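(* Let $\varphi:\mathbb N\to\mathbb R^+$ satisfy $\sum_{k\ge0}\varphi(k)=1$ and $\sum_{k\ge0}k^2\varphi(k)<\infty$, and put $\phi(x):=\sum_{k=x}^\infty\varphi(k)$. 1. (a) For all $n\in\mathbb N$ and $\Lambda_n\in\mathcal F_n$, $$\lim_{p\to\infty}\frac{\mathbb E[\mathbf 1_{\Lambda_n}\varphi(S^*_{g_p})]}{\mathbb E[\varphi(S^*_{g_p})]}=\mathbb E[\mathbf 1_{\Lambda_n}M_n^*],\qquad M_n^*:=\varphi(S^*_{g_n})|X_n|+\varphi(S_n^* )(S_n^*-|X_n|)+\phi(S_n^* ).$$ (b) $(M_n^*,n\ge0)$ is a positive $(\mathcal F_n)$-martingale under $\mathbb P$ which is not uniformly integrable. 2. Let $Q^*$ be the probability on $(\Omega,\mathcal F_\infty)$ characterized by $Q^*(\Lambda_n)=\mathbb E[\mathbf 1_{\Lambda_n}M_n^*]$ for all $n\in\mathbb N$, $\Lambda_n\in\mathcal F_n$. Under $Q^*$: (a) with $g:=\sup\{k\ge0:X_k=0\}$ and $S^*_\infty:=\sup_{k\ge0}|X_k|$, almost surely $g<\infty$ and $S^*_\infty=\infty$; (b) for all integers $a\ge1$, $k\ge0$, $$Q^*(\gamma_g=a,S^*_g=k)=\begin{cases}\varphi(0)&\text{if }k=0,\ a=1,\\ 0&\text{if }k=0,\ a>1,\\ \left\{\left(1-\frac1{k+1}\right)^{a-1}-\left(1-\frac1k\right)^{a-1}\right\}\varphi(k)&\text{if }k\ge1,\ a>1,\\ 0&\text{if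 }k\ge1,\ a=1;\end{cases}$$ consequently $Q^*(S^*_g=k)=\varphi(k)$ for all $k\in\mathbb N$. 3. Under $Q^*$: (a) $(X_n,n\le g)$ and $(X_n,n>g)$ are two independent processes; (b) with probability $\frac12$ the process $(X_{g+n},n\ge1)$ is a 3-Bessel* walk started from $1$, and with probability $\frac12$ the process $(-X_{g+n},n\ge1)$ is a 3-Bessel* walk started from $1$ (that is, $Q^*(X_{g+1}=1)=Q^*(X_{g+1}=-1)=\frac12$, and conditionally on $X_{g+1}=1$, resp. $X_{g+1}=-1$, the process $(X_{g+n},n\ge1)$, resp. $(-X_{g+n},n\ge1)$, is a 3-Bessel* walk started from $1$); (c) conditionally on $\gamma_g=a$ and $S^*_g=b$, the process $(X_n,n\le g)$ is distributed as the symmetric random walk started from $0$ (law $\mathbb P$), stopped at $\tau_a$ and conditioned on $S^*_{\tau_a}=b$.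
   Context: $\mathbb N=\{0,1,2,\dots\}$. $\Omega$ is the set of paths $\omega:\mathbb N\to\mathbb Z$ with $|\omega(n+1)-\omega(n)|=1$; $X=(X_n)_{n\ge0}$ is the coordinate process, $\mathcal F_n=\sigma(X_0,\dots,X_n)$, $\mathcal F_\infty=\bigvee_n\mathcal F_n$. $\mathbb P=\mathbb P_0$ is the law under which $X$ is the simple symmetric random walk on $\mathbb Z$ started from $0$, with expectation $\mathbb E$. $S^*_n:=\max_{0\le k\le n}|X_k|$; $g_p:=\sup\{k\le p:X_k=0\}$; $\gamma_n:=\sum_{k=0}^n\mathbf 1_{X_k=0}$ (time $0$ is counted); $\tau_a:=\inf\{n\ge0:\gamma_n=a\}$. "Positive" means nonnegative. $(X_n,n>g)$ is understood as the process $(X_{g+n})_{n\ge1}$. Conditional statements are for conditioning events of positive probability. The 3-Bessel* walk is the Markov chain on $\{1,2,\dots\}$ with transition probabilities $\pi^*(x,x+1)=\frac{x+1}{2x}$, $\pi^*(x,x-1)=\frac{x-1}{2x}$ for $x\ge1$. *)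

theory Defs
  imports "HOL-Probability.Probability"
begin

definition paths :: "(nat \<Rightarrow> int) set" where
  "paths = {\<omega>. \<forall>n. \<bar>\<omega> (Suc n) - \<omega> n\<bar> = 1}"

definition cF :: "nat \<Rightarrow> (nat \<Rightarrow> int) measure" where
  "cF n = sigma paths {{\<omega> \<in> paths. \<omega> k \<in> A} | k A. k \<le> n}"

definition cF_inf :: "(nat \<Rightarrow> int) measure" where
  "cF_inf = sigma paths (\<Union>n. sets (cF n))"

definition SRW :: "(nat \<Rightarrow> int) measure" where
  "SRW = distr (PiM UNIV (\<lambda>_::nat. uniform_count_measure {-1, 1::int})) cF_inf
           (\<lambda>\<xi> n. \<Sum>i<n. \<xi> i)"

definition Smax :: "nat \<Rightarrow> (nat \<Rightarrow> int) \<Rightarrow> nat" where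
  "Smax n \<omega> = Max ((\<lambda>k. nat \<bar>\<omega> k\<bar>) ` {0..n})"

definition Smax_inf :: "(nat \<Rightarrow> int) \<Rightarrow> enat" where
  "Smax_inf \<omega> = (SUP k. enat (nat \<bar>\<omega> k\<bar>))"

text \<open>On \<^typ>\<open>nat\<close> the supremum of the empty set is 0; this case only concerns paths not
  started at 0, which are null for the laws considered here.\<close>

definition last_zero_upto :: "nat \<Rightarrow> (nat \<Rightarrow> int) \<Rightarrow> nat" where
  "last_zero_upto p \<omega> = Sup {k. k \<le> p \<and> \<omega> k = 0}"

definition last_zero :: "(nat \<Rightarrow> int) \<Rightarrow> enat" where
  "last_zero \<omega> = Sup {enat k | k. \<omega> k = 0}"

definition num_zeros :: "nat \<Rightarrow> (nat \<Rightarrow> int) \<Rightarrow> nat" where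
  "num_zeros n \<omega> = (\<Sum>k=0..n. of_bool (\<omega> k = 0))"

definition tau :: "nat \<Rightarrow> (nat \<Rightarrow> int) \<Rightarrow> enat" where
  "tau a \<omega> = Inf {enat n | n. num_zeros n \<omega> = a}"

text \<open>The random times \<^const>\<open>last_zero\<close> and \<^const>\<open>tau\<close> may be infinite. To evaluate a process at
  them they are converted to \<^typ>\<open>nat\<close>; the value at infinity is unspecified, and it matters
  only on null sets, since the last zero is almost surely finite under \<open>Q\<close> and \<open>tau a\<close> (for
  positive \<open>a\<close>) is almost surely finite under \<^const>\<open>SRW\<close>.\<close>

abbreviation g_time :: "(nat \<Rightarrow> int) \<Rightarrow> nat" where
  "g_time \<omega> \<equiv> the_enat (last_zero \<omega>)"

abbreviation tau_time :: "nat \<Rightarrow> (nat \<Rightarrow> int) \<Rightarrow> nat" where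
  "tau_time a \<omega> \<equiv> the_enat (tau a \<omega>)"

text \<open>The process \<open>(X\<^sub>n, n \<le> m)\<close>, with \<open>m\<close> possibly a random time, is the finite word
  \<open>[X\<^sub>0, \<dots>, X\<^sub>m]\<close>, a random element of the countable set of integer lists.\<close>

definition path_upto :: "nat \<Rightarrow> (nat \<Rightarrow> int) \<Rightarrow> int list" where
  "path_upto m \<omega> = map \<omega> [0..<Suc m]"

text \<open>The process \<open>(X\<^sub>m\<^sub>+\<^sub>n, n \<ge> 1)\<close>, reindexed to start at index 0.\<close>

definition path_after :: "nat \<Rightarrow> (nat \<Rightarrow> int) \<Rightarrow> nat \<Rightarrow> int" where
  "path_after m \<omega> = (\<lambda>n. \<omega> (m + Suc n))"

definition martingale :: "'a measure \<Rightarrow> (nat \<Rightarrow> 'a measure) \<Rightarrow> (nat \<Rightarrow> 'a \<Rightarrow> real) \<Rightarrow> bool" where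
  "martingale M F Z \<longleftrightarrow>
     prob_space M \<and> filtration (space M) F \<and> (\<forall>n. subalgebra M (F n)) \<and>
     (\<forall>n. Z n \<in> borel_measurable (F n)) \<and> (\<forall>n. integrable M (Z n)) \<and>
     (\<forall>m n. m \<le> n \<longrightarrow> (AE x in M. real_cond_exp M (F m) (Z n) x = Z m x))"

definition uniformly_integrable :: "'a measure \<Rightarrow> (nat \<Rightarrow> 'a \<Rightarrow> real) \<Rightarrow> bool" where
  "uniformly_integrable M Z \<longleftrightarrow>
     (\<forall>n. Z n \<in> borel_measurable M) \<and>
     ((\<lambda>c::real. SUP n. \<integral>\<^sup>+x. ennreal \<bar>Z n x\<bar> * indicator {x. \<bar>Z n x\<bar> > c} x \<partial>M) \<longlongrightarrow> 0) at_top"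

text \<open>Only histories \<open>h\<close> of positive probability are conditioned on; they lie in \<open>S\<close>, so values
  of the kernel \<open>K\<close> outside \<open>S\<close> are irrelevant.\<close>

definition markov_chain ::
  "'a measure \<Rightarrow> int set \<Rightarrow> (int \<Rightarrow> int \<Rightarrow> real) \<Rightarrow> int \<Rightarrow> (nat \<Rightarrow> 'a \<Rightarrow> int) \<Rightarrow> bool" where
  "markov_chain M S K x Y \<longleftrightarrow>
     prob_space M \<and> (\<forall>n. Y n \<in> measurable M (count_space UNIV)) \<and>
     (AE \<omega> in M. \<forall>n. Y n \<omega> \<in> S) \<and> (AE \<omega> in M. Y 0 \<omega> = x) \<and>
     (\<forall>n h. \<forall>y\<in>S. \<P>(\<omega> in M. \<forall>i\<le>n. Y i \<omega> = h i) > 0 \<longrightarrow>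
        cond_prob M (\<lambda>\<omega>. Y (Suc n) \<omega> = y) (\<lambda>\<omega>. \<forall>i\<le>n. Y i \<omega> = h i) = K (h n) y)"

definition bessel3_star :: "int \<Rightarrow> int \<Rightarrow> real" where
  "bessel3_star x y =
     (if y = x + 1 then (x + 1) / (2 * x) else if y = x - 1 then (x - 1) / (2 * x) else 0)"

definition bessel3_star_walk :: "'a measure \<Rightarrow> int \<Rightarrow> (nat \<Rightarrow> 'a \<Rightarrow> int) \<Rightarrow> bool" where
  "bessel3_star_walk M x Y \<longleftrightarrow> markov_chain M {1..} bessel3_star x Y"

definition tail_sum :: "(nat \<Rightarrow> real) \<Rightarrow> nat \<Rightarrow> real" where
  "tail_sum \<phi> x = (\<Sum>k. \<phi> (x + k))"

definition Mstar :: "(nat \<Rightarrow> real) \<Rightarrow> nat \<Rightarrow> (nat \<Rightarrow> int) \<Rightarrow> real" where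
  "Mstar \<phi> n \<omega> =
     \<phi> (Smax (last_zero_upto n \<omega>) \<omega>) * \<bar>real_of_int (\<omega> n)\<bar>
     + \<phi> (Smax n \<omega>) * (real (Smax n \<omega>) - \<bar>real_of_int (\<omega> n)\<bar>)
     + tail_sum \<phi> (Smax n \<omega>)"

definition is_Qstar :: "(nat \<Rightarrow> real) \<Rightarrow> (nat \<Rightarrow> int) measure \<Rightarrow> bool" where
  "is_Qstar \<phi> Q \<longleftrightarrow>
     prob_space Q \<and> space Q = paths \<and> sets Q = sets cF_inf \<and>
     (\<forall>n. \<forall>\<Lambda>\<in>sets (cF n). measure Q \<Lambda> = (\<integral>\<omega>. indicator \<Lambda> \<omega> * Mstar \<phi> n \<omega> \<partial>SRW))"

end

theory Submission
  imports Defs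
begin

text \<open>Splitting at the last zero before \<open>p\<close> writes the mean of \<open>\<phi>(S*\<^sub>g\<^sub>p)\<close>, given the first \<open>n\<close> steps, as
  \<open>\<phi>(S*\<^sub>g\<^sub>n)\<close> times the probability of no further zero, plus the convolution of
  \<open>b\<^sub>j = E[\<phi>(S*\<^sub>j); X\<^sub>j = 0]\<close> with the probability \<open>r\<^sub>m\<close> of no return to 0 within \<open>m\<close> steps. The
  explicit \<open>r\<^sub>m\<close> (a central binomial weight) varies regularly, and the second moment of \<open>\<phi>\<close> gives
  \<open>b\<^sub>j = o(1 / j)\<close>. Hence division by \<open>r\<close> leaves \<open>\<phi>(S*\<^sub>g) \<bar>X\<bar>\<close> plus the sum of the \<open>b\<^sub>j\<close>, which a discrete
  potential evaluates to \<open>\<phi>(S*) (S* - \<bar>X\<bar>)\<close> plus the tail of \<open>\<phi>\<close> at \<open>S*\<close>.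

  Under \<open>Q\<close>, the function \<open>\<bar>x\<bar>\<close>, harmonic for the walk killed at 0, shows that a word \<open>h\<close> of \<open>n\<close> steps is
  followed without any later zero with probability \<open>\<phi>(S*\<^sub>g) \<bar>h\<^sub>n\<bar> / 2\<^sup>n\<close> (with \<open>\<bar>h\<^sub>n\<bar>\<close> replaced by 1 at a zero).
  These weights factor at the last zero, which yields the joint law of \<open>\<gamma>\<^sub>g\<close> and \<open>S*\<^sub>g\<close>, the independence,
  the 3-Bessel* walk and the conditional law together.\<close>

section \<open>Survival probabilities\<close>

text \<open>Expectations are finite averages over the extensions of a word
  (\<open>walk_mean\<close>), so that the Markov property is a recursion and measure theory enters
  only with the laws themselves. Words, not positions, are the states, because the maximum and its
  value at the last zero depend on the past. The sum of the \<open>b\<^sub>j\<close> and the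
  probability of a given number of zeros within a range are found by one scheme: the reward is the
  one-step drop of a potential, and the mean of the potential after J steps vanishes because it is
  small on words with a large maximum and such words prevail. The sum of the
  \<open>b\<^sub>j\<close> from the start has two roles. It equals 1, which normalizes the
  martingale, and it is the mass under Q of the paths with a last zero, so that the last zero is
  almost surely finite. An obstacle to \<open>b\<^sub>j = o(1 / j)\<close> is that \<phi> need not
  be monotone and that zeros obey parity. The decay is therefore proved for the tail of \<phi>,
  which is monotone and dominates \<phi>; the second moment makes it summable against 2 k +
  1.\<close>

primrec survival :: "nat \<Rightarrow> int \<Rightarrow> real" where
  "survival 0 x = of_bool (x \<noteq> 0)"
| "survival (Suc m) x = (if x = 0 then 0 else (survival m (x + 1) + survival m (x - 1)) / 2)"

text \<open>The walk from 0 has to avoid 0 from time 1 on, and by symmetry its first step may be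
  taken to 1. \<open>survival\<close> cannot serve directly, since it counts time 0 and vanishes at
  0.\<close>

definition no_return :: "nat \<Rightarrow> real" where
  "no_return m = (case m of 0 \<Rightarrow> 1 | Suc l \<Rightarrow> survival l 1)"

lemma no_return_simps [simp]: "no_return 0 = 1" "no_return (Suc m) = survival m 1"
  by (simp_all add: no_return_def)

lemma survival_zero [simp]: "survival m 0 = 0"
  by (cases m) simp_all

lemma survival_uminus: "survival m (- x) = survival m x"
proof (induction m arbitrary: x)
  case (Suc m)
  have "survival m (- x + 1) = survival m (x - 1)" "survival m (- x - 1) = survival m (x + 1)"
    using Suc[of "x - 1"] Suc[of "x + 1"] by (simp_all add: algebra_simps minus_diff_commute[of x])
  then show ?case by (simp only: survival.simps neg_equal_0_iff_equal add.commute)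
qed simp

lemma survival_abs: "survival m \<bar>x\<bar> = survival m x"
  by (simp add: abs_if survival_uminus)

text \<open>The probability that a walk from y is at 0 at time m, not necessarily for the first
  time. Likewise \<open>walk_cdf\<close> is the probability that a walk from x is nonnegative at
  time m, by symmetry a distribution function.\<close>

primrec hit_prob :: "nat \<Rightarrow> int \<Rightarrow> real" where
  "hit_prob 0 y = of_bool (y = 0)"
| "hit_prob (Suc m) y = (hit_prob m (y + 1) + hit_prob m (y - 1)) / 2"

primrec walk_cdf :: "nat \<Rightarrow> int \<Rightarrow> real" where
  "walk_cdf 0 x = of_bool (0 \<le> x)"
| "walk_cdf (Suc m) x = (walk_cdf m (x + 1) + walk_cdf m (x - 1)) / 2"

lemma walk_cdf_diff: "walk_cdf m x - walk_cdf m (x - 1) = hit_prob m x"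
proof (induction m arbitrary: x)
  case (Suc m)
  show ?case using Suc[of "x + 1"] Suc[of "x - 1"] by (simp add: algebra_simps)
qed auto

text \<open>The reflection principle: both sides solve the same recursion, and the right-hand side vanishes at 0
  by antisymmetry.\<close>

lemma survival_eq_walk_cdf: "0 \<le> x \<Longrightarrow> survival m x = walk_cdf m x - walk_cdf m (- x)"
proof (induction m arbitrary: x)
  case (Suc m)
  show ?case
  proof (cases "x = 0")
    case False
    then have "0 \<le> x - 1" "0 \<le> x + 1" using Suc.prems by auto
    note IH = Suc.IH[OF this(1)] Suc.IH[OF this(2)]
    have *: "- x + 1 = - (x - 1)" "- x - 1 = - (x + 1)" by simp_all
    show ?thesis using False unfolding survival.simps walk_cdf.simps * IH by (simp add: field_simps)
  qed simp
qed auto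

text \<open>Parity annihilates one of the two summands, so survival from 1 is a single binomial
  weight.\<close>

lemma survival_one: "survival m 1 = hit_prob m 1 + hit_prob m 0"
  using walk_cdf_diff[of m 1] walk_cdf_diff[of m 0] by (simp add: survival_eq_walk_cdf)

lemma hit_prob_outside: "y < - int m \<Longrightarrow> hit_prob m y = 0"
proof (induction m arbitrary: y)
  case (Suc m)
  show ?case using Suc.IH[of "y + 1"] Suc.IH[of "y - 1"] Suc.prems by simp
qed simp

lemma hit_prob_parity: "odd (int m + y) \<Longrightarrow> hit_prob m y = 0"
proof (induction m arbitrary: y)
  case (Suc m)
  show ?case using Suc.IH[of "y + 1"] Suc.IH[of "y - 1"] Suc.prems by simp
qed auto

text \<open>From 2 k - m, a walk ends at 0 after m steps exactly when k of them go down.\<close>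

lemma hit_prob_binomial: "hit_prob m (2 * int k - int m) = real (m choose k) / 2 ^ m"
proof (induction m arbitrary: k)
  case 0
  show ?case by (cases k) auto
next
  case (Suc m)
  have up: "hit_prob m (2 * int k - int (Suc m) + 1) = real (m choose k) / 2 ^ m"
    using Suc[of k] by (simp add: algebra_simps)
  show ?case
  proof (cases k)
    case 0
    have "hit_prob m (2 * int k - int (Suc m) - 1) = 0"
      using 0 by (intro hit_prob_outside) simp
    then show ?thesis using up 0 by (simp add: algebra_simps)
  next
    case (Suc j)
    have "hit_prob m (2 * int k - int (Suc m) - 1) = real (m choose j) / 2 ^ m"
      using Suc.IH[of j] Suc by (simp add: algebra_simps)
    then show ?thesis using up Suc by (simp add: field_simps)
  qed
qed

text \<open>The return probability at time 2 l. As \<open>no_return\<close> takes this value at both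
  2 l and 2 l + 1, its asymptotics reduce to the ratio in \<open>central_Suc\<close>.\<close>

definition central :: "nat \<Rightarrow> real" where
  "central l = real (2 * l choose l) / 4 ^ l"

lemma central_0 [simp]: "central 0 = 1" by (simp add: central_def)

lemma central_pos: "0 < central l"
  by (simp add: central_def)

lemma central_odd: "real (2 * l + 1 choose (l + 1)) / 2 ^ (2 * l + 1) = central (Suc l)"
proof -
  have "(2 * l + 1 choose (l + 1)) = (2 * l + 1 choose l)"
    using binomial_symmetric[of l "2 * l + 1"] by simp
  then have *: "(2 * Suc l choose Suc l) = 2 * (2 * l + 1 choose (l + 1))"
    by simp
  show ?thesis unfolding central_def * by (simp add: power_mult del: binomial_Suc_Suc)
qed

lemma central_Suc: "central (Suc l) = central l * (2 * real l + 1) / (2 * real l + 2)"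
proof -
  have "Suc l * (Suc (2 * l) choose Suc l) = Suc (2 * l) * (2 * l choose l)"
    using Suc_times_binomial_eq[of "2 * l" l] by (simp add: mult.commute)
  then have "real (Suc l) * real (Suc (2 * l) choose Suc l) = real (Suc (2 * l)) * real (2 * l choose l)"
    by (metis of_nat_mult)
  then have "real (2 * l + 1 choose (l + 1)) = (2 * real l + 1) * real (2 * l choose l) / (real l + 1)"
    by (simp add: field_simps)
  then have "central (Suc l) = ((2 * real l + 1) * real (2 * l choose l) / (real l + 1)) / 2 ^ (2 * l + 1)"
    by (metis central_odd)
  moreover have "(2::real) ^ (2 * l + 1) = 2 * 4 ^ l" by (simp add: power_mult)
  ultimately show ?thesis
    by (simp only: central_def) (simp add: divide_simps)
qed

lemma no_return_odd: "no_return (Suc (2 * l)) = central l"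
proof -
  have "hit_prob (2 * l) 1 = 0" by (rule hit_prob_parity) simp
  moreover have "hit_prob (2 * l) 0 = central l"
    using hit_prob_binomial[of "2 * l" l] by (simp add: central_def power_mult)
  ultimately show ?thesis by (simp add: survival_one)
qed

lemma no_return_even: "no_return (2 * l) = central l"
proof (cases l)
  case (Suc j)
  have "hit_prob (2 * j + 1) 0 = 0" by (rule hit_prob_parity) simp
  moreover have "hit_prob (2 * j + 1) 1 = central (Suc j)"
    using hit_prob_binomial[of "2 * j + 1" "j + 1"] central_odd[of j]
    by (simp del: binomial_Suc_Suc hit_prob.simps)
  ultimately show ?thesis using Suc by (simp add: survival_one del: hit_prob.simps)
qed simp

lemma no_return_pos: "0 < no_return m"
  by (cases "even m") (auto elim!: evenE oddE simp del: no_return_simps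
      simp: no_return_even no_return_odd central_pos)

lemma no_return_Suc_le: "no_return (Suc m) \<le> no_return m"
proof (cases "even m")
  case True
  then obtain l where "m = 2 * l" by (elim evenE)
  then show ?thesis by (simp only: no_return_odd no_return_even)
next
  case False
  then obtain l where l: "m = 2 * l + 1" by (elim oddE)
  have "no_return (Suc m) = central (Suc l)"
    using no_return_even[of "Suc l"] l by (simp del: no_return_simps)
  moreover have "no_return m = central l" using no_return_odd[of l] l by (simp del: no_return_simps)
  moreover have "central (Suc l) \<le> central l"
    using central_pos[of l] unfolding central_Suc by (simp add: field_simps)
  ultimately show ?thesis by simp
qed

text \<open>An equality for odd m, while for even m the two values of \<open>no_return\<close>
  coincide. It forces the ratio of successive values to 1.\<close>

lemma no_return_Suc_ge: "no_return m * real m / (real m + 1) \<le> no_return (Suc m)"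
proof (cases "even m")
  case True
  then obtain l where "m = 2 * l" by (elim evenE)
  then show ?thesis using central_pos[of l]
    by (simp only: no_return_odd no_return_even) (simp add: field_simps)
next
  case False
  then obtain l where l: "m = 2 * l + 1" by (elim oddE)
  have "no_return (Suc m) = central (Suc l)"
    using no_return_even[of "Suc l"] l by (simp del: no_return_simps)
  moreover have "no_return m = central l" using no_return_odd[of l] l by (simp del: no_return_simps)
  ultimately show ?thesis using l by (simp add: central_Suc field_simps)
qed

section \<open>Regular variation of the no-return probabilities\<close>

lemma decseq_no_return: "decseq no_return"
  by (simp add: decseq_Suc_iff no_return_Suc_le del: no_return_simps)

lemma no_return_ratio_Suc: "(\<lambda>m. no_return (Suc m) / no_return m) \<longlonglongrightarrow> 1"
proof (rule tendsto_sandwich)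
  show "(\<lambda>m. real m / (real m + 1)) \<longlonglongrightarrow> 1"
    using LIMSEQ_n_over_Suc_n by (simp add: add.commute)
  show "(\<lambda>m. 1 :: real) \<longlonglongrightarrow> 1" by simp
  show "\<forall>\<^sub>F m in sequentially. real m / (real m + 1) \<le> no_return (Suc m) / no_return m"
    using no_return_Suc_ge no_return_pos by (intro always_eventually) (simp add: field_simps del: no_return_simps)
  show "\<forall>\<^sub>F m in sequentially. no_return (Suc m) / no_return m \<le> 1"
    using no_return_Suc_le no_return_pos by (intro always_eventually) (simp add: field_simps del: no_return_simps)
qed

lemma no_return_ratio: "(\<lambda>m. no_return m / no_return (m + j)) \<longlonglongrightarrow> 1"
proof (induction j)
  case 0
  have "no_return m / no_return m = 1" for m using no_return_pos[of m] by simp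
  then show ?case by simp
next
  case (Suc j)
  have "(\<lambda>m. inverse (no_return (Suc (m + j)) / no_return (m + j))) \<longlonglongrightarrow> inverse 1"
    by (intro tendsto_inverse LIMSEQ_ignore_initial_segment[OF no_return_ratio_Suc]) simp
  from tendsto_mult[OF Suc this]
  show ?case using no_return_pos
    by (simp add: field_simps less_imp_neq[THEN not_sym] del: no_return_simps)
qed

text \<open>Each central weight occurs twice, and the sum telescopes: (2 l + 1)
  \<open>central l\<close> equals (2 l + 2) \<open>central (Suc l)\<close>, so adding
  \<open>central (Suc l)\<close> gives the factor 2 l + 3.\<close>

lemma sum_no_return_odd: "(\<Sum>i\<le>Suc (2 * l). no_return i) = 2 * (2 * real l + 1) * central l"
proof (induction l)
  case 0
  show ?case by simp
next
  case (Suc l)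
  have step: "(2 * real l + 1) * central l = (2 * real l + 2) * central (Suc l)"
    unfolding central_Suc by (simp add: field_simps)
  have "(\<Sum>i\<le>Suc (2 * Suc l). no_return i)
      = (\<Sum>i\<le>Suc (2 * l). no_return i) + no_return (2 * Suc l) + no_return (Suc (2 * Suc l))"
    by (simp del: no_return_simps)
  also have "\<dots> = 2 * (2 * real (Suc l) + 1) * central (Suc l)"
    unfolding Suc no_return_even no_return_odd mult.assoc step by (simp add: algebra_simps)
  finally show ?case .
qed

text \<open>A bound of Karamata type: a sequence decaying like the inverse square root has partial
  sums of the order m times the last term. An even m is padded to m + 1 to use the closed
  form.\<close>

lemma sum_no_return_le: "(\<Sum>i\<le>m. no_return i) \<le> 2 * (real m + 1) * no_return m"
proof (cases "even m")
  case True
  then obtain l where l: "m = 2 * l" by (elim evenE)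
  have "(\<Sum>i\<le>m. no_return i) \<le> (\<Sum>i\<le>Suc (2 * l). no_return i)"
    using no_return_pos l by (intro sum_mono2) (auto intro: less_imp_le simp del: no_return_simps)
  then show ?thesis using l by (simp add: sum_no_return_odd no_return_even del: no_return_simps sum.atMost_Suc)
next
  case False
  then obtain l where l: "m = Suc (2 * l)" by (auto elim: oddE)
  show ?thesis unfolding l sum_no_return_odd no_return_odd using central_pos[of l]
    by (simp add: field_simps)
qed

lemma no_return_tendsto_0: "no_return \<longlonglongrightarrow> 0"
proof -
  \<comment> \<open>Wallis: the left side decreases in l, because (2 l + 1) (2 l + 3) is at most the
    square of 2 l + 2.\<close>
  have c: "(central l)\<^sup>2 * (2 * real l + 1) \<le> 1" for l
  proof (induction l)
    case (Suc l)
    have "(central (Suc l))\<^sup>2 * (2 * real (Suc l) + 1)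
        = ((central l)\<^sup>2 * (2 * real l + 1)) * ((2 * real l + 1) * (2 * real l + 3) / (2 * real l + 2)\<^sup>2)"
      by (simp add: central_Suc power2_eq_square field_simps)
    also have "\<dots> \<le> 1 * 1"
    proof (intro mult_mono Suc)
      have "(2 * real l + 1) * (2 * real l + 3) \<le> (2 * real l + 2)\<^sup>2"
        by (simp add: power2_eq_square algebra_simps)
      then show "(2 * real l + 1) * (2 * real l + 3) / (2 * real l + 2)\<^sup>2 \<le> 1"
        by (simp add: divide_le_eq)
    qed auto
    finally show ?case by simp
  qed simp
  have sq: "(no_return m)\<^sup>2 \<le> 1 / real m" if "m > 0" for m
  proof (cases "even m")
    case True
    then obtain l where "m = 2 * l" by (elim evenE)
    moreover have "(central l)\<^sup>2 * (2 * real l) \<le> 1"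
      by (rule order_trans[OF mult_left_mono c[of l]]) auto
    moreover have "no_return m = central l" using \<open>m = 2 * l\<close> by (simp only: no_return_even)
    ultimately show ?thesis using that by (simp add: field_simps)
  next
    case False
    then obtain l where "m = Suc (2 * l)" by (auto elim: oddE)
    moreover from this have "no_return m = central l" by (simp only: no_return_odd)
    ultimately show ?thesis using c[of l] by (simp add: field_simps)
  qed
  have "(\<lambda>m. (no_return m)\<^sup>2) \<longlonglongrightarrow> 0"
  proof (rule tendsto_sandwich[where f = "\<lambda>_. 0" and h = "\<lambda>m. 1 / real m"])
    show "\<forall>\<^sub>F m in sequentially. (no_return m)\<^sup>2 \<le> 1 / real m"
      by (rule eventually_mono[OF eventually_gt_at_top[of 0]]) (rule sq)
    show "(\<lambda>m. 1 / real m) \<longlonglongrightarrow> 0" by (rule lim_1_over_n)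
  qed auto
  from tendsto_real_sqrt[OF this] show ?thesis
    using no_return_pos by (simp add: less_imp_le del: no_return_simps)
qed

text \<open>The recursion, solved for the far neighbour, gives the value at j + 2 from those at j +
  1 and j. The time shift disappears in the limit, and 2 (j + 1) - j = j + 2 remains.\<close>

lemma survival_ratio: "(\<lambda>m. survival m x / no_return m) \<longlonglongrightarrow> \<bar>real_of_int x\<bar>"
proof -
  have "(\<lambda>m. survival m (int k) / no_return m) \<longlonglongrightarrow> real k" for k
  proof (induction k rule: less_induct)
    case (less k)
    consider "k = 0" | "k = 1" | j where "k = Suc (Suc j)" by (metis One_nat_def old.nat.exhaust)
    then show ?case
    proof cases
      case 1
      then show ?thesis by simp
    next
      case 2
      then show ?thesis using no_return_ratio_Suc by simp
    next
      case (3 j)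
      have rec: "survival m (int k) = 2 * survival (Suc m) (int (Suc j)) - survival m (int j)" for m
        by (simp add: 3 algebra_simps)
      have "(\<lambda>m. (survival (Suc m) (int (Suc j)) / no_return (Suc m)) * (no_return (Suc m) / no_return m))
            \<longlonglongrightarrow> real (Suc j) * 1"
        by (intro tendsto_mult no_return_ratio_Suc LIMSEQ_Suc[OF less]) (simp add: 3)
      moreover have "(survival (Suc m) (int (Suc j)) / no_return (Suc m)) * (no_return (Suc m) / no_return m)
          = survival (Suc m) (int (Suc j)) / no_return m" for m
        using no_return_pos[of "Suc m"] by (simp del: no_return_simps survival.simps)
      ultimately have *: "(\<lambda>m. survival (Suc m) (int (Suc j)) / no_return m) \<longlonglongrightarrow> real (Suc j)"
        by (simp only: mult_1_right)
      have "(\<lambda>m. 2 * (survival (Suc m) (int (Suc j)) / no_return m) - survival m (int j) / no_return m)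
            \<longlonglongrightarrow> 2 * real (Suc j) - real j"
        by (intro tendsto_diff tendsto_mult_left less *) (simp add: 3)
      then show ?thesis unfolding rec
        by (simp add: 3 diff_divide_distrib add.commute[of 2])
    qed
  qed
  from this[of "nat \<bar>x\<bar>"] show ?thesis by (simp add: survival_abs)
qed

text \<open>Doubling from the bound on sums: at least (m + 1) / 2 terms are no smaller than
  \<open>no_return (m div 2)\<close>, and the whole sum is at most 2 (m + 1)
  \<open>no_return m\<close>.\<close>

lemma no_return_half_le: "no_return (m div 2) \<le> 4 * no_return m"
proof -
  have "(real m / 2) * no_return (m div 2) + no_return (m div 2) / 2\<le> real (m div 2 + 1) * no_return (m div 2)"
  proof -
    have "real m / 2 + 1/2 \<le> real (m div 2 + 1)" by linarith
    from mult_right_mono[OF this less_imp_le[OF no_return_pos[of "m div 2"]]] show ?thesis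
      by (simp add: algebra_simps del: no_return_simps)
  qed
  also have "\<dots> = (\<Sum>i\<le>m div 2. no_return (m div 2))" by simp
  also have "\<dots> \<le> (\<Sum>i\<le>m div 2. no_return i)"
    using decseq_no_return by (intro sum_mono) (auto simp: decseq_def)
  also have "\<dots> \<le> (\<Sum>i\<le>m. no_return i)"
    using no_return_pos by (intro sum_mono2) (auto intro: less_imp_le simp del: no_return_simps)
  also have "\<dots> \<le> 2 * (real m + 1) * no_return m" by (rule sum_no_return_le)
  finally have "(real m + 1) * no_return (m div 2) \<le> (real m + 1) * (4 * no_return m)"
    by (simp add: algebra_simps del: no_return_simps)
  then show ?thesis by (rule mult_left_le_imp_le) simp
qed

text \<open>In the convolution the indices above \<open>m / 2\<close> are negligible because \<open>b j = o(1 / j)\<close>,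
  while the remaining ones are dominated since \<^const>\<open>no_return\<close> varies regularly.\<close>

lemma convolution_no_return:
  fixes b :: "nat \<Rightarrow> real"
  assumes b0: "\<And>j. 0 \<le> b j" and bs: "b sums B" and jb: "(\<lambda>j. real j * b j) \<longlonglongrightarrow> 0"
  shows "(\<lambda>m. (\<Sum>j\<le>m. b j * no_return (m - j)) / no_return m) \<longlonglongrightarrow> B"
proof -
  let ?r = no_return
  define low where "low m = (\<Sum>j\<le>m div 2. b j * ?r (m - j)) / ?r m" for m
  define high where "high m = (\<Sum>j\<in>{m div 2<..m}. b j * ?r (m - j)) / ?r m" for m
  have split: "(\<Sum>j\<le>m. b j * ?r (m - j)) / ?r m = low m + high m" for m
  proof -
    have "{..m} = {..m div 2} \<union> {m div 2<..m}" by auto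
    then have "(\<Sum>j\<le>m. b j * ?r (m - j)) = (\<Sum>j\<le>m div 2. b j * ?r (m - j)) + (\<Sum>j\<in>{m div 2<..m}. b j * ?r (m - j))"
      by (subst sum.union_disjoint[symmetric]) auto
    then show ?thesis by (simp add: low_def high_def add_divide_distrib)
  qed
  have r0: "0 < ?r m" for m by (rule no_return_pos)
  have mono: "?r n \<le> ?r m" if "m \<le> n" for m n using decseq_no_return that by (auto simp: decseq_def)
  have "low \<longlonglongrightarrow> (\<Sum>j. b j)"
  proof -
    define f where "f j m = (if j \<le> m div 2 then b j * ?r (m - j) / ?r m else 0)" for j m
    \<comment> \<open>The majorant for Tannery's theorem: k at most m div 2 leaves m - k at least m
      div 2, where the doubling bound applies.\<close>
    have "norm (f k m) \<le> 4 * b k" for k m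
    proof (cases "k \<le> m div 2")
      case True
      have "?r (m - k) \<le> ?r (m div 2)" using True by (intro mono) linarith
      also have "\<dots> \<le> 4 * ?r m" by (rule no_return_half_le)
      finally have "?r (m - k) / ?r m \<le> 4" using r0[of m] by (simp add: field_simps del: no_return_simps)
      from mult_left_mono[OF this b0[of k]] show ?thesis
        using True b0[of k] r0[of m] r0[of "m - k"] by (simp add: f_def mult.commute del: no_return_simps)
    qed (simp add: f_def b0)
    then have "\<forall>\<^sub>F (k, n) in at_top \<times>\<^sub>F sequentially. norm (f k n) \<le> 4 * b k"
      by (intro always_eventually) auto
    moreover have "(f k \<longlongrightarrow> b k) sequentially" for k
    proof -
      have "(\<lambda>m. b k * (?r m / ?r (m + k))) \<longlonglongrightarrow> b k * 1"
        by (intro tendsto_mult no_return_ratio tendsto_const)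
      then have "(\<lambda>m. b k * (?r (m + k - k) / ?r (m + k))) \<longlonglongrightarrow> b k" by (simp del: no_return_simps)
      then have "(\<lambda>m. b k * (?r (m - k) / ?r m)) \<longlonglongrightarrow> b k" by (rule LIMSEQ_offset)
      moreover have "\<forall>\<^sub>F m in sequentially. b k * (?r (m - k) / ?r m) = f k m"
        using eventually_ge_at_top[of "2 * k"] by eventually_elim (auto simp: f_def)
      ultimately show ?thesis by (rule Lim_transform_eventually)
    qed
    moreover have "summable (\<lambda>k. 4 * b k)" using bs by (intro summable_mult) (simp add: sums_iff)
    ultimately have "(\<lambda>m. \<Sum>k. f k m) \<longlonglongrightarrow> (\<Sum>k. b k)"
      by (intro tannerys_theorem[where M = "\<lambda>k. 4 * b k", THEN conjunct2, THEN conjunct2]) auto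
    moreover have "(\<Sum>k. f k m) = low m" for m
    proof -
      have "(\<Sum>k. f k m) = (\<Sum>k\<le>m div 2. f k m)" by (intro suminf_finite) (auto simp: f_def)
      then show ?thesis by (simp add: low_def f_def sum_divide_distrib)
    qed
    ultimately show ?thesis by simp
  qed
  moreover have "high \<longlonglongrightarrow> 0"
  proof (rule LIMSEQ_I)
    fix e :: real assume "0 < e"
    \<comment> \<open>A factor 2 is lost through j >= (m + 1) / 2 and another one in
      \<open>sum_no_return_le\<close>, which leaves 4 e / 5 < e.\<close>
    then have "0 < e / 5" by simp
    from LIMSEQ_D[OF jb this] obtain N where N: "\<And>j. j \<ge> N \<Longrightarrow> norm (real j * b j) < e / 5" by auto
    show "\<exists>no. \<forall>m\<ge>no. norm (high m - 0) < e"
    proof (intro exI allI impI)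
      fix m assume m: "m \<ge> 2 * N"
      have "(\<Sum>j\<in>{m div 2<..m}. b j * ?r (m - j)) \<le> (\<Sum>j\<in>{m div 2<..m}. (2 * e / (5 * (real m + 1))) * ?r (m - j))"
      proof (intro sum_mono mult_right_mono)
        fix j assume j: "j \<in> {m div 2<..m}"
        have "j \<ge> N" using j m by auto
        from N[OF this] have "real j * b j < e / 5" using b0[of j] by auto
        moreover have "(real m + 1) / 2 \<le> real j" using j by auto
        ultimately have "(real m + 1) / 2 * b j < e / 5"
          using mult_right_mono[of "(real m + 1) / 2" "real j" "b j"] b0[of j] by linarith
        then show "b j \<le> 2 * e / (5 * (real m + 1))" by (simp add: field_simps)
        show "0 \<le> ?r (m - j)" using r0 less_imp_le by blast
      qed
      also have "\<dots> = (2 * e / (5 * (real m + 1))) * (\<Sum>j\<in>{m div 2<..m}. ?r (m - j))"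
        by (simp only: sum_distrib_left)
      also have "\<dots> \<le> (2 * e / (5 * (real m + 1))) * (2 * (real m + 1) * ?r m)"
      proof (rule mult_left_mono)
        have "(\<Sum>j\<in>{m div 2<..m}. ?r (m - j)) \<le> (\<Sum>j\<in>{..m}. ?r (m - j))"
          using r0 by (intro sum_mono2) (auto intro: less_imp_le simp del: no_return_simps)
        also have "\<dots> = (\<Sum>j\<le>m. ?r j)" by (rule sum.nat_diff_reindex[of ?r "Suc m", simplified lessThan_Suc_atMost diff_Suc_Suc, simplified])
        finally show "(\<Sum>j\<in>{m div 2<..m}. ?r (m - j)) \<le> 2 * (real m + 1) * ?r m"
          using sum_no_return_le[of m] by linarith
      qed (use \<open>0 < e\<close> in simp)
      also have "\<dots> = 4 / 5 * e * ?r m" by (simp add: field_simps del: no_return_simps)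
      finally have "high m \<le> 4 / 5 * e" unfolding high_def using r0[of m]
        by (simp add: field_simps del: no_return_simps)
      moreover have "0 \<le> high m" unfolding high_def
        using b0 r0 by (intro divide_nonneg_pos sum_nonneg mult_nonneg_nonneg) (auto intro: less_imp_le simp del: no_return_simps)
      ultimately show "norm (high m - 0) < e" using \<open>0 < e\<close> by simp
    qed
  qed
  ultimately have "(\<lambda>m. low m + high m) \<longlonglongrightarrow> suminf b + 0" by (rule tendsto_add)
  then show ?thesis using bs by (simp add: split sums_iff)
qed

section \<open>Averages over the extensions of a word\<close>

primrec walks :: "nat \<Rightarrow> int list set" where
  "walks 0 = {[0]}"
| "walks (Suc n) = (\<Union>h\<in>walks n. {h @ [last h + 1], h @ [last h - 1]})"

text \<open>The conditional expectation of G after m further steps, given the past h.\<close>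

primrec walk_mean :: "(int list \<Rightarrow> real) \<Rightarrow> nat \<Rightarrow> int list \<Rightarrow> real" where
  "walk_mean G 0 = G"
| "walk_mean G (Suc m) = (\<lambda>h. (walk_mean G m (h @ [last h + 1]) + walk_mean G m (h @ [last h - 1])) / 2)"

definition wmax :: "int list \<Rightarrow> nat" where
  "wmax h = Max ((\<lambda>x. nat \<bar>x\<bar>) ` set h)"

text \<open>The maximum of the absolute values up to the last zero, for the reversed word. A word
  without zeros gets the value at its first letter, as \<^const>\<open>last_zero_upto\<close> is then 0.\<close>

fun gmax_rev :: "int list \<Rightarrow> nat" where
  "gmax_rev [] = 0"
| "gmax_rev (y # t) = (if y = 0 \<or> t = [] then wmax (rev (y # t)) else gmax_rev t)"

definition gmax :: "int list \<Rightarrow> nat" where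
  "gmax h = gmax_rev (rev h)"

lemma walks_length: "h \<in> walks n \<Longrightarrow> length h = Suc n"
  by (induction n arbitrary: h) auto

lemma walks_nonempty: "h \<in> walks n \<Longrightarrow> h \<noteq> []"
  using walks_length by fastforce

lemma finite_walks [simp]: "finite (walks n)"
  by (induction n) auto

lemma sum_walks_Suc:
  "(\<Sum>h\<in>walks (Suc n). G h) = (\<Sum>h\<in>walks n. G (h @ [last h + 1]) + G (h @ [last h - 1]))"
proof -
  have "(\<Sum>h\<in>walks (Suc n). G h) = (\<Sum>h\<in>walks n. \<Sum>w\<in>{h @ [last h + 1], h @ [last h - 1]}. G w)"
    unfolding walks.simps by (intro sum.UNION_disjoint) auto
  also have "\<dots> = (\<Sum>h\<in>walks n. G (h @ [last h + 1]) + G (h @ [last h - 1]))"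
    by (intro sum.cong) auto
  finally show ?thesis .
qed

lemma wmax_snoc: "h \<noteq> [] \<Longrightarrow> wmax (h @ [y]) = max (wmax h) (nat \<bar>y\<bar>)"
  by (simp add: wmax_def max.commute)

lemma wmax_single [simp]: "wmax [x] = nat \<bar>x\<bar>"
  by (simp add: wmax_def)

lemma gmax_single [simp]: "gmax [x] = nat \<bar>x\<bar>"
  by (simp add: gmax_def)

lemma gmax_snoc: "h \<noteq> [] \<Longrightarrow> gmax (h @ [y]) = (if y = 0 then wmax (h @ [y]) else gmax h)"
  by (simp add: gmax_def)

lemma abs_last_le_wmax: "h \<noteq> [] \<Longrightarrow> \<bar>last h\<bar> \<le> int (wmax h)"
proof -
  assume "h \<noteq> []"
  then have "nat \<bar>last h\<bar> \<le> wmax h" unfolding wmax_def by (intro Max_ge) auto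
  then show ?thesis by simp
qed

lemma gmax_eq_wmax: "h \<noteq> [] \<Longrightarrow> last h = 0 \<Longrightarrow> gmax h = wmax h"
  by (cases h rule: rev_cases) (auto simp: gmax_snoc gmax_def wmax_def)

text \<open>The definition splits off the first added step; a potential argument needs the last
  one.\<close>

lemma walk_mean_Suc_right:
  "walk_mean G (Suc m) h = walk_mean (\<lambda>w. (G (w @ [last w + 1]) + G (w @ [last w - 1])) / 2) m h"
  by (induction m arbitrary: h) simp_all

lemma walk_mean_add: "walk_mean G (m + k) h = walk_mean (walk_mean G k) m h"
  by (induction m arbitrary: h) simp_all

lemma walk_mean_cong:
  "h \<in> walks n \<Longrightarrow> (\<And>w. w \<in> walks (n + m) \<Longrightarrow> take (Suc n) w = h \<Longrightarrow> F w = G w)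
    \<Longrightarrow> walk_mean F m h = walk_mean G m h"
proof (induction m arbitrary: h n)
  case 0
  then show ?case using walks_length[OF 0(1)] by simp
next
  case (Suc m)
  have "walk_mean F m h' = walk_mean G m h'"
    if "h' = h @ [last h + 1] \<or> h' = h @ [last h - 1]" for h'
  proof (rule Suc.IH)
    show h': "h' \<in> walks (Suc n)" using that Suc.prems(1) by auto
    fix w assume w: "w \<in> walks (Suc n + m)" "take (Suc (Suc n)) w = h'"
    have "take (Suc n) w = take (Suc n) h'" by (simp flip: w(2))
    also have "\<dots> = h" using that walks_length[OF Suc.prems(1)] by auto
    finally show "F w = G w" using w by (intro Suc.prems(2)) auto
  qed
  then show ?case by simp
qed

lemma walk_mean_mono:
  assumes "h \<in> walks n" "\<And>w. w \<in> walks (n + m) \<Longrightarrow> F w \<le> G w"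
  shows "walk_mean F m h \<le> walk_mean G m h"
  using assms
proof (induction m arbitrary: h n)
  case (Suc m)
  have "walk_mean F m h' \<le> walk_mean G m h'"
    if "h' = h @ [last h + 1] \<or> h' = h @ [last h - 1]" for h'
    using that Suc.prems by (intro Suc.IH[of h' "Suc n"]) auto
  from this[of "h @ [last h + 1]"] this[of "h @ [last h - 1]"] show ?case by simp
qed simp

lemma walk_mean_const [simp]: "walk_mean (\<lambda>_. c) m h = c"
  by (induction m arbitrary: h) simp_all

lemma walk_mean_nonneg:
  assumes "h \<in> walks n" "\<And>w. w \<in> walks (n + m) \<Longrightarrow> 0 \<le> F w"
  shows "0 \<le> walk_mean F m h"
  using walk_mean_mono[of h n m "\<lambda>_. 0" F] assms by simp

lemma walk_mean_plus: "walk_mean (\<lambda>w. F w + G w) m h = walk_mean F m h + walk_mean G m h"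
  by (induction m arbitrary: h) (simp_all add: field_simps)

lemma walk_mean_mult: "walk_mean (\<lambda>w. c * F w) m h = c * walk_mean F m h"
  by (induction m arbitrary: h) (simp_all add: field_simps)

lemma walk_mean_diff: "walk_mean (\<lambda>w. F w - G w) m h = walk_mean F m h - walk_mean G m h"
  by (induction m arbitrary: h) (simp_all add: diff_divide_distrib add_divide_distrib)

lemma walk_mean_LIMSEQ:
  assumes "h \<in> walks n" "\<And>w. w \<in> walks (n + m) \<Longrightarrow> (\<lambda>i. F i w) \<longlonglongrightarrow> G w"
  shows "(\<lambda>i. walk_mean (F i) m h) \<longlonglongrightarrow> walk_mean G m h"
  using assms
proof (induction m arbitrary: h n)
  case 0
  from 0(2)[of h] 0(1) show ?case by simp
next
  case (Suc m)
  have "(\<lambda>i. walk_mean (F i) m h') \<longlonglongrightarrow> walk_mean G m h'"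
    if "h' = h @ [last h + 1] \<or> h' = h @ [last h - 1]" for h'
  proof (rule Suc.IH)
    show "h' \<in> walks (Suc n)" using that Suc.prems(1) by auto
    show "(\<lambda>i. F i w) \<longlonglongrightarrow> G w" if "w \<in> walks (Suc n + m)" for w
      using that by (intro Suc.prems(2)) (simp only: add_Suc_right add_Suc)
  qed
  from tendsto_divide[OF tendsto_add[OF this[OF disjI1[OF refl]] this[OF disjI2[OF refl]]] tendsto_const[of 2]]
  show ?case by simp
qed

lemma walk_mean_sum_walks: "walk_mean G n [0] = (\<Sum>h\<in>walks n. G h) / 2 ^ n"
proof (induction n arbitrary: G)
  case (Suc n)
  show ?case unfolding walk_mean_Suc_right Suc sum_walks_Suc
    unfolding power_Suc2 divide_divide_eq_left[symmetric] sum_divide_distrib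
    by (simp add: mult.commute)
qed simp

text \<open>Taking out what is known: every extension of h keeps h as its first n + 1
  letters.\<close>

lemma walk_mean_take:
  assumes "h \<in> walks n"
  shows "walk_mean (\<lambda>w. f (take (Suc n) w) * G w) m h = f h * walk_mean G m h"
  using walk_mean_cong[of h n m "\<lambda>w. f (take (Suc n) w) * G w" "\<lambda>w. f h * G w"] assms
  by (simp add: walk_mean_mult)

text \<open>A discrete Dynkin formula: \<open>b\<close> is the drop of the potential \<open>D\<close> in one step.\<close>

lemma walk_mean_potential:
  assumes h: "h \<in> walks n"
    and pot: "\<And>w k. n \<le> k \<Longrightarrow> w \<in> walks k \<Longrightarrow> D w = b w + (D (w @ [last w + 1]) + D (w @ [last w - 1])) / 2"
  shows "(\<Sum>j<J. walk_mean b j h) = D h - walk_mean D J h"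
proof (induction J)
  case (Suc J)
  have "walk_mean D (Suc J) h = walk_mean (\<lambda>w. D w - b w) J h"
    unfolding walk_mean_Suc_right
  proof (rule walk_mean_cong[OF h])
    fix w assume "w \<in> walks (n + J)"
    from pot[OF _ this] show "(D (w @ [last w + 1]) + D (w @ [last w - 1])) / 2 = D w - b w" by linarith
  qed
  then show ?case using Suc by (simp only: walk_mean_diff sum.lessThan_Suc)
qed simp

lemma walk_mean_harmonic:
  assumes h: "h \<in> walks n"
    and harm: "\<And>w k. n \<le> k \<Longrightarrow> w \<in> walks k \<Longrightarrow> F w = (F (w @ [last w + 1]) + F (w @ [last w - 1])) / 2"
  shows "walk_mean F m h = F h"
proof -
  have "(\<Sum>j<m. walk_mean (\<lambda>_. 0) j h) = F h - walk_mean F m h"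
    by (rule walk_mean_potential[OF h]) (unfold add_0_left, rule harm)
  then show ?thesis by simp
qed

text \<open>The Olivier-Pringsheim theorem: the block from j div 2 to j has at least j / 2 terms,
  none below c j, and its sum is small by Cauchy's criterion.\<close>

lemma decseq_summable_times_tendsto_0:
  fixes c :: "nat \<Rightarrow> real"
  assumes dec: "decseq c" and c0: "\<And>j. 0 \<le> c j" and s: "summable c"
  shows "(\<lambda>j. real j * c j) \<longlonglongrightarrow> 0"
proof (rule LIMSEQ_I)
  fix e :: real assume "0 < e"
  then have "0 < e / 2" by simp
  from s[unfolded summable_Cauchy, rule_format, OF this]
  obtain N where N: "\<And>m n. m \<ge> N \<Longrightarrow> norm (sum c {m..<n}) < e / 2" by blast
  show "\<exists>no. \<forall>j\<ge>no. norm (real j * c j - 0) < e"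
  proof (intro exI allI impI)
    fix j assume "j \<ge> 2 * N"
    have "j \<le> 2 * card {j div 2..<j}" by simp
    then have "real j / 2 \<le> real (card {j div 2..<j})" by linarith
    then have "real j / 2 * c j \<le> real (card {j div 2..<j}) * c j"
      using c0 by (intro mult_right_mono)
    also have "\<dots> = (\<Sum>i\<in>{j div 2..<j}. c j)" by simp
    also have "\<dots> \<le> (\<Sum>i\<in>{j div 2..<j}. c i)"
      by (intro sum_mono decseqD[OF dec]) simp
    also have "\<dots> \<le> norm (sum c {j div 2..<j})" by simp
    also have "\<dots> < e / 2" using \<open>j \<ge> 2 * N\<close> by (intro N) linarith
    finally show "norm (real j * c j - 0) < e" using c0[of j] by (simp add: abs_mult)
  qed
qed

text \<open>The potential \<open>\<theta> s ((s + 1)\<^sup>2 - x\<^sup>2) + (\<Sum>k>s. (2 k + 1) \<theta> k)\<close>, with \<open>x\<close> the position and \<open>s\<close> the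
  maximum, adds up the expected times spent by the maximum at the levels from \<open>s\<close> on, weighted by \<open>\<theta>\<close>.\<close>

lemma walk_mean_wmax_little_o:
  assumes h: "h \<in> walks n"
    and anti: "antimono \<theta>" and pos: "\<And>k. 0 \<le> \<theta> k" and sm: "summable (\<lambda>k. (2 * real k + 1) * \<theta> k)"
  shows "(\<lambda>j. real j * walk_mean (\<lambda>w. \<theta> (wmax w)) j h) \<longlonglongrightarrow> 0"
proof (rule decseq_summable_times_tendsto_0)
  let ?c = "\<lambda>j. walk_mean (\<lambda>w. \<theta> (wmax w)) j h"
  show nn: "0 \<le> ?c j" for j using h pos by (intro walk_mean_nonneg)
  show "decseq ?c"
  proof (intro decseq_SucI)
    fix j
    have "(\<theta> (wmax (w @ [last w + 1])) + \<theta> (wmax (w @ [last w - 1]))) / 2 \<le> \<theta> (wmax w)"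
      if "w \<in> walks (n + j)" for w
    proof -
      have "\<theta> (wmax (w @ [y])) \<le> \<theta> (wmax w)" for y
        using walks_nonempty[OF that] by (intro antimonoD[OF anti]) (simp add: wmax_snoc)
      from this[of "last w + 1"] this[of "last w - 1"] show ?thesis by simp
    qed
    then show "?c (Suc j) \<le> ?c j" unfolding walk_mean_Suc_right
      by (intro walk_mean_mono[OF h])
  qed
  define T where "T s = (\<Sum>k. (2 * real (s + k) + 1) * \<theta> (s + k))" for s
  have T_Suc: "T s = (2 * real s + 1) * \<theta> s + T (Suc s)" for s
  proof -
    have "summable (\<lambda>k. (2 * real (k + s) + 1) * \<theta> (k + s))"
      using summable_ignore_initial_segment[OF sm, of s] .
    then have "summable (\<lambda>k. (2 * real (s + k) + 1) * \<theta> (s + k))" by (simp add: add.commute)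
    from suminf_split_head[OF this] show ?thesis by (simp add: T_def)
  qed
  have T_nonneg: "0 \<le> T s" for s
  proof -
    have "summable (\<lambda>k. (2 * real (s + k) + 1) * \<theta> (s + k))"
      using summable_ignore_initial_segment[OF sm, of s] by (simp add: add.commute)
    then show ?thesis unfolding T_def using pos by (intro suminf_nonneg) auto
  qed
  define L where "L w = \<theta> (wmax w) * ((real (wmax w) + 1)\<^sup>2 - (real_of_int (last w))\<^sup>2) + T (Suc (wmax w))" for w
  have pot: "L w = \<theta> (wmax w) + (L (w @ [last w + 1]) + L (w @ [last w - 1])) / 2" if "w \<in> walks k" for w k
  proof -
    have ne: "w \<noteq> []" using that by (rule walks_nonempty)
    have le: "\<bar>last w\<bar> \<le> int (wmax w)" using ne by (rule abs_last_le_wmax)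
    \<comment> \<open>The formula with the old maximum s remains valid at distance s + 1: there its
      first term is 0, and the new first term (2 s + 3) \<theta> (s + 1) is the leading summand of T
      (s + 1). Hence only the mean growth of the squared position by 1 matters, and it costs
      \<theta> s.\<close>
    have up: "L (w @ [y]) = \<theta> (wmax w) * ((real (wmax w) + 1)\<^sup>2 - (real_of_int y)\<^sup>2) + T (Suc (wmax w))"
      if "\<bar>y\<bar> \<le> int (wmax w) + 1" for y
    proof (cases "\<bar>y\<bar> \<le> int (wmax w)")
      case True
      then have "wmax (w @ [y]) = wmax w" using ne by (simp add: wmax_snoc)
      then show ?thesis by (simp add: L_def)
    next
      case False
      then have y: "\<bar>y\<bar> = int (wmax w) + 1" using that by simp
      then have "nat \<bar>y\<bar> = Suc (wmax w)" by simp
      then have m: "wmax (w @ [y]) = Suc (wmax w)" using ne by (simp add: wmax_snoc)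
      have "(real_of_int y)\<^sup>2 = (real_of_int \<bar>y\<bar>)\<^sup>2" by simp
      also have "\<dots> = (real (wmax w) + 1)\<^sup>2" unfolding y by simp
      finally have "(real_of_int y)\<^sup>2 = (real (wmax w) + 1)\<^sup>2" .
      then show ?thesis using T_Suc[of "Suc (wmax w)"]
        by (simp add: L_def m power2_eq_square algebra_simps)
    qed
    have "\<bar>last w + 1\<bar> \<le> int (wmax w) + 1" "\<bar>last w - 1\<bar> \<le> int (wmax w) + 1"
      using le by linarith+
    note ups = this[THEN up]
    have "L (w @ [last w + 1]) + L (w @ [last w - 1]) = 2 * L w - 2 * \<theta> (wmax w)"
      unfolding ups unfolding L_def by (simp add: power2_eq_square algebra_simps)
    then show ?thesis by (simp add: field_simps)
  qed
  have Lnn: "0 \<le> L w" if "w \<in> walks k" for w k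
  proof -
    have "\<bar>last w\<bar> \<le> int (wmax w)" using walks_nonempty[OF that] by (rule abs_last_le_wmax)
    then have "\<bar>real_of_int (last w)\<bar> \<le> \<bar>real (wmax w) + 1\<bar>" by linarith
    then have "(real_of_int (last w))\<^sup>2 \<le> (real (wmax w) + 1)\<^sup>2" by (simp only: abs_le_square_iff)
    then show ?thesis using pos T_nonneg by (simp add: L_def)
  qed
  have "(\<Sum>j<J. ?c j) \<le> L h" for J
  proof -
    have "(\<Sum>j<J. ?c j) = L h - walk_mean L J h"
      by (rule walk_mean_potential[OF h]) (rule pot)
    moreover have "0 \<le> walk_mean L J h" by (rule walk_mean_nonneg[OF h]) (rule Lnn)
    ultimately show ?thesis by linarith
  qed
  then show "summable ?c" using nn
    by (intro summableI_nonneg_bounded[where x = "L h"]) auto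
qed

text \<open>The preceding estimate for a finitely supported weight: the maximum exceeds every level
  in probability.\<close>

lemma walk_mean_wmax_le_tendsto_0:
  assumes h: "h \<in> walks n"
  shows "(\<lambda>j. walk_mean (\<lambda>w. of_bool (wmax w \<le> K)) j h) \<longlonglongrightarrow> 0"
proof -
  let ?c = "\<lambda>j. walk_mean (\<lambda>w. of_bool (wmax w \<le> K)) j h"
  have "summable (\<lambda>k. (2 * real k + 1) * of_bool (k \<le> K))"
    by (rule summable_finite[of "{..K}"]) auto
  then have "(\<lambda>j. real j * ?c j) \<longlonglongrightarrow> 0"
    by (intro walk_mean_wmax_little_o[OF h, of "\<lambda>k. of_bool (k \<le> K)"]) (auto simp: antimono_def)
  then show ?thesis
  proof (rule Lim_null_comparison[rotated])
    show "\<forall>\<^sub>F j in sequentially. norm (?c j) \<le> real j * ?c j"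
      using eventually_ge_at_top[of 1]
    proof eventually_elim
      case (elim j)
      have "0 \<le> ?c j" using h by (intro walk_mean_nonneg) auto
      then show ?case using elim mult_right_mono[of 1 "real j" "?c j"] by simp
    qed
  qed
qed

text \<open>Bounded convergence by hand: d is bounded and small at high levels, and words with a low
  maximum become rare. It removes the remainder in the Dynkin formula.\<close>

lemma walk_mean_wmax_tendsto_0:
  assumes h: "h \<in> walks n" and d: "d \<longlonglongrightarrow> (0::real)"
    and D: "\<And>w k. w \<in> walks k \<Longrightarrow> \<bar>D w\<bar> \<le> d (wmax w)"
  shows "(\<lambda>j. walk_mean D j h) \<longlonglongrightarrow> 0"
proof (rule LIMSEQ_I)
  fix e :: real assume "0 < e"
  then have e2: "0 < e / 2" by simp
  from LIMSEQ_D[OF d this] obtain K where K: "\<And>k. k \<ge> K \<Longrightarrow> \<bar>d k\<bar> < e / 2" by auto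
  obtain C where C: "0 < C" "\<And>k. \<bar>d k\<bar> \<le> C"
    using BseqE[OF convergent_imp_Bseq[OF convergentI[OF d]]] by auto
  let ?c = "\<lambda>j. walk_mean (\<lambda>w. of_bool (wmax w \<le> K)) j h"
  have "0 < e / (2 * C)" using \<open>0 < e\<close> C by simp
  from LIMSEQ_D[OF walk_mean_wmax_le_tendsto_0[OF h] this]
  obtain N where N: "\<And>j. j \<ge> N \<Longrightarrow> norm (?c j - 0) < e / (2 * C)" by blast
  show "\<exists>no. \<forall>j\<ge>no. norm (walk_mean D j h - 0) < e"
  proof (intro exI allI impI)
    fix j assume "j \<ge> N"
    have *: "\<bar>D w\<bar> \<le> C * of_bool (wmax w \<le> K) + e / 2" if "w \<in> walks (n + j)" for w
      using D[OF that] C(2)[of "wmax w"] K[of "wmax w"] e2 by (cases "wmax w \<le> K") auto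
    have "walk_mean D j h \<le> walk_mean (\<lambda>w. C * of_bool (wmax w \<le> K) + e / 2) j h"
      using * by (intro walk_mean_mono[OF h]) (auto simp: abs_le_iff)
    moreover have "walk_mean (\<lambda>w. -1 * D w) j h \<le> walk_mean (\<lambda>w. C * of_bool (wmax w \<le> K) + e / 2) j h"
      using * by (intro walk_mean_mono[OF h]) (auto simp: abs_le_iff)
    ultimately have "\<bar>walk_mean D j h\<bar> \<le> C * ?c j + e / 2"
      unfolding walk_mean_plus walk_mean_mult by (simp add: abs_le_iff)
    moreover have "?c j < e / (2 * C)" using N[OF \<open>j \<ge> N\<close>] by (auto simp: abs_less_iff)
    then have "C * ?c j < e / 2" using C(1) by (simp add: field_simps)
    ultimately show "norm (walk_mean D j h - 0) < e" by simp
  qed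
qed

section \<open>Words and their zeros\<close>

text \<open>The discrete Tanaka formula: the absolute value is harmonic off 0 and gains 1 in the
  mean at 0.\<close>

lemma abs_neighbours:
  "\<bar>real_of_int (x + 1)\<bar> + \<bar>real_of_int (x - 1)\<bar> = 2 * \<bar>real_of_int x\<bar> + 2 * of_bool (x = 0)"
proof (cases "x = 0")
  case False
  then have "1 \<le> x \<or> x \<le> - 1" by linarith
  then show ?thesis by auto
qed simp

text \<open>Strictly after n, so that a zero at n is allowed and can be the last one.\<close>

definition no_zero_after :: "nat \<Rightarrow> int list \<Rightarrow> bool" where
  "no_zero_after n w \<longleftrightarrow> (\<forall>i. n < i \<and> i < length w \<longrightarrow> w ! i \<noteq> 0)"

lemma no_zero_after_walks [simp]: "h \<in> walks n \<Longrightarrow> no_zero_after n h"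
  using walks_length[of h n] by (auto simp: no_zero_after_def)

lemma no_zero_after_snoc: "n < length w \<Longrightarrow> no_zero_after n (w @ [y]) \<longleftrightarrow> no_zero_after n w \<and> y \<noteq> 0"
  by (auto simp: no_zero_after_def nth_append less_Suc_eq)

lemma no_zero_after_last:
  assumes "w \<in> walks k" "n < k" "no_zero_after n w"
  shows "last w \<noteq> 0"
  using assms walks_length[OF assms(1)] walks_nonempty[OF assms(1)]
  by (auto simp: no_zero_after_def last_conv_nth)

text \<open>A word ending in 0 satisfies the condition only if it has exactly n steps. From there
  only later zeros count, which is why \<open>no_return\<close> replaces
  \<open>survival\<close>.\<close>

lemma walk_mean_no_zero_after:
  assumes "h \<in> walks k" "n \<le> k"
  shows "walk_mean (\<lambda>w. of_bool (no_zero_after n w)) m h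
    = of_bool (no_zero_after n h) * (if last h = 0 then no_return m else survival m (last h))"
  using assms
proof (induction m arbitrary: h k)
  case 0
  then show ?case by simp
next
  case (Suc m)
  have "n < length h" using Suc.prems walks_length by fastforce
  note nz = no_zero_after_snoc[OF this]
  have IH: "walk_mean (\<lambda>w. of_bool (no_zero_after n w)) m (h @ [y])
      = of_bool (no_zero_after n h) * survival m y"
    if "y = last h + 1 \<or> y = last h - 1" for y
  proof -
    have "h @ [y] \<in> walks (Suc k)" using Suc.prems that by auto
    from Suc.IH[OF this] Suc.prems show ?thesis by (auto simp: nz)
  qed
  show ?case
    using IH[of "last h + 1"] IH[of "last h - 1"] survival_uminus[of m 1]
    by (auto simp: field_simps)
qed

lemma walk_mean_no_zero_after_tendsto_0:
  assumes "h \<in> walks n" "last h = 0"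
  shows "(\<lambda>m. walk_mean (\<lambda>w. of_bool (no_zero_after n w)) m h) \<longlonglongrightarrow> 0"
  using assms no_return_tendsto_0 by (simp add: walk_mean_no_zero_after del: no_return_simps)

text \<open>The probability of completing \<open>a\<close> zeros before leaving \<open>{-k..k}\<close>, given the word so far: an
  excursion from 0 stays within \<open>{-k..k}\<close> with probability \<open>k / (k + 1)\<close>.\<close>

definition zeros_potential :: "nat \<Rightarrow> nat \<Rightarrow> int list \<Rightarrow> real" where
  "zeros_potential a k w = of_bool (wmax w \<le> k) *
     (if last w = 0 then of_bool (count_list w 0 \<le> a) * (real k / (real k + 1)) ^ (a - count_list w 0)
      else of_bool (count_list w 0 < a) * (1 - \<bar>real_of_int (last w)\<bar> / (real k + 1))
        * (real k / (real k + 1)) ^ (a - Suc (count_list w 0)))"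

text \<open>Off 0 the linear factor is the gambler's ruin probability of reaching 0 before distance
  k + 1, and the exponent is one less because this return is itself a zero. At the a-th zero the
  potential is 1, one step later it is 0: that is the drop.\<close>

lemma zeros_potential_step:
  assumes w: "w \<in> walks n"
  shows "zeros_potential a k w = of_bool (last w = 0 \<and> count_list w 0 = a \<and> wmax w \<le> k)
    + (zeros_potential a k (w @ [last w + 1]) + zeros_potential a k (w @ [last w - 1])) / 2"
proof (cases "wmax w \<le> k")
  case False
  then show ?thesis using walks_nonempty[OF w] by (simp add: zeros_potential_def wmax_snoc)
next
  case True
  define c where "c = count_list w 0"
  define \<alpha> where "\<alpha> = real k / (real k + 1)"
  have ne: "w \<noteq> []" using walks_nonempty[OF w] .
  have le: "\<bar>last w\<bar> \<le> int k" using abs_last_le_wmax[OF ne] True by linarith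
  \<comment> \<open>At distance k + 1 the left side vanishes through the maximum, the right side
    through the linear factor.\<close>
  have next_ne: "zeros_potential a k (w @ [y])
      = of_bool (c < a) * (1 - \<bar>real_of_int y\<bar> / (real k + 1)) * \<alpha> ^ (a - Suc c)"
    if "y \<noteq> 0" "\<bar>y\<bar> \<le> int k + 1" for y
  proof (cases "\<bar>y\<bar> = int k + 1")
    case True
    then have "\<bar>real_of_int y\<bar> = real k + 1" by linarith
    then show ?thesis using True ne by (simp add: zeros_potential_def wmax_snoc that)
  next
    case False
    then have "wmax (w @ [y]) \<le> k" using ne True that by (auto simp: wmax_snoc)
    then show ?thesis using that by (simp add: zeros_potential_def c_def \<alpha>_def)
  qed
  have next_0: "zeros_potential a k (w @ [0]) = of_bool (c < a) * \<alpha> ^ (a - Suc c)"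
    using ne True by (auto simp: zeros_potential_def wmax_snoc c_def \<alpha>_def Suc_le_eq)
  show ?thesis
  proof (cases "last w = 0")
    case l0: True
    have one: "1 - 1 / (real k + 1) = \<alpha>" by (simp add: \<alpha>_def field_simps)
    have "zeros_potential a k (w @ [1]) = of_bool (c < a) * \<alpha> * \<alpha> ^ (a - Suc c)"
      "zeros_potential a k (w @ [- 1]) = of_bool (c < a) * \<alpha> * \<alpha> ^ (a - Suc c)"
      using next_ne[of 1] next_ne[of "-1"] le unfolding one[symmetric] by simp_all
    moreover have "of_bool (c < a) * \<alpha> * \<alpha> ^ (a - Suc c) = of_bool (c < a) * \<alpha> ^ (a - c)"
      by (cases "c < a") (simp_all flip: power_Suc add: Suc_diff_Suc)
    moreover have "zeros_potential a k w = of_bool (c \<le> a) * \<alpha> ^ (a - c)"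
      using l0 True by (simp add: zeros_potential_def c_def \<alpha>_def)
    ultimately show ?thesis using l0 True by (auto simp: c_def[symmetric])
  next
    case l1: False
    have all: "zeros_potential a k (w @ [y])
      = of_bool (c < a) * (1 - \<bar>real_of_int y\<bar> / (real k + 1)) * \<alpha> ^ (a - Suc c)"
      if "y = last w + 1 \<or> y = last w - 1" for y
      using next_0 next_ne[of y] that le by (cases "y = 0") auto
    have abs: "\<bar>real_of_int (last w + 1)\<bar> + \<bar>real_of_int (last w - 1)\<bar> = 2 * \<bar>real_of_int (last w)\<bar>"
      using abs_neighbours[of "last w"] l1 by simp
    have "zeros_potential a k (w @ [last w + 1]) + zeros_potential a k (w @ [last w - 1])
       = of_bool (c < a) * \<alpha> ^ (a - Suc c)
         * (2 - (\<bar>real_of_int (last w + 1)\<bar> + \<bar>real_of_int (last w - 1)\<bar>) / (real k + 1))"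
      using all[of "last w + 1"] all[of "last w - 1"] by (simp add: algebra_simps add_divide_distrib)
    also have "\<dots> = 2 * zeros_potential a k w"
      unfolding abs using l1 True by (simp add: zeros_potential_def c_def \<alpha>_def algebra_simps)
    finally show ?thesis using l1 by simp
  qed
qed

text \<open>The zero at time 0 is counted, so a zeros amount to a - 1 excursions. The remainder
  vanishes because the potential lives on words with maximum at most k.\<close>

lemma zeros_sums:
  assumes "1 \<le> a"
  shows "(\<lambda>j. walk_mean (\<lambda>w. of_bool (last w = 0 \<and> count_list w 0 = a \<and> wmax w \<le> k)) j [0])
    sums (real k / (real k + 1)) ^ (a - 1)"
proof -
  have h: "[0] \<in> walks 0" by simp
  have "(\<lambda>k'. of_bool (k' \<le> k) :: real) \<longlonglongrightarrow> 0"
    by (rule tendsto_eventually) (auto intro: eventually_mono[OF eventually_gt_at_top[of k]])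
  moreover have "\<bar>zeros_potential a k w\<bar> \<le> of_bool (wmax w \<le> k)" if "w \<in> walks n" for w n
  proof (cases "wmax w \<le> k")
    case True
    have "\<bar>last w\<bar> \<le> int k" using abs_last_le_wmax[OF walks_nonempty[OF that]] True by linarith
    then have "\<bar>real_of_int (last w)\<bar> \<le> real k + 1" by linarith
    then have "\<bar>real_of_int (last w)\<bar> / (real k + 1) \<le> 1" by (simp add: divide_le_eq)
    then have 1: "\<bar>1 - \<bar>real_of_int (last w)\<bar> / (real k + 1)\<bar> \<le> 1" by (simp add: abs_le_iff)
    have 2: "\<bar>(real k / (real k + 1)) ^ i\<bar> \<le> 1" for i by (simp add: power_le_one)
    show ?thesis using True 2 mult_mono[OF 1 2] by (simp add: zeros_potential_def abs_mult)
  qed (simp add: zeros_potential_def)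
  ultimately have "(\<lambda>j. walk_mean (zeros_potential a k) j [0]) \<longlonglongrightarrow> 0"
    by (rule walk_mean_wmax_tendsto_0[OF h])
  then have "(\<lambda>J. zeros_potential a k [0] - walk_mean (zeros_potential a k) J [0])
      \<longlonglongrightarrow> zeros_potential a k [0] - 0"
    by (intro tendsto_diff tendsto_const)
  moreover have "(\<Sum>j<J. walk_mean (\<lambda>w. of_bool (last w = 0 \<and> count_list w 0 = a \<and> wmax w \<le> k)) j [0])
      = zeros_potential a k [0] - walk_mean (zeros_potential a k) J [0]" for J
    by (rule walk_mean_potential[OF h]) (rule zeros_potential_step)
  moreover have "zeros_potential a k [0] = (real k / (real k + 1)) ^ (a - 1)"
    using assms by (simp add: zeros_potential_def)
  ultimately show ?thesis unfolding sums_def by simp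
qed

section \<open>The penalizing weight and its martingale\<close>

locale penalty =
  fixes \<phi> :: "nat \<Rightarrow> real"
  assumes nonneg: "0 \<le> \<phi> k"
    and summable: "summable \<phi>"
    and second_moment: "summable (\<lambda>k. (real k)\<^sup>2 * \<phi> k)"
begin

abbreviation tail :: "nat \<Rightarrow> real" where
  "tail \<equiv> tail_sum \<phi>"

lemma summable_shift: "summable (\<lambda>k. \<phi> (s + k))"
  using summable_ignore_initial_segment[OF summable, of s] by (simp add: add.commute)

lemma tail_Suc: "tail s = \<phi> s + tail (Suc s)"
  using suminf_split_head[OF summable_shift[of s]] by (simp add: tail_sum_def)

lemma tail_nonneg: "0 \<le> tail s"
  unfolding tail_sum_def by (intro suminf_nonneg summable_shift nonneg)

lemma phi_le_tail: "\<phi> s \<le> tail s"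
  using tail_Suc[of s] tail_nonneg[of "Suc s"] by simp

lemma antimono_tail: "antimono tail"
proof -
  have "tail (Suc s) \<le> tail s" for s using tail_Suc[of s] nonneg[of s] by simp
  then have "decseq tail" by (rule decseq_SucI)
  then show ?thesis by (simp add: decseq_def antimono_def)
qed

lemma tail_tendsto_0: "tail \<longlonglongrightarrow> 0"
  using suminf_exist_split2[OF summable] unfolding tail_sum_def by (simp add: add.commute)

lemma times_phi_tendsto_0: "(\<lambda>k. real k * \<phi> k) \<longlonglongrightarrow> 0"
proof (rule Lim_null_comparison)
  show "(\<lambda>k. (real k)\<^sup>2 * \<phi> k) \<longlonglongrightarrow> 0" using second_moment by (rule summable_LIMSEQ_zero)
  have "k * \<phi> k \<le> (real k)\<^sup>2 * \<phi> k" if "k > 0" for k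
    using that nonneg[of k] mult_right_mono[of "real k" "(real k)\<^sup>2" "\<phi> k"] by (simp add: power2_eq_square)
  then show "\<forall>\<^sub>F k in sequentially. norm (real k * \<phi> k) \<le> (real k)\<^sup>2 * \<phi> k"
    by (intro eventually_mono[OF eventually_gt_at_top[of 0]]) (simp add: nonneg)
qed

text \<open>Summation by parts, 2 k + 1 being a difference of squares. In the boundary term K is at
  most every index of the tail, so the second moment bounds it too.\<close>

lemma summable_weighted_tail: "summable (\<lambda>k. (2 * real k + 1) * tail k)"
proof -
  let ?f = "\<lambda>k. (real k + 1)\<^sup>2 * \<phi> k"
  have f: "summable ?f"
  proof (rule summable_comparison_test)
    show "summable (\<lambda>k. 2 * ((real k)\<^sup>2 * \<phi> k) + 2 * \<phi> k)"
      by (intro summable_add summable_mult second_moment summable)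
    have "(real k + 1)\<^sup>2 \<le> 2 * (real k)\<^sup>2 + 2" for k
      using sum_squares_ge_zero[of "real k - 1" 0] by (simp add: power2_eq_square algebra_simps)
    from mult_right_mono[OF this nonneg] show "\<exists>N. \<forall>k\<ge>N. norm (?f k) \<le> 2 * ((real k)\<^sup>2 * \<phi> k) + 2 * \<phi> k"
      by (intro exI[of _ 0]) (simp add: nonneg algebra_simps)
  qed
  have parts: "(\<Sum>k<K. (2 * real k + 1) * tail k) = (\<Sum>k<K. ?f k) + (real K)\<^sup>2 * tail K" for K
  proof (induction K)
    case (Suc K)
    then show ?case using tail_Suc[of K] by (simp add: power2_eq_square algebra_simps)
  qed simp
  have "(real K)\<^sup>2 * tail K \<le> suminf ?f" for K
  proof -
    have "(real K)\<^sup>2 * tail K = (\<Sum>k. (real K)\<^sup>2 * \<phi> (K + k))"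
      unfolding tail_sum_def by (rule suminf_mult[symmetric, OF summable_shift])
    also have "\<dots> \<le> (\<Sum>k. ?f (k + K))"
      using nonneg by (intro suminf_le summable_mult summable_shift summable_ignore_initial_segment[OF f])
        (auto intro!: mult_mono power_mono simp: add.commute)
    also have "\<dots> \<le> suminf ?f"
      using suminf_split_initial_segment[OF f, of K] nonneg by (simp add: sum_nonneg)
    finally show ?thesis .
  qed
  moreover have "(\<Sum>k<K. ?f k) \<le> suminf ?f" for K
    using nonneg by (intro sum_le_suminf f) auto
  ultimately have "(\<Sum>k<K. (2 * real k + 1) * tail k) \<le> suminf ?f + suminf ?f" for K
    unfolding parts by (rule add_mono[rotated])
  then show ?thesis using tail_nonneg by (intro summableI_nonneg_bounded) auto
qed

text \<open>The expected total of \<open>zero_reward\<close> from now on. From x, the walk visits 0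
  on average s + 1 - |x| times before it reaches distance s + 1, and once while the maximum is k,
  for each later level k. One \<phi> s is moved into the tail.\<close>

definition residual :: "int list \<Rightarrow> real" where
  "residual w = \<phi> (wmax w) * (real (wmax w) - \<bar>real_of_int (last w)\<bar>) + tail (wmax w)"

definition zero_reward :: "int list \<Rightarrow> real" where
  "zero_reward w = of_bool (last w = 0) * \<phi> (wmax w)"

definition Mword :: "int list \<Rightarrow> real" where
  "Mword w = \<phi> (gmax w) * \<bar>real_of_int (last w)\<bar> + residual w"

lemma zero_reward_nonneg: "0 \<le> zero_reward w"
  by (simp add: zero_reward_def nonneg)

lemma residual_bounds:
  assumes "w \<noteq> []"
  shows "0 \<le> residual w" "residual w \<le> real (wmax w) * \<phi> (wmax w) + tail (wmax w)"
proof -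
  have "\<bar>real_of_int (last w)\<bar> \<le> real (wmax w)" using abs_last_le_wmax[OF assms] by linarith
  then show "0 \<le> residual w" unfolding residual_def
    by (intro add_nonneg_nonneg mult_nonneg_nonneg nonneg tail_nonneg) simp
  show "residual w \<le> real (wmax w) * \<phi> (wmax w) + tail (wmax w)"
    using mult_left_mono[of "real (wmax w) - \<bar>real_of_int (last w)\<bar>" "real (wmax w)" "\<phi> (wmax w)"] nonneg
    by (simp add: residual_def mult.commute)
qed

lemma Mword_nonneg: "w \<noteq> [] \<Longrightarrow> 0 \<le> Mword w"
  using residual_bounds(1) by (simp add: Mword_def nonneg)

text \<open>Raising the maximum to s + 1 causes no jump: \<phi> s (s - (s + 1)) +
  \<open>tail s\<close> is \<open>tail (Suc s)\<close>.\<close>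

lemma residual_snoc:
  assumes w: "w \<noteq> []" and y: "\<bar>y\<bar> \<le> int (wmax w) + 1"
  shows "residual (w @ [y]) = \<phi> (wmax w) * (real (wmax w) - \<bar>real_of_int y\<bar>) + tail (wmax w)"
proof (cases "\<bar>y\<bar> \<le> int (wmax w)")
  case True
  then have "wmax (w @ [y]) = wmax w" using w by (simp add: wmax_snoc)
  then show ?thesis by (simp add: residual_def)
next
  case False
  then have a: "\<bar>y\<bar> = int (wmax w) + 1" using y by simp
  then have m: "wmax (w @ [y]) = Suc (wmax w)" using w by (simp add: wmax_snoc)
  have "\<bar>real_of_int y\<bar> = real (wmax w) + 1" using a by linarith
  then show ?thesis using tail_Suc[of "wmax w"] by (simp add: residual_def m)
qed

lemma residual_step:
  assumes w: "w \<in> walks n"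
  shows "residual w = zero_reward w + (residual (w @ [last w + 1]) + residual (w @ [last w - 1])) / 2"
proof -
  have ne: "w \<noteq> []" using walks_nonempty[OF w] .
  have le: "\<bar>last w\<bar> \<le> int (wmax w)" using abs_last_le_wmax[OF ne] .
  have r: "residual (w @ [last w + 1]) = \<phi> (wmax w) * (real (wmax w) - \<bar>real_of_int (last w + 1)\<bar>) + tail (wmax w)"
    "residual (w @ [last w - 1]) = \<phi> (wmax w) * (real (wmax w) - \<bar>real_of_int (last w - 1)\<bar>) + tail (wmax w)"
    using le by (intro residual_snoc ne; linarith)+
  have e: "\<bar>real_of_int (last w - 1)\<bar> = 2 * \<bar>real_of_int (last w)\<bar> + 2 * of_bool (last w = 0)
      - \<bar>real_of_int (last w + 1)\<bar>" using abs_neighbours[of "last w"] by linarith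
  show ?thesis unfolding r e unfolding residual_def zero_reward_def by (simp add: field_simps)
qed

lemma residual_tendsto_0:
  assumes "h \<in> walks n"
  shows "(\<lambda>j. walk_mean residual j h) \<longlonglongrightarrow> 0"
proof (rule walk_mean_wmax_tendsto_0[OF assms])
  show "(\<lambda>k. real k * \<phi> k + tail k) \<longlonglongrightarrow> 0"
    using tendsto_add[OF times_phi_tendsto_0 tail_tendsto_0] by simp
  show "\<bar>residual w\<bar> \<le> real (wmax w) * \<phi> (wmax w) + tail (wmax w)" if "w \<in> walks k" for w k
    using residual_bounds[OF walks_nonempty[OF that]] by simp
qed

lemma zero_reward_sums:
  assumes "h \<in> walks n"
  shows "(\<lambda>j. walk_mean zero_reward j h) sums residual h"
proof -
  have "(\<Sum>j<J. walk_mean zero_reward j h) = residual h - walk_mean residual J h" for J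
    by (rule walk_mean_potential[OF assms]) (rule residual_step)
  moreover have "(\<lambda>J. residual h - walk_mean residual J h) \<longlonglongrightarrow> residual h - 0"
    by (intro tendsto_diff tendsto_const residual_tendsto_0[OF assms])
  ultimately show ?thesis by (simp add: sums_def)
qed

text \<open>The reward itself need not decrease in the mean, so the estimate is made for the larger,
  antitone weight \<open>tail\<close>.\<close>

lemma zero_reward_little_o:
  assumes "h \<in> walks n"
  shows "(\<lambda>j. real j * walk_mean zero_reward j h) \<longlonglongrightarrow> 0"
proof (rule Lim_null_comparison)
  show "(\<lambda>j. real j * walk_mean (\<lambda>w. tail (wmax w)) j h) \<longlonglongrightarrow> 0"
    by (intro walk_mean_wmax_little_o[OF assms] antimono_tail tail_nonneg summable_weighted_tail)
  have "zero_reward w \<le> tail (wmax w)" for w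
    using phi_le_tail tail_nonneg by (simp add: zero_reward_def)
  then show "\<forall>\<^sub>F j in sequentially. norm (real j * walk_mean zero_reward j h)
      \<le> real j * walk_mean (\<lambda>w. tail (wmax w)) j h"
    using walk_mean_nonneg[OF assms, of _ zero_reward] zero_reward_nonneg
    by (intro always_eventually allI) (auto simp: abs_mult intro!: mult_left_mono walk_mean_mono[OF assms])
qed

text \<open>The \<open>j\<close>-th summand accounts for the extensions whose last zero comes \<open>j\<close> steps after \<open>h\<close>, the term
  with \<^const>\<open>survival\<close> for those without a further zero.\<close>

lemma walk_mean_gmax:
  "h \<in> walks n \<Longrightarrow> walk_mean (\<lambda>w. \<phi> (gmax w)) m h
    = \<phi> (gmax h) * survival m (last h) + (\<Sum>j\<le>m. walk_mean zero_reward j h * no_return (m - j))"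
proof (induction m arbitrary: h n)
  case 0
  then show ?case using gmax_eq_wmax[OF walks_nonempty[OF 0]] by (simp add: zero_reward_def)
next
  case (Suc m)
  have ne: "h \<noteq> []" using walks_nonempty[OF Suc.prems] .
  let ?u = "h @ [last h + 1]" and ?d = "h @ [last h - 1]"
  have IH: "walk_mean (\<lambda>w. \<phi> (gmax w)) m h' = \<phi> (gmax h) * survival m (last h')
      + (\<Sum>j\<le>m. walk_mean zero_reward j h' * no_return (m - j))"
    if "h' = ?u \<or> h' = ?d" for h'
  proof -
    have "h' \<in> walks (Suc n)" using that Suc.prems by auto
    \<comment> \<open>\<open>gmax\<close> changes only on landing at 0, where the survival factor
      vanishes.\<close>
    moreover have "\<phi> (gmax h') * survival m (last h') = \<phi> (gmax h) * survival m (last h')"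
      using that ne by (cases "last h' = 0") (auto simp: gmax_snoc)
    ultimately show ?thesis using Suc.IH by metis
  qed
  have sum: "(\<Sum>j\<le>m. walk_mean zero_reward j ?u * no_return (m - j))
      + (\<Sum>j\<le>m. walk_mean zero_reward j ?d * no_return (m - j))
      = 2 * (\<Sum>j\<le>m. walk_mean zero_reward (Suc j) h * no_return (m - j))"
    unfolding sum.distrib[symmetric] sum_distrib_left by (intro sum.cong) (simp_all add: field_simps)
  have "walk_mean (\<lambda>w. \<phi> (gmax w)) (Suc m) h
      = \<phi> (gmax h) * ((survival m (last h + 1) + survival m (last h - 1)) / 2)
        + (\<Sum>j\<le>m. walk_mean zero_reward (Suc j) h * no_return (m - j))"
    using IH[of ?u] IH[of ?d] sum by (simp add: field_simps)
  \<comment> \<open>At a zero the left side is the new summand j = 0, because \<open>gmax\<close>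
    and \<open>wmax\<close> agree there; off 0 that summand is 0 and the recursion of
    \<open>survival\<close> applies.\<close>
  also have "\<phi> (gmax h) * ((survival m (last h + 1) + survival m (last h - 1)) / 2)
      = \<phi> (gmax h) * survival (Suc m) (last h) + zero_reward h * no_return (Suc m)"
    using gmax_eq_wmax[OF ne] survival_uminus[of m 1] by (simp add: zero_reward_def)
  also have "\<phi> (gmax h) * survival (Suc m) (last h) + zero_reward h * no_return (Suc m)
        + (\<Sum>j\<le>m. walk_mean zero_reward (Suc j) h * no_return (m - j))
      = \<phi> (gmax h) * survival (Suc m) (last h)
        + (\<Sum>j\<le>Suc m. walk_mean zero_reward j h * no_return (Suc m - j))"
    unfolding sum.atMost_Suc_shift by simp
  finally show ?case .
qed

lemma walk_mean_gmax_asymp: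
  assumes "h \<in> walks n"
  shows "(\<lambda>m. walk_mean (\<lambda>w. \<phi> (gmax w)) m h / no_return m) \<longlonglongrightarrow> Mword h"
proof -
  have "(\<lambda>m. \<phi> (gmax h) * (survival m (last h) / no_return m)
      + (\<Sum>j\<le>m. walk_mean zero_reward j h * no_return (m - j)) / no_return m) \<longlonglongrightarrow> Mword h"
    unfolding Mword_def
    by (intro tendsto_add tendsto_mult tendsto_const survival_ratio convolution_no_return
        zero_reward_sums[OF assms] zero_reward_little_o[OF assms] walk_mean_nonneg[OF assms] zero_reward_nonneg)
  then show ?thesis
    unfolding walk_mean_gmax[OF assms] by (simp add: add_divide_distrib)
qed

text \<open>The two parts compensate at a zero: the absolute value gains 1 with coefficient \<phi>
  at \<open>gmax\<close>, the residual loses \<phi> at \<open>wmax\<close>, and the two maxima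
  coincide.\<close>

lemma Mword_step:
  assumes w: "w \<in> walks n"
  shows "Mword w = (Mword (w @ [last w + 1]) + Mword (w @ [last w - 1])) / 2"
proof -
  have ne: "w \<noteq> []" using walks_nonempty[OF w] .
  have g: "\<phi> (gmax (w @ [y])) * \<bar>real_of_int y\<bar> = \<phi> (gmax w) * \<bar>real_of_int y\<bar>" for y
    using ne by (simp add: gmax_snoc)
  have e: "\<bar>real_of_int (last w - 1)\<bar> = 2 * \<bar>real_of_int (last w)\<bar> + 2 * of_bool (last w = 0)
      - \<bar>real_of_int (last w + 1)\<bar>" using abs_neighbours[of "last w"] by linarith
  have "Mword (w @ [last w + 1]) + Mword (w @ [last w - 1])
      = \<phi> (gmax w) * (\<bar>real_of_int (last w + 1)\<bar> + \<bar>real_of_int (last w - 1)\<bar>)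
        + (residual (w @ [last w + 1]) + residual (w @ [last w - 1]))"
    unfolding Mword_def distrib_left last_snoc g by simp
  also have "\<dots> = 2 * Mword w"
    unfolding e using residual_step[OF w] gmax_eq_wmax[OF ne]
    by (cases "last w = 0") (simp_all add: Mword_def zero_reward_def field_simps)
  finally show ?thesis by simp
qed

lemma walk_mean_Mword:
  assumes "h \<in> walks n"
  shows "walk_mean Mword m h = Mword h"
  by (rule walk_mean_harmonic[OF assms]) (rule Mword_step)

text \<open>The leading term of \<^const>\<open>Mword\<close>, modified at 0 into a harmonic function for the walk killed at
  its return to 0.\<close>

definition escape :: "nat \<Rightarrow> int list \<Rightarrow> real" where
  "escape n w = of_bool (no_zero_after n w) * \<phi> (gmax w) * (if last w = 0 then 1 else \<bar>real_of_int (last w)\<bar>)"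

lemma escape_step:
  assumes w: "w \<in> walks k" and "n \<le> k"
  shows "escape n w = (escape n (w @ [last w + 1]) + escape n (w @ [last w - 1])) / 2"
proof -
  have ne: "w \<noteq> []" using walks_nonempty[OF w] .
  have "n < length w" using assms walks_length by fastforce
  note nz = no_zero_after_snoc[OF this]
  have s: "escape n (w @ [y]) = of_bool (no_zero_after n w) * \<phi> (gmax w) * \<bar>real_of_int y\<bar>" for y
    using ne by (auto simp: escape_def nz gmax_snoc)
  have "\<bar>real_of_int (last w + 1)\<bar> + \<bar>real_of_int (last w - 1)\<bar>
      = 2 * (if last w = 0 then 1 else \<bar>real_of_int (last w)\<bar>)"
    using abs_neighbours[of "last w"] by auto
  then show ?thesis unfolding s unfolding escape_def
    by (simp only: distrib_left[symmetric])
qed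

text \<open>On words without a zero after n, \<open>Mword\<close> is the harmonic
  \<open>escape\<close> plus the residual, whose mean vanishes in the limit.\<close>

lemma walk_mean_no_zero_after_Mword:
  assumes h: "h \<in> walks n"
  shows "(\<lambda>m. walk_mean (\<lambda>w. of_bool (no_zero_after n w) * Mword w) m h) \<longlonglongrightarrow> escape n h"
proof -
  let ?R = "\<lambda>w. of_bool (no_zero_after n w) * residual w"
  have R: "(\<lambda>m. walk_mean ?R m h) \<longlonglongrightarrow> 0"
  proof (rule Lim_null_comparison[OF _ residual_tendsto_0[OF h]], intro always_eventually allI)
    fix m
    have "0 \<le> walk_mean ?R m h" "walk_mean ?R m h \<le> walk_mean residual m h"
      using residual_bounds(1)[OF walks_nonempty]
      by (auto intro!: walk_mean_nonneg[OF h] walk_mean_mono[OF h])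
    then show "norm (walk_mean ?R m h) \<le> walk_mean residual m h" by simp
  qed
  \<comment> \<open>m = 0 is left out because a word ending in 0 has \<open>escape\<close> built
    with 1 in place of the absolute value 0.\<close>
  have "walk_mean (\<lambda>w. of_bool (no_zero_after n w) * Mword w) m h = escape n h + walk_mean ?R m h"
    if "0 < m" for m
  proof -
    have "walk_mean (\<lambda>w. of_bool (no_zero_after n w) * Mword w) m h = walk_mean (\<lambda>w. escape n w + ?R w) m h"
    proof (rule walk_mean_cong[OF h])
      fix w assume "w \<in> walks (n + m)"
      then show "of_bool (no_zero_after n w) * Mword w = escape n w + ?R w"
        using no_zero_after_last[of w "n + m" n] that by (auto simp: escape_def Mword_def)
    qed
    also have "\<dots> = escape n h + walk_mean ?R m h"
      unfolding walk_mean_plus using walk_mean_harmonic[OF h, of "escape n" m] escape_step by simp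
    finally show ?thesis .
  qed
  then have "\<forall>\<^sub>F m in sequentially. escape n h + walk_mean ?R m h
      = walk_mean (\<lambda>w. of_bool (no_zero_after n w) * Mword w) m h"
    by (intro eventually_mono[OF eventually_gt_at_top[of 0]]) simp
  moreover have "(\<lambda>m. escape n h + walk_mean ?R m h) \<longlonglongrightarrow> escape n h + 0"
    by (intro tendsto_add tendsto_const R)
  ultimately show ?thesis by (simp add: Lim_transform_eventually)
qed

end

section \<open>Laws on the path space\<close>

lemma path_upto_Suc: "path_upto (Suc n) \<omega> = path_upto n \<omega> @ [\<omega> (Suc n)]"
  by (simp add: path_upto_def)

lemma path_upto_0 [simp]: "path_upto 0 \<omega> = [\<omega> 0]"
  by (simp add: path_upto_def)

lemma length_path_upto [simp]: "length (path_upto n \<omega>) = Suc n"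
  by (simp add: path_upto_def)

lemma path_upto_nonempty [simp]: "path_upto n \<omega> \<noteq> []"
  by (simp add: path_upto_def)

lemma last_path_upto [simp]: "last (path_upto n \<omega>) = \<omega> n"
  by (simp add: path_upto_def)

lemma nth_path_upto: "i \<le> n \<Longrightarrow> path_upto n \<omega> ! i = \<omega> i"
  by (simp add: path_upto_def del: upt_Suc)

lemma take_path_upto: "n \<le> p \<Longrightarrow> take (Suc n) (path_upto p \<omega>) = path_upto n \<omega>"
  by (simp add: path_upto_def take_map take_upt del: upt_Suc)

lemma path_step: "\<omega> \<in> paths \<Longrightarrow> \<omega> (Suc n) = \<omega> n + 1 \<or> \<omega> (Suc n) = \<omega> n - 1"
proof -
  assume "\<omega> \<in> paths"
  then have "\<bar>\<omega> (Suc n) - \<omega> n\<bar> = 1" by (simp add: paths_def)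
  then show ?thesis by linarith
qed

lemma path_upto_in_walks:
  assumes "\<omega> \<in> paths" "\<omega> 0 = 0"
  shows "path_upto n \<omega> \<in> walks n"
proof (induction n)
  case (Suc n)
  then show ?case using path_step[OF assms(1), of n] by (force simp: path_upto_Suc)
qed (simp add: assms)

lemma Smax_eq_wmax: "Smax n \<omega> = wmax (path_upto n \<omega>)"
  by (simp add: Smax_def wmax_def path_upto_def image_image atLeastLessThanSuc_atLeastAtMost del: upt_Suc)

lemma last_zero_upto_Suc:
  "last_zero_upto (Suc n) \<omega> = (if \<omega> (Suc n) = 0 then Suc n else last_zero_upto n \<omega>)"
proof (cases "\<omega> (Suc n) = 0")
  case True
  then show ?thesis unfolding last_zero_upto_def by (auto intro!: cSup_eq_maximum)
next
  case False
  then have "{k. k \<le> Suc n \<and> \<omega> k = 0} = {k. k \<le> n \<and> \<omega> k = 0}" by (auto simp: le_Suc_eq)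
  then show ?thesis using False by (simp add: last_zero_upto_def)
qed

lemma last_zero_upto_0 [simp]: "last_zero_upto 0 \<omega> = 0"
proof -
  have "{k. k \<le> 0 \<and> \<omega> k = 0} = (if \<omega> 0 = 0 then {0} else {})" by auto
  then show ?thesis unfolding last_zero_upto_def by (simp add: Sup_nat_def)
qed

lemma Smax_last_zero_upto: "Smax (last_zero_upto n \<omega>) \<omega> = gmax (path_upto n \<omega>)"
proof (induction n)
  case (Suc n)
  show ?case
    by (simp add: last_zero_upto_Suc path_upto_Suc gmax_snoc Suc)
      (simp add: Smax_eq_wmax path_upto_Suc)
qed (simp add: Smax_eq_wmax)

lemma num_zeros_eq_count: "num_zeros n \<omega> = count_list (path_upto n \<omega>) 0"
  by (induction n) (simp_all add: num_zeros_def path_upto_Suc)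

lemma (in penalty) Mstar_eq_Mword: "Mstar \<phi> n \<omega> = Mword (path_upto n \<omega>)"
  unfolding Mstar_def Smax_last_zero_upto by (simp add: Mword_def residual_def Smax_eq_wmax)

section \<open>The filtration in terms of words\<close>

lemma space_cF [simp]: "space (cF n) = paths"
  unfolding cF_def by (rule space_measure_of) auto

lemma measurable_coordinate_cF:
  assumes "k \<le> n"
  shows "(\<lambda>\<omega>. \<omega> k) \<in> measurable (cF n) (count_space UNIV)"
proof (rule measurableI)
  fix A :: "int set"
  have "(\<lambda>\<omega>. \<omega> k) -` A \<inter> space (cF n) = {\<omega> \<in> paths. \<omega> k \<in> A}" by auto
  also have "\<dots> \<in> sets (cF n)" unfolding cF_def using assms
    by (subst sets_measure_of) auto
  finally show "(\<lambda>\<omega>. \<omega> k) -` A \<inter> space (cF n) \<in> sets (cF n)" .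
qed simp

lemma measurable_path_upto_of_coordinates:
  assumes "\<And>k. k \<le> n \<Longrightarrow> (\<lambda>\<omega>. X \<omega> k) \<in> measurable M (count_space UNIV)"
  shows "(\<lambda>\<omega>. path_upto n (X \<omega>)) \<in> measurable M (count_space UNIV)"
  using assms
proof (induction n)
  case 0
  then show ?case by (auto intro: measurable_compose[OF _ measurable_count_space])
next
  case (Suc n)
  have "(\<lambda>\<omega>. (\<lambda>h \<omega>. h @ [X \<omega> (Suc n)]) (path_upto n (X \<omega>)) \<omega>) \<in> measurable M (count_space UNIV)"
  proof (rule measurable_compose_countable[where f = "\<lambda>h \<omega>. h @ [X \<omega> (Suc n)]"])
    show "(\<lambda>\<omega>. h @ [X \<omega> (Suc n)]) \<in> measurable M (count_space UNIV)" for h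
      by (rule measurable_compose[OF Suc.prems measurable_count_space]) simp
    show "(\<lambda>\<omega>. path_upto n (X \<omega>)) \<in> measurable M (count_space UNIV)"
      using Suc by simp
  qed
  then show ?case by (simp add: path_upto_Suc)
qed

lemma measurable_path_upto_cF: "path_upto n \<in> measurable (cF n) (count_space UNIV)"
  using measurable_path_upto_of_coordinates[of n "\<lambda>\<omega>. \<omega>" "cF n"] measurable_coordinate_cF by simp

text \<open>Words are countably many, so the events up to time n are exactly the arbitrary sets of
  words. Integrals over them become finite sums.\<close>

lemma sets_cF: "sets (cF n) = {{\<omega> \<in> paths. path_upto n \<omega> \<in> L} | L. True}"
proof
  let ?V = "vimage_algebra paths (path_upto n) (count_space UNIV)"
  have V: "sets ?V = {{\<omega> \<in> paths. path_upto n \<omega> \<in> L} | L. True}"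
    by (subst sets_vimage_algebra2) (auto simp: vimage_def Int_def conj_commute)
  have "{{\<omega> \<in> paths. \<omega> k \<in> A} |k A. k \<le> n} \<subseteq> sets ?V"
  proof safe
    fix k A assume "k \<le> n"
    then have "{\<omega> \<in> paths. \<omega> k \<in> A} = {\<omega> \<in> paths. path_upto n \<omega> \<in> {h. h ! k \<in> A}}"
      by (auto simp: nth_path_upto)
    then show "{\<omega> \<in> paths. \<omega> k \<in> A} \<in> sets ?V" unfolding V by blast
  qed
  from sets.sigma_sets_subset[OF this]
  show "sets (cF n) \<subseteq> {{\<omega> \<in> paths. path_upto n \<omega> \<in> L} | L. True}"
    unfolding V[symmetric] cF_def by (subst sets_measure_of) auto
  show "{{\<omega> \<in> paths. path_upto n \<omega> \<in> L} | L. True} \<subseteq> sets (cF n)"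
    using measurable_sets[OF measurable_path_upto_cF[of n]] by (auto simp: vimage_def Int_def conj_commute)
qed

lemma cF_I: "{\<omega> \<in> paths. path_upto n \<omega> \<in> L} \<in> sets (cF n)"
  by (auto simp: sets_cF)

lemma sets_cF_mono: "m \<le> n \<Longrightarrow> sets (cF m) \<subseteq> sets (cF n)"
proof
  fix A assume "m \<le> n" "A \<in> sets (cF m)"
  then obtain L where "A = {\<omega> \<in> paths. path_upto m \<omega> \<in> L}" by (auto simp: sets_cF)
  then have "A = {\<omega> \<in> paths. path_upto n \<omega> \<in> {h. take (Suc m) h \<in> L}}"
    using \<open>m \<le> n\<close> by (auto simp: take_path_upto)
  then show "A \<in> sets (cF n)" by (simp only: cF_I)
qed

lemma cF_subset_paths: "(\<Union>n. sets (cF n)) \<subseteq> Pow paths"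
  by (auto simp: sets_cF)

lemma space_cF_inf [simp]: "space cF_inf = paths"
  unfolding cF_inf_def by (rule space_measure_of[OF cF_subset_paths])

lemma sets_cF_inf: "sets cF_inf = sigma_sets paths (\<Union>n. sets (cF n))"
  unfolding cF_inf_def by (rule sets_measure_of[OF cF_subset_paths])

lemma cF_subset_cF_inf: "sets (cF n) \<subseteq> sets cF_inf"
  by (auto simp: sets_cF_inf)

lemma cF_inf_I [measurable]: "{\<omega> \<in> paths. path_upto n \<omega> \<in> L} \<in> sets cF_inf"
  using cF_I cF_subset_cF_inf by blast

lemma measurable_from_cF: "f \<in> measurable (cF n) N \<Longrightarrow> f \<in> measurable cF_inf N"
  using cF_subset_cF_inf by (auto simp: measurable_def)

lemma measurable_path_upto [measurable]: "path_upto n \<in> measurable cF_inf (count_space UNIV)"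
  by (rule measurable_from_cF[OF measurable_path_upto_cF])

lemma measurable_coordinate [measurable]: "(\<lambda>\<omega>. \<omega> k) \<in> measurable cF_inf (count_space UNIV)"
  by (rule measurable_from_cF[OF measurable_coordinate_cF[OF order_refl]])

lemma Int_stable_cF: "Int_stable (\<Union>n. sets (cF n))"
proof (rule Int_stableI)
  fix a b assume "a \<in> (\<Union>n. sets (cF n))" "b \<in> (\<Union>n. sets (cF n))"
  then obtain m n where "a \<in> sets (cF m)" "b \<in> sets (cF n)" by auto
  then have "a \<in> sets (cF (max m n))" "b \<in> sets (cF (max m n))"
    using sets_cF_mono[of m "max m n"] sets_cF_mono[of n "max m n"] by auto
  then have "a \<inter> b \<in> sets (cF (max m n))" by auto
  then show "a \<inter> b \<in> (\<Union>n. sets (cF n))" by blast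
qed

text \<open>The common frame for the random walk and Q. Only words from 0 with unit steps receive
  weights; \<open>f [0] = 1\<close> and the path space make all other words null.\<close>

locale walk_law = prob_space \<mu> for \<mu> :: "(nat \<Rightarrow> int) measure" +
  fixes f :: "int list \<Rightarrow> real"
  assumes sets_law [measurable_cong]: "sets \<mu> = sets cF_inf"
    and cylinder: "h \<in> walks n \<Longrightarrow> measure \<mu> {\<omega> \<in> paths. path_upto n \<omega> = h} = f h"
    and start: "f [0] = 1"
begin

lemma space_law [simp]: "space \<mu> = paths"
  using sets_eq_imp_space_eq[OF sets_law] by simp

lemma AE_start: "AE \<omega> in \<mu>. \<omega> 0 = 0"
proof -
  have "measure \<mu> {\<omega> \<in> space \<mu>. \<omega> 0 = 0} = 1" using cylinder[of "[0]" 0] start by simp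
  moreover have "{\<omega> \<in> space \<mu>. \<omega> 0 = 0} \<in> sets \<mu>"
    using cF_inf_I[of 0 "{[0]}"] by (simp add: sets_law)
  ultimately show ?thesis by (subst prob_Collect_eq_1[symmetric])
qed

lemma AE_walks: "AE \<omega> in \<mu>. \<forall>n. path_upto n \<omega> \<in> walks n"
proof -
  have "AE \<omega> in \<mu>. \<omega> \<in> paths" using AE_space[of \<mu>] by simp
  with AE_start show ?thesis by eventually_elim (auto intro: path_upto_in_walks)
qed

lemma law_sum:
  fixes G :: "int list \<Rightarrow> real"
  shows "integrable \<mu> (\<lambda>\<omega>. G (path_upto n \<omega>))"
    and "(\<integral>\<omega>. G (path_upto n \<omega>) \<partial>\<mu>) = (\<Sum>h\<in>walks n. f h * G h)"
proof -
  let ?S = "\<lambda>\<omega>. \<Sum>h\<in>walks n. G h * indicator {\<omega> \<in> paths. path_upto n \<omega> = h} \<omega>"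
  have cyl: "{\<omega> \<in> paths. path_upto n \<omega> = h} \<in> sets \<mu>" for h
    using cF_inf_I[of n "{h}"] by (simp add: sets_law)
  have eq: "AE \<omega> in \<mu>. G (path_upto n \<omega>) = ?S \<omega>"
    using AE_walks AE_space
  proof eventually_elim
    case (elim \<omega>)
    then have "\<omega> \<in> paths" by simp
    then have "?S \<omega> = (\<Sum>h\<in>walks n. if h = path_upto n \<omega> then G h else 0)"
      by (intro sum.cong) (auto simp: indicator_def)
    then show ?case using elim by simp
  qed
  have S: "integrable \<mu> ?S" using cyl by (intro Bochner_Integration.integrable_sum) (simp add: less_top[symmetric])
  have m: "(\<lambda>\<omega>. G (path_upto n \<omega>)) \<in> borel_measurable \<mu>" by measurable
  show "integrable \<mu> (\<lambda>\<omega>. G (path_upto n \<omega>))"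
    using integrable_cong_AE[OF m _ eq] S by blast
  have "(\<integral>\<omega>. G (path_upto n \<omega>) \<partial>\<mu>) = (\<integral>\<omega>. ?S \<omega> \<partial>\<mu>)"
    using S by (intro integral_cong_AE m eq) auto
  also have "\<dots> = (\<Sum>h\<in>walks n. G h * measure \<mu> {\<omega> \<in> paths. path_upto n \<omega> = h})"
    using cyl by (subst Bochner_Integration.integral_sum)
      (auto simp: less_top[symmetric] Int_absorb2 subset_eq intro!: sum.cong)
  finally show "(\<integral>\<omega>. G (path_upto n \<omega>) \<partial>\<mu>) = (\<Sum>h\<in>walks n. f h * G h)"
    by (simp add: cylinder mult.commute)
qed

lemma law_measure:
  "measure \<mu> {\<omega> \<in> paths. path_upto n \<omega> \<in> L} = (\<Sum>h\<in>walks n. f h * of_bool (h \<in> L))"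
proof -
  have "measure \<mu> {\<omega> \<in> paths. path_upto n \<omega> \<in> L} = (\<integral>\<omega>. indicator {\<omega> \<in> paths. path_upto n \<omega> \<in> L} \<omega> \<partial>\<mu>)"
    by (simp add: Int_absorb2 subset_eq)
  also have "\<dots> = (\<integral>\<omega>. of_bool (path_upto n \<omega> \<in> L) \<partial>\<mu>)"
    by (intro Bochner_Integration.integral_cong) (auto simp: indicator_def)
  also have "\<dots> = (\<Sum>h\<in>walks n. f h * of_bool (h \<in> L))" by (rule law_sum(2))
  finally show ?thesis .
qed

end

lemma walk_law_unique:
  assumes "walk_law \<mu> f" "walk_law \<nu> f"
  shows "\<mu> = \<nu>"
proof -
  interpret M: walk_law \<mu> f by fact
  interpret N: walk_law \<nu> f by fact
  show ?thesis
  proof (rule measure_eqI_generator_eq[OF Int_stable_cF cF_subset_paths])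
    fix X assume "X \<in> (\<Union>n. sets (cF n))"
    then obtain n L where "X = {\<omega> \<in> paths. path_upto n \<omega> \<in> L}" by (auto simp: sets_cF)
    then show "emeasure \<mu> X = emeasure \<nu> X"
      by (simp add: M.emeasure_eq_measure N.emeasure_eq_measure M.law_measure N.law_measure)
  next
    show "range (\<lambda>_. paths) \<subseteq> (\<Union>n. sets (cF n))" using sets.top[of "cF 0"] by auto
  qed (auto simp: M.sets_law N.sets_law sets_cF_inf M.emeasure_eq_measure)
qed

text \<open>With uniform inputs and a threshold depending on the past, a driven walk realizes any consistent
  family of cylinder weights. This replaces an extension theorem in the construction of \<open>Q\<close>.\<close>

primrec driven_word :: "(int list \<Rightarrow> 'a \<Rightarrow> int) \<Rightarrow> (nat \<Rightarrow> 'a) \<Rightarrow> nat \<Rightarrow> int list" where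
  "driven_word st u 0 = [0]"
| "driven_word st u (Suc n) = driven_word st u n @ [last (driven_word st u n) + st (driven_word st u n) (u n)]"

definition driven_path :: "(int list \<Rightarrow> 'a \<Rightarrow> int) \<Rightarrow> (nat \<Rightarrow> 'a) \<Rightarrow> nat \<Rightarrow> int" where
  "driven_path st u n = last (driven_word st u n)"

lemma path_upto_driven_path: "path_upto n (driven_path st u) = driven_word st u n"
  by (induction n) (simp_all add: path_upto_Suc driven_path_def)

lemma length_driven_word [simp]: "length (driven_word st u n) = Suc n"
  by (induction n) simp_all

text \<open>Once the target word is fixed, the thresholds no longer depend on the inputs. Each input
  meets one condition of its own, and the event is a product box.\<close>

lemma driven_word_eq_iff:
  "length h = Suc n \<Longrightarrow> h ! 0 = 0 \<Longrightarrow>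
    driven_word st u n = h \<longleftrightarrow> (\<forall>i<n. st (take (Suc i) h) (u i) = h ! Suc i - h ! i)"
proof (induction n arbitrary: h)
  case 0
  then show ?case by (cases h) auto
next
  case (Suc n)
  obtain h' y where h: "h = h' @ [y]" using Suc.prems by (cases h rule: rev_cases) auto
  then have l: "length h' = Suc n" using Suc.prems by simp
  then have ne: "h' \<noteq> []" by auto
  have last: "last h' = h' ! n" using l ne by (simp add: last_conv_nth)
  have IH: "driven_word st u n = h' \<longleftrightarrow> (\<forall>i<n. st (take (Suc i) h') (u i) = h' ! Suc i - h' ! i)"
    using Suc.prems h l by (intro Suc.IH) (auto simp: nth_append)
  have "(\<forall>i<Suc n. st (take (Suc i) h) (u i) = h ! Suc i - h ! i)
      \<longleftrightarrow> driven_word st u n = h' \<and> st h' (u n) = y - last h'"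
    unfolding IH All_less_Suc using l last by (auto simp: h nth_append)
  then show ?case by (auto simp: h)
qed

lemma walks_start: "h \<in> walks n \<Longrightarrow> h ! 0 = 0"
proof (induction n arbitrary: h)
  case (Suc n)
  then obtain h' y where "h' \<in> walks n" "h = h' @ [y]" by auto
  then show ?case using Suc.IH[of h'] walks_length[of h' n] by (simp add: nth_append)
qed simp

lemma walk_law_driven:
  fixes N :: "'a measure" and st :: "int list \<Rightarrow> 'a \<Rightarrow> int"
  assumes N: "prob_space N"
    and st_meas: "\<And>h. st h \<in> measurable N (count_space UNIV)"
    and st_range: "\<And>h a. a \<in> space N \<Longrightarrow> st h a = 1 \<or> st h a = -1"
    and f0: "f [0] = 1"
    and fs: "\<And>n h s. h \<in> walks n \<Longrightarrow> s = 1 \<or> s = -1 \<Longrightarrow>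
      f (h @ [last h + s]) = f h * measure N {a \<in> space N. st h a = s}"
  shows "walk_law (distr (PiM UNIV (\<lambda>_::nat. N)) cF_inf (driven_path st)) f"
proof -
  let ?P = "PiM UNIV (\<lambda>_::nat. N)"
  interpret N: prob_space N by fact
  interpret P: product_prob_space "\<lambda>_. N" UNIV ..
  have wd: "(\<lambda>u. driven_word st u n) \<in> measurable ?P (count_space UNIV)" for n
  proof (induction n)
    case (Suc n)
    have "(\<lambda>u. (\<lambda>h u. h @ [last h + st h (u n)]) (driven_word st u n) u) \<in> measurable ?P (count_space UNIV)"
    proof (rule measurable_compose_countable[OF _ Suc])
      fix h
      have "(\<lambda>u. st h (u n)) \<in> measurable ?P (count_space UNIV)"
        using measurable_compose[of "\<lambda>u. u n" ?P N, OF measurable_component_singleton st_meas] by simp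
      from measurable_compose[OF this, of "\<lambda>s. h @ [last h + s]" "count_space UNIV"]
      show "(\<lambda>u. h @ [last h + st h (u n)]) \<in> measurable ?P (count_space UNIV)" by simp
    qed
    then show ?case by simp
  qed simp
  have in_paths: "driven_path st u \<in> paths" if "u \<in> space ?P" for u
  proof -
    have "u n \<in> space N" for n using that by (simp add: space_PiM PiE_iff)
    then show ?thesis using st_range by (auto simp: paths_def driven_path_def) (metis abs_1 abs_minus_cancel)
  qed
  have m: "driven_path st \<in> measurable ?P cF_inf"
    unfolding cF_inf_def
  proof (rule measurable_measure_of[OF cF_subset_paths])
    show "driven_path st \<in> space ?P \<rightarrow> paths" using in_paths by auto
    fix A assume "A \<in> (\<Union>n. sets (cF n))"
    then obtain n L where A: "A = {\<omega> \<in> paths. path_upto n \<omega> \<in> L}" by (auto simp: sets_cF)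
    have "driven_path st -` A \<inter> space ?P = (\<lambda>u. driven_word st u n) -` L \<inter> space ?P"
      using in_paths by (auto simp: A path_upto_driven_path)
    then show "driven_path st -` A \<inter> space ?P \<in> sets ?P" using measurable_sets[OF wd, of L n] by simp
  qed
  have box: "measure ?P {u \<in> space ?P. driven_word st u n = h} = f h" if h: "h \<in> walks n" for n h
  proof -
    let ?A = "\<lambda>h i. {a \<in> space N. st (take (Suc i) h) a = h ! Suc i - h ! i}"
    have A: "?A h i \<in> sets N" for h i
      using measurable_sets[OF st_meas, of "{h ! Suc i - h ! i}" "take (Suc i) h"]
      by (simp add: vimage_def Int_def conj_commute)
    have "{u \<in> space ?P. driven_word st u n = h} = prod_emb UNIV (\<lambda>_. N) {..<n} (PiE {..<n} (?A h))"
      using walks_length[OF h] walks_start[OF h]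
      by (auto simp: driven_word_eq_iff prod_emb_def space_PiM PiE_iff extensional_def)
    then have "measure ?P {u \<in> space ?P. driven_word st u n = h} = (\<Prod>i<n. measure N (?A h i))"
      using A by (simp add: P.measure_PiM_emb)
    also have "\<dots> = f h" using h
    proof (induction n arbitrary: h)
      case 0
      then show ?case by (simp add: f0)
    next
      case (Suc n)
      then obtain h' s where h': "h' \<in> walks n" "h = h' @ [last h' + s]" "s = 1 \<or> s = -1"
        by (auto simp: diff_conv_add_uminus simp del: add_uminus_conv_diff)
      have l: "length h' = Suc n" using walks_length[OF h'(1)] .
      have "h' ! n = last h'" using l walks_nonempty[OF h'(1)] by (simp add: last_conv_nth)
      then have An: "?A h n = {a \<in> space N. st h' a = s}" using l by (simp add: h'(2) nth_append)
      have "?A h i = ?A h' i" if "i < n" for i using l that by (simp add: h'(2) nth_append)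
      then have "(\<Prod>i<n. measure N (?A h i)) = (\<Prod>i<n. measure N (?A h' i))" by simp
      also have "\<dots> = f h'" by (rule Suc.IH[OF h'(1)])
      finally show ?case using fs[OF h'(1,3)] An h'(2) by simp
    qed
    finally show ?thesis .
  qed
  interpret D: prob_space "distr ?P cF_inf (driven_path st)" by (rule P.prob_space_distr[OF m])
  show "walk_law (distr ?P cF_inf (driven_path st)) f"
  proof
    fix h n assume h: "h \<in> walks n"
    have "driven_path st -` {\<omega> \<in> paths. path_upto n \<omega> = h} \<inter> space ?P
        = {u \<in> space ?P. driven_word st u n = h}"
      using in_paths by (auto simp: path_upto_driven_path)
    moreover have "{\<omega> \<in> paths. path_upto n \<omega> = h} \<in> sets cF_inf" using cF_inf_I[of n "{h}"] by simp
    ultimately show "measure (distr ?P cF_inf (driven_path st)) {\<omega> \<in> paths. path_upto n \<omega> = h} = f h"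
      using measure_distr[OF m] box[OF h] by simp
  qed (simp_all add: f0)
qed

abbreviation srw_weight :: "int list \<Rightarrow> real" where
  "srw_weight h \<equiv> 1 / 2 ^ (length h - 1)"

lemma walk_law_SRW: "walk_law SRW srw_weight"
proof -
  let ?N = "uniform_count_measure {-1, 1::int}"
  have N: "prob_space ?N" by (rule prob_space_uniform_count_measure) auto
  have half: "measure ?N {a \<in> space ?N. a = s} = 1 / 2" if "s = 1 \<or> s = -1" for s
  proof -
    have "{a \<in> space ?N. a = s} = {s}" using that by (auto simp: space_uniform_count_measure)
    then show ?thesis using that by (auto simp: measure_uniform_count_measure)
  qed
  have "driven_path (\<lambda>_ a. a) = (\<lambda>\<xi> n. \<Sum>i<n. \<xi> i)"
  proof (intro ext)
    show "driven_path (\<lambda>_ a. a) \<xi> n = (\<Sum>i<n. \<xi> i)" for \<xi> :: "nat \<Rightarrow> int" and n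
      by (induction n) (simp_all add: driven_path_def)
  qed
  then have SRW: "SRW = distr (PiM UNIV (\<lambda>_::nat. ?N)) cF_inf (driven_path (\<lambda>_ a. a))"
    by (simp add: SRW_def)
  show ?thesis unfolding SRW
  proof (rule walk_law_driven[OF N])
    show "(\<lambda>a. a) \<in> measurable ?N (count_space UNIV)" for h :: "int list"
      by (rule measurableI) (auto simp: sets_uniform_count_measure space_uniform_count_measure)
    show "srw_weight (h @ [last h + s]) = srw_weight h * measure ?N {a \<in> space ?N. a = s}"
      if "h \<in> walks n" "s = 1 \<or> s = -1" for n h s
      unfolding half[OF that(2)] using walks_length[OF that(1)] by simp
  qed (auto simp: space_uniform_count_measure)
qed

interpretation SRW: walk_law SRW srw_weight
  by (rule walk_law_SRW)

lemma SRW_expectation: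
  fixes G :: "int list \<Rightarrow> real"
  shows "(\<integral>\<omega>. G (path_upto n \<omega>) \<partial>SRW) = walk_mean G n [0]"
  by (simp add: SRW.law_sum walk_mean_sum_walks sum_divide_distrib walks_length)

lemma SRW_expectation_indicator:
  fixes G :: "int list \<Rightarrow> real"
  assumes "n \<le> p"
  shows "(\<integral>\<omega>. indicator {\<omega> \<in> paths. path_upto n \<omega> \<in> L} \<omega> * G (path_upto p \<omega>) \<partial>SRW)
    = walk_mean (\<lambda>h. of_bool (h \<in> L) * walk_mean G (p - n) h) n [0]"
proof -
  have "(\<integral>\<omega>. indicator {\<omega> \<in> paths. path_upto n \<omega> \<in> L} \<omega> * G (path_upto p \<omega>) \<partial>SRW)
    = (\<integral>\<omega>. (\<lambda>w. of_bool (take (Suc n) w \<in> L) * G w) (path_upto p \<omega>) \<partial>SRW)"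
    using assms by (intro Bochner_Integration.integral_cong) (auto simp: indicator_def take_path_upto)
  also have "\<dots> = walk_mean (\<lambda>w. of_bool (take (Suc n) w \<in> L) * G w) (n + (p - n)) [0]"
    using assms by (subst SRW_expectation) simp
  also have "\<dots> = walk_mean (\<lambda>h. of_bool (h \<in> L) * walk_mean G (p - n) h) n [0]"
    unfolding walk_mean_add
    by (rule walk_mean_cong[of "[0]" 0])
      (simp_all add: walk_mean_take[of _ n "\<lambda>h. of_bool (h \<in> L)"])
  finally show ?thesis .
qed

section \<open>Existence and uniqueness of the penalized law\<close>

locale prob_penalty = penalty +
  assumes total: "(\<Sum>k. \<phi> k) = 1"
begin

lemma Mword_start: "Mword [0] = 1"
  using total by (simp add: Mword_def residual_def tail_sum_def)

abbreviation q_weight :: "int list \<Rightarrow> real" where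
  "q_weight h \<equiv> Mword h / 2 ^ (length h - 1)"

lemma is_Qstar_iff: "is_Qstar \<phi> Q \<longleftrightarrow> walk_law Q q_weight"
proof
  assume Q: "is_Qstar \<phi> Q"
  then interpret Q: prob_space Q by (simp add: is_Qstar_def)
  show "walk_law Q q_weight"
  proof
    show "sets Q = sets cF_inf" using Q by (simp add: is_Qstar_def)
    fix h n assume h: "h \<in> walks n"
    have "{\<omega> \<in> paths. path_upto n \<omega> = h} = {\<omega> \<in> paths. path_upto n \<omega> \<in> {h}}" by simp
    moreover have "{\<omega> \<in> paths. path_upto n \<omega> \<in> {h}} \<in> sets (cF n)" by (rule cF_I)
    ultimately have "measure Q {\<omega> \<in> paths. path_upto n \<omega> = h}
      = (\<integral>\<omega>. indicator {\<omega> \<in> paths. path_upto n \<omega> \<in> {h}} \<omega> * Mword (path_upto n \<omega>) \<partial>SRW)"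
      using Q by (simp add: is_Qstar_def Mstar_eq_Mword)
    also have "\<dots> = (\<Sum>w\<in>walks n. of_bool (w = h) * Mword w) / 2 ^ n"
      by (subst SRW_expectation_indicator) (simp_all add: walk_mean_sum_walks)
    also have "\<dots> = q_weight h" using h by (simp add: walks_length of_bool_def if_distrib[of "\<lambda>x. x * _"] cong: if_cong)
    finally show "measure Q {\<omega> \<in> paths. path_upto n \<omega> = h} = q_weight h" .
  qed (simp add: Mword_start)
next
  assume "walk_law Q q_weight"
  then interpret Q: walk_law Q q_weight .
  show "is_Qstar \<phi> Q" unfolding is_Qstar_def
  proof (intro conjI allI ballI)
    fix n \<Lambda> assume "\<Lambda> \<in> sets (cF n)"
    then obtain L where L: "\<Lambda> = {\<omega> \<in> paths. path_upto n \<omega> \<in> L}" by (auto simp: sets_cF)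
    show "measure Q \<Lambda> = (\<integral>\<omega>. indicator \<Lambda> \<omega> * Mstar \<phi> n \<omega> \<partial>SRW)"
      unfolding L Mstar_eq_Mword Q.law_measure
      by (subst SRW_expectation_indicator)
        (auto simp add: walk_mean_sum_walks sum_divide_distrib walks_length simp del: sum_of_bool_mult_eq
          intro!: sum.cong)
  qed (use Q.sets_law Q.prob_space_axioms in auto)
qed

lemma walk_law_exists: "\<exists>Q. walk_law Q q_weight"
proof -
  let ?N = "uniform_measure lborel {0..1::real}"
  \<comment> \<open>The up-probability of Doob's transform by \<open>Mword\<close>. If
    \<open>Mword h = 0\<close>, division by 0 gives the threshold 0; this is harmless, as both
    extensions have weight 0 as well.\<close>
  define p where "p h = Mword (h @ [last h + 1]) / (2 * Mword h)" for h
  define st :: "int list \<Rightarrow> real \<Rightarrow> int" where "st h a = (if a \<le> p h then 1 else -1)" for h a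
  have N: "prob_space ?N" by (rule prob_space_uniform_measure) auto
  have p: "0 \<le> p h" "p h \<le> 1" if "h \<in> walks n" for h n
  proof -
    have "0 \<le> Mword (h @ [last h + 1])" "0 \<le> Mword (h @ [last h - 1])" by (simp_all add: Mword_nonneg)
    then show "0 \<le> p h" "p h \<le> 1" using Mword_step[OF that] Mword_nonneg[OF walks_nonempty[OF that]]
      unfolding p_def by (auto simp: divide_le_eq)
  qed
  have "walk_law (distr (PiM UNIV (\<lambda>_::nat. ?N)) cF_inf (driven_path st)) q_weight"
  proof (rule walk_law_driven[OF N])
    show "st h \<in> measurable ?N (count_space UNIV)" for h unfolding st_def by measurable
    show "q_weight [0] = 1" by (simp add: Mword_start)
    show "st h a = 1 \<or> st h a = -1" for h a by (simp add: st_def)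
    fix n h s assume h: "h \<in> walks n" and s: "s = (1::int) \<or> s = -1"
    have up: "{a \<in> space ?N. st h a = 1} = {..p h}" by (auto simp: st_def)
    have dn: "{a \<in> space ?N. st h a = - 1} = {p h<..}" by (auto simp: st_def)
    have "{0..1} \<inter> {..p h} = {0..p h}" "{0..1} \<inter> {p h<..} = {p h<..1}" using p[OF h] by auto
    then have P: "measure ?N {a \<in> space ?N. st h a = 1} = p h"
      "measure ?N {a \<in> space ?N. st h a = - 1} = 1 - p h"
      unfolding up dn using p[OF h] by simp_all
    have step: "Mword (h @ [last h + s]) = Mword h * (2 * measure ?N {a \<in> space ?N. st h a = s})"
    proof (cases "Mword h = 0")
      case True
      have "0 \<le> Mword (h @ [last h + 1])" "0 \<le> Mword (h @ [last h - 1])" by (simp_all add: Mword_nonneg)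
      then show ?thesis using True Mword_step[OF h] s by auto
    next
      case False
      have "Mword (h @ [last h + 1]) = Mword h * (2 * p h)" using False by (simp add: p_def)
      moreover from this have "Mword (h @ [last h - 1]) = Mword h * (2 * (1 - p h))"
        using Mword_step[OF h] by (simp add: algebra_simps)
      ultimately show ?thesis using s P by (elim disjE) (simp_all only: add_uminus_conv_diff)
    qed
    show "q_weight (h @ [last h + s]) = q_weight h * measure ?N {a \<in> space ?N. st h a = s}"
      unfolding step using walks_length[OF h] by simp
  qed
  then show ?thesis by blast
qed

lemma ex1_is_Qstar: "\<exists>!Q. is_Qstar \<phi> Q"
  unfolding is_Qstar_iff using walk_law_exists walk_law_unique by blast

end

section \<open>The last zero and the inverse of the zero count\<close>

lemma last_zero_eqI:
  assumes "\<omega> n = 0" "\<forall>k>n. \<omega> k \<noteq> 0"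
  shows "last_zero \<omega> = enat n"
  unfolding last_zero_def
proof (rule Sup_eqI)
  fix y assume "y \<in> {enat k |k. \<omega> k = 0}"
  then obtain k where "y = enat k" "\<omega> k = 0" by auto
  moreover from this have "\<not> k > n" using assms by blast
  ultimately show "y \<le> enat n" by simp
qed (use assms in blast)

lemma last_zero_cases:
  obtains n where "\<omega> n = 0" "\<forall>k>n. \<omega> k \<noteq> 0" "last_zero \<omega> = enat n"
  | "\<forall>n. \<omega> n \<noteq> 0" "last_zero \<omega> = 0"
  | "\<forall>n. \<exists>k>n. \<omega> k = 0" "last_zero \<omega> = \<infinity>"
proof (cases "\<forall>n. \<exists>k>n. \<omega> k = 0")
  case True
  have "last_zero \<omega> = \<infinity>"
  proof (rule ccontr)
    assume "last_zero \<omega> \<noteq> \<infinity>"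
    then obtain n where n: "last_zero \<omega> = enat n" by auto
    obtain k where "k > n" "\<omega> k = 0" using True by auto
    then have "enat k \<le> last_zero \<omega>" unfolding last_zero_def by (intro Sup_upper) auto
    then show False using \<open>k > n\<close> n by simp
  qed
  then show ?thesis using True that(3) by blast
next
  case False
  then obtain N where N: "\<And>k. k > N \<Longrightarrow> \<omega> k \<noteq> 0" by auto
  show ?thesis
  proof (cases "\<forall>n. \<omega> n \<noteq> 0")
    case True
    then have "last_zero \<omega> = 0" by (simp add: last_zero_def bot_enat_def)
    then show ?thesis using True that(2) by blast
  next
    case False
    then obtain m where "\<omega> m = 0" by auto
    have fin: "finite {k. \<omega> k = 0}" 
    proof (rule finite_subset)
      show "{k. \<omega> k = 0} \<subseteq> {..N}" using N by (auto simp: subset_eq) (meson not_le)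
    qed simp
    define n where "n = Max {k. \<omega> k = 0}"
    have "n \<in> {k. \<omega> k = 0}" unfolding n_def using fin \<open>\<omega> m = 0\<close> by (intro Max_in) auto
    moreover have "\<omega> k \<noteq> 0" if "k > n" for k
    proof
      assume "\<omega> k = 0"
      then have "k \<le> n" unfolding n_def by (intro Max_ge fin) simp
      then show False using that by simp
    qed
    ultimately show ?thesis using that(1)[of n] last_zero_eqI[of \<omega> n] by auto
  qed
qed

text \<open>Countable quantifiers and \<open>LEAST\<close> make measurability evident; the
  unspecified value at infinity is a constant. The formula for \<open>tau_time\<close> has the same
  purpose.\<close>

lemma g_time_eq:
  "g_time \<omega> = (if \<exists>n. \<omega> n = 0 \<and> (\<forall>k>n. \<omega> k \<noteq> 0) then LEAST n. \<omega> n = 0 \<and> (\<forall>k>n. \<omega> k \<noteq> 0)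
    else if \<forall>n. \<omega> n \<noteq> 0 then 0 else the_enat \<infinity>)"
proof (cases \<omega> rule: last_zero_cases)
  case (1 n)
  have "(LEAST n. \<omega> n = 0 \<and> (\<forall>k>n. \<omega> k \<noteq> 0)) = n"
  proof (rule Least_equality)
    show "n \<le> m" if "\<omega> m = 0 \<and> (\<forall>k>m. \<omega> k \<noteq> 0)" for m
      using 1(1) that by (meson not_le)
  qed (use 1 in auto)
  then show ?thesis using 1 by auto
next
  case 3
  then show ?thesis by auto
qed (auto simp: zero_enat_def)

lemma tau_time_eq:
  "tau_time a \<omega> = (if \<exists>n. num_zeros n \<omega> = a then LEAST n. num_zeros n \<omega> = a else the_enat \<infinity>)"
proof (cases "\<exists>n. num_zeros n \<omega> = a")
  case True
  then obtain n where "num_zeros n \<omega> = a" by auto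
  then have "num_zeros (LEAST n. num_zeros n \<omega> = a) \<omega> = a" by (rule LeastI)
  then have "tau a \<omega> = enat (LEAST n. num_zeros n \<omega> = a)" unfolding tau_def
    by (intro Inf_eqI) (auto intro: Least_le)
  then show ?thesis using True by simp
next
  case False
  then have "tau a \<omega> = \<infinity>" unfolding tau_def by (simp add: top_enat_def)
  then show ?thesis using False by simp
qed

lemma measurable_num_zeros [measurable]: "num_zeros n \<in> measurable cF_inf (count_space UNIV)"
proof -
  have "(\<lambda>\<omega>. count_list (path_upto n \<omega>) 0) \<in> measurable cF_inf (count_space UNIV)"
    by (rule measurable_compose[OF measurable_path_upto]) simp
  then show ?thesis by (simp add: num_zeros_eq_count[abs_def])
qed

lemma measurable_g_time [measurable]: "g_time \<in> measurable cF_inf (count_space UNIV)"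
  unfolding g_time_eq[abs_def] by measurable

lemma measurable_tau_time [measurable]: "tau_time a \<in> measurable cF_inf (count_space UNIV)"
  unfolding tau_time_eq[abs_def] by measurable

lemma measurable_path_upto_time:
  assumes "T \<in> measurable cF_inf (count_space UNIV)"
  shows "(\<lambda>\<omega>. path_upto (T \<omega>) \<omega>) \<in> measurable cF_inf (count_space UNIV)"
  by (rule measurable_compose_countable[OF measurable_path_upto assms])

lemma measurable_path_after_time:
  assumes "T \<in> measurable cF_inf (count_space UNIV)"
  shows "(\<lambda>\<omega>. path_after (T \<omega>) \<omega> n) \<in> measurable cF_inf (count_space UNIV)"
proof (rule measurable_compose_countable[OF _ assms, where f = "\<lambda>t \<omega>. path_after t \<omega> n"])
  show "(\<lambda>\<omega>. path_after t \<omega> n) \<in> measurable cF_inf (count_space UNIV)" for t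
    unfolding path_after_def by (rule measurable_coordinate)
qed

lemma path_upto_add: "path_upto (n + m) \<omega> = path_upto n \<omega> @ map (path_after n \<omega>) [0..<m]"
  by (induction m) (simp_all add: path_upto_Suc path_after_def)

lemma walks_snoc_iff: "h @ [y] \<in> walks (Suc n) \<longleftrightarrow> h \<in> walks n \<and> (y = last h + 1 \<or> y = last h - 1)"
  by auto

lemma walks_append_iff:
  assumes "v \<in> walks n" "last v = 0"
  shows "v @ u \<in> walks (n + length u) \<longleftrightarrow> 0 # u \<in> walks (length u)"
proof (induction u rule: rev_induct)
  case Nil
  then show ?case using assms by simp
next
  case (snoc y u)
  have "last (v @ u) = last (0 # u)" using assms(2) by (simp add: last_append)
  moreover have "v @ (u @ [y]) \<in> walks (n + length (u @ [y])) \<longleftrightarrow> (v @ u) @ [y] \<in> walks (Suc (n + length u))"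
    by simp
  moreover have "0 # (u @ [y]) \<in> walks (length (u @ [y])) \<longleftrightarrow> (0 # u) @ [y] \<in> walks (Suc (length u))"
    by simp
  ultimately show ?case using snoc by (simp only: walks_snoc_iff)
qed

lemma walks_appendD: "v @ u \<in> walks (n + length u) \<Longrightarrow> v \<in> walks n"
proof (induction u rule: rev_induct)
  case (snoc y u)
  then have "(v @ u) @ [y] \<in> walks (Suc (n + length u))" by simp
  then show ?case using snoc.IH by (simp only: walks_snoc_iff)
qed simp

lemma gmax_append: "v \<noteq> [] \<Longrightarrow> 0 \<notin> set u \<Longrightarrow> gmax (v @ u) = gmax v"
proof (induction u rule: rev_induct)
  case (snoc y u)
  then show ?case using gmax_snoc[of "v @ u" y] by simp
qed simp

text \<open>The law of the walk stopped at its a-th zero, split by the time n of that zero. In this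
  form it compares term by term with the law under Q up to the last zero.\<close>

definition tau_law :: "nat \<Rightarrow> int list set \<Rightarrow> real" where
  "tau_law a L = (\<Sum>n. walk_mean (\<lambda>h. of_bool (last h = 0 \<and> count_list h 0 = a \<and> h \<in> L)) n [0])"

lemma num_zeros_mono: "m \<le> n \<Longrightarrow> num_zeros m \<omega> \<le> num_zeros n \<omega>"
  unfolding num_zeros_def by (intro sum_mono2) auto

lemma num_zeros_less: "m < n \<Longrightarrow> \<omega> n = 0 \<Longrightarrow> num_zeros m \<omega> < num_zeros n \<omega>"
proof (cases n)
  case (Suc k)
  assume "m < n" "\<omega> n = 0"
  then have "num_zeros n \<omega> = Suc (num_zeros k \<omega>)" "m \<le> k" using Suc by (simp_all add: num_zeros_def)
  then show ?thesis using num_zeros_mono[of m k \<omega>] by simp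
qed simp

definition at_zero_number :: "nat \<Rightarrow> int list set \<Rightarrow> nat \<Rightarrow> (nat \<Rightarrow> int) set" where
  "at_zero_number a L n = {\<omega> \<in> paths. path_upto n \<omega> \<in> {h. last h = 0 \<and> count_list h 0 = a \<and> h \<in> L}}"

lemma at_zero_number_sets [measurable]: "at_zero_number a L n \<in> sets cF_inf"
  unfolding at_zero_number_def by (rule cF_inf_I)

lemma tau_time_at_zero_number:
  assumes "\<omega> \<in> at_zero_number a L n"
  shows "tau_time a \<omega> = n"
proof -
  have z: "\<omega> n = 0" "num_zeros n \<omega> = a" using assms by (auto simp: at_zero_number_def num_zeros_eq_count)
  have "(LEAST k. num_zeros k \<omega> = a) = n"
  proof (rule Least_equality)
    show "n \<le> m" if "num_zeros m \<omega> = a" for m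
      using z(2) that num_zeros_less[where m = m and n = n and \<omega> = \<omega>] z(1) by (metis less_irrefl not_le)
  qed (rule z)
  then show ?thesis using z unfolding tau_time_eq by auto
qed

lemma at_zero_number_disjoint: "disjoint_family (at_zero_number a L)"
  unfolding disjoint_family_on_def
proof (intro ballI impI)
  fix m n :: nat assume "m \<noteq> n"
  then show "at_zero_number a L m \<inter> at_zero_number a L n = {}"
    using tau_time_at_zero_number[of _ a L] by blast
qed

lemma at_zero_number_measure:
  "measure SRW (at_zero_number a L n) = walk_mean (\<lambda>h. of_bool (last h = 0 \<and> count_list h 0 = a \<and> h \<in> L)) n [0]"
proof -
  have "measure SRW (at_zero_number a L n) = (\<Sum>h\<in>walks n. srw_weight h *
      of_bool (h \<in> {h. last h = 0 \<and> count_list h 0 = a \<and> h \<in> L}))"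
    unfolding at_zero_number_def by (rule SRW.law_measure)
  also have "\<dots> = (\<Sum>h\<in>walks n. of_bool (last h = 0 \<and> count_list h 0 = a \<and> h \<in> L) / 2 ^ n)"
    by (intro sum.cong) (simp_all add: walks_length)
  finally show ?thesis by (simp only: walk_mean_sum_walks sum_divide_distrib)
qed

lemma tau_law_sums:
  "(\<lambda>n. walk_mean (\<lambda>h. of_bool (last h = 0 \<and> count_list h 0 = a \<and> h \<in> L)) n [0]) sums tau_law a L"
  "tau_law a L = measure SRW (\<Union>n. at_zero_number a L n)"
proof -
  have *: "(\<lambda>n. walk_mean (\<lambda>h. of_bool (last h = 0 \<and> count_list h 0 = a \<and> h \<in> L)) n [0])
      sums measure SRW (\<Union>n. at_zero_number a L n)"
    unfolding at_zero_number_measure[symmetric]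
    by (intro SRW.finite_measure_UNION at_zero_number_disjoint) (auto simp: SRW.sets_law)
  then show "tau_law a L = measure SRW (\<Union>n. at_zero_number a L n)"
    unfolding tau_law_def by (rule sums_unique[symmetric])
  then show "(\<lambda>n. walk_mean (\<lambda>h. of_bool (last h = 0 \<and> count_list h 0 = a \<and> h \<in> L)) n [0]) sums tau_law a L"
    using * by simp
qed

lemma tau_law_wmax_le: "1 \<le> a \<Longrightarrow> tau_law a {h. wmax h \<le> k} = (real k / (real k + 1)) ^ (a - 1)"
  using sums_unique[OF zeros_sums[of a k]] by (simp add: tau_law_def)

lemma tau_law_wmax_eq:
  assumes "1 \<le> a" "1 \<le> k"
  shows "tau_law a {h. wmax h = k} = (1 - 1 / (real k + 1)) ^ (a - 1) - (1 - 1 / real k) ^ (a - 1)"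
proof -
  obtain j where k: "k = Suc j" using assms(2) by (cases k) auto
  have "of_bool (last h = 0 \<and> count_list h 0 = a \<and> h \<in> {h. wmax h = k})
      = of_bool (last h = 0 \<and> count_list h 0 = a \<and> h \<in> {h. wmax h \<le> k})
        - (of_bool (last h = 0 \<and> count_list h 0 = a \<and> h \<in> {h. wmax h \<le> j}) :: real)" for h
    using k by auto
  then have "tau_law a {h. wmax h = k} = tau_law a {h. wmax h \<le> k} - tau_law a {h. wmax h \<le> j}"
    unfolding tau_law_def
    by (simp only: walk_mean_diff)
      (intro suminf_diff[symmetric] sums_summable[OF tau_law_sums(1)])
  moreover have "1 - 1 / (real k + 1) = real k / (real k + 1)" by (simp add: field_simps)
  moreover have "1 - 1 / real k = real j / (real j + 1)" using k by (simp add: field_simps)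
  ultimately show ?thesis using assms(1) by (simp only: tau_law_wmax_le)
qed

text \<open>Recurrence from the excursion formula: as k grows, the probability of a zeros within
  distance k tends to 1.\<close>

lemma tau_law_UNIV:
  assumes "1 \<le> a"
  shows "tau_law a UNIV = 1"
proof (rule antisym)
  show "tau_law a UNIV \<le> 1" unfolding tau_law_sums(2) by (rule SRW.prob_le_1)
  have "tau_law a {h. wmax h \<le> k} \<le> tau_law a UNIV" for k
    unfolding tau_law_sums(2)
    by (intro SRW.finite_measure_mono sets.countable_UN)
      (auto simp: SRW.sets_law, auto simp add: at_zero_number_def)
  then have "(real k / (real k + 1)) ^ (a - 1) \<le> tau_law a UNIV" for k
    using assms by (simp only: tau_law_wmax_le)
  moreover have "(\<lambda>k. (real k / (real k + 1)) ^ (a - 1)) \<longlonglongrightarrow> 1 ^ (a - 1)"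
    using LIMSEQ_n_over_Suc_n by (intro tendsto_power) (simp add: add.commute)
  ultimately show "1 \<le> tau_law a UNIV"
    by (intro LIMSEQ_le_const2) auto
qed

lemma measure_path_upto_tau:
  assumes "1 \<le> a"
  shows "measure SRW {\<omega> \<in> paths. path_upto (tau_time a \<omega>) \<omega> \<in> L} = tau_law a L"
proof -
  have "measure SRW (\<Union>n. at_zero_number a UNIV n) = 1"
    using tau_law_UNIV[OF assms] by (simp add: tau_law_sums(2))
  then have fin: "AE \<omega> in SRW. \<omega> \<in> (\<Union>n. at_zero_number a UNIV n)"
    by (intro SRW.AE_prob_1)
  show ?thesis unfolding tau_law_sums(2)
  proof (rule SRW.finite_measure_eq_AE)
    show "AE \<omega> in SRW. \<omega> \<in> {\<omega> \<in> paths. path_upto (tau_time a \<omega>) \<omega> \<in> L}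
        \<longleftrightarrow> \<omega> \<in> (\<Union>n. at_zero_number a L n)"
      using fin
    proof eventually_elim
      case (elim \<omega>)
      then obtain n where n: "\<omega> \<in> at_zero_number a UNIV n" by auto
      have t: "tau_time a \<omega> = n" by (rule tau_time_at_zero_number[OF n])
      show ?case
      proof
        assume "\<omega> \<in> {\<omega> \<in> paths. path_upto (tau_time a \<omega>) \<omega> \<in> L}"
        then have "\<omega> \<in> at_zero_number a L n" using n t by (simp add: at_zero_number_def)
        then show "\<omega> \<in> (\<Union>n. at_zero_number a L n)" by blast
      next
        assume "\<omega> \<in> (\<Union>n. at_zero_number a L n)"
        then obtain m where m: "\<omega> \<in> at_zero_number a L m" by auto
        then have "tau_time a \<omega> = m" by (rule tau_time_at_zero_number)
        then show "\<omega> \<in> {\<omega> \<in> paths. path_upto (tau_time a \<omega>) \<omega> \<in> L}"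
          using m by (simp add: at_zero_number_def)
      qed
    qed
    have "{\<omega> \<in> space cF_inf. path_upto (tau_time a \<omega>) \<omega> \<in> L} \<in> sets cF_inf" by measurable
    then show "{\<omega> \<in> paths. path_upto (tau_time a \<omega>) \<omega> \<in> L} \<in> sets SRW" by (simp add: SRW.sets_law)
  qed (auto simp: SRW.sets_law)
qed

section \<open>The path at its last zero\<close>

locale penalized_law = prob_penalty \<phi> + walk_law Q q_weight for \<phi> Q
begin

lemma law_walk_mean:
  "measure Q {\<omega> \<in> paths. path_upto n \<omega> \<in> L} = walk_mean (\<lambda>h. of_bool (h \<in> L) * Mword h) n [0]"
  unfolding law_measure walk_mean_sum_walks sum_divide_distrib
  by (rule sum.cong) (simp_all add: walks_length)

text \<open>Having no later zero is a decreasing limit of events with finite horizon, on which Q has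
  the density \<open>Mword\<close>.\<close>

lemma measure_escape:
  "measure Q {\<omega> \<in> paths. path_upto n \<omega> \<in> L \<and> (\<forall>k>n. \<omega> k \<noteq> 0)}
    = walk_mean (\<lambda>h. of_bool (h \<in> L) * escape n h) n [0]"
proof -
  define A where "A m = {\<omega> \<in> paths. path_upto (n + m) \<omega> \<in> {w. take (Suc n) w \<in> L \<and> no_zero_after n w}}" for m
  have A_eq: "A m = {\<omega> \<in> paths. path_upto n \<omega> \<in> L \<and> (\<forall>k. n < k \<and> k \<le> n + m \<longrightarrow> \<omega> k \<noteq> 0)}" for m
    by (auto simp: A_def take_path_upto no_zero_after_def nth_path_upto less_Suc_eq_le)
  have Int: "(\<Inter>m. A m) = {\<omega> \<in> paths. path_upto n \<omega> \<in> L \<and> (\<forall>k>n. \<omega> k \<noteq> 0)}"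
  proof
    show "(\<Inter>m. A m) \<subseteq> {\<omega> \<in> paths. path_upto n \<omega> \<in> L \<and> (\<forall>k>n. \<omega> k \<noteq> 0)}"
    proof
      fix \<omega> assume *: "\<omega> \<in> (\<Inter>m. A m)"
      have "\<omega> k \<noteq> 0" if "k > n" for k
      proof -
        have "\<omega> \<in> A (k - n)" using * by blast
        then show ?thesis using that by (simp add: A_eq)
      qed
      then show "\<omega> \<in> {\<omega> \<in> paths. path_upto n \<omega> \<in> L \<and> (\<forall>k>n. \<omega> k \<noteq> 0)}"
        using * by (auto simp: A_eq)
    qed
  qed (auto simp: A_eq)
  have "(\<lambda>m. measure Q (A m)) \<longlonglongrightarrow> measure Q (\<Inter>m. A m)"
  proof (rule finite_Lim_measure_decseq)
    show "range A \<subseteq> sets Q" unfolding A_def sets_law using cF_inf_I by blast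
    show "decseq A" by (auto simp: A_eq decseq_def)
  qed
  moreover have "measure Q (A m)
    = walk_mean (\<lambda>h. of_bool (h \<in> L) * walk_mean (\<lambda>w. of_bool (no_zero_after n w) * Mword w) m h) n [0]" for m
  proof -
    have "measure Q (A m) = walk_mean (walk_mean
        (\<lambda>w. of_bool (take (Suc n) w \<in> L) * (of_bool (no_zero_after n w) * Mword w)) m) n [0]"
      unfolding A_def law_walk_mean walk_mean_add[symmetric] by (simp add: of_bool_conj mult.assoc)
    also have "\<dots> = walk_mean (\<lambda>h. of_bool (h \<in> L) * walk_mean (\<lambda>w. of_bool (no_zero_after n w) * Mword w) m h) n [0]"
      by (rule walk_mean_cong[of "[0]" 0]) (simp_all add: walk_mean_take[of _ n "\<lambda>h. of_bool (h \<in> L)"])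
    finally show ?thesis .
  qed
  moreover have "(\<lambda>m. walk_mean (\<lambda>h. of_bool (h \<in> L) *
        walk_mean (\<lambda>w. of_bool (no_zero_after n w) * Mword w) m h) n [0])
      \<longlonglongrightarrow> walk_mean (\<lambda>h. of_bool (h \<in> L) * escape n h) n [0]"
    by (rule walk_mean_LIMSEQ[of "[0]" 0])
      (auto intro!: tendsto_mult tendsto_const walk_mean_no_zero_after_Mword)
  ultimately show ?thesis unfolding Int using LIMSEQ_unique by fastforce
qed

text \<open>Up to a factor 1/2 for the sign, the product of the transition probabilities
  \<open>\<bar>x'\<bar> / (2 \<bar>x\<bar>)\<close> of the 3-Bessel* walk along \<open>u\<close>, which telescopes.\<close>

definition excursion_weight :: "int list \<Rightarrow> real" where
  "excursion_weight u = of_bool (0 # u \<in> walks (length u) \<and> 0 \<notin> set u)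
     * (if u = [] then 1 else \<bar>real_of_int (last u)\<bar>) / 2 ^ length u"

text \<open>The past ranges over any set L, while the future is prescribed by one finite word u:
  such cylinders suffice to generate the future.\<close>

definition split_at_zero :: "int list set \<Rightarrow> int list \<Rightarrow> nat \<Rightarrow> (nat \<Rightarrow> int) set" where
  "split_at_zero L u n = {\<omega> \<in> paths. \<omega> n = 0 \<and> (\<forall>k>n. \<omega> k \<noteq> 0) \<and> path_upto n \<omega> \<in> L
     \<and> map (path_after n \<omega>) [0..<length u] = u}"

text \<open>The escape weight of v @ u is \<phi> (wmax v), given by the past, times the distance of
  \<open>last u\<close> from 0, given by the future (1 for empty u). If u is no zero-free walk from
  0, both sides are 0.\<close>

lemma measure_split_at_zero:
  "measure Q (split_at_zero L u n)
    = excursion_weight u * walk_mean (\<lambda>h. of_bool (h \<in> L) * zero_reward h) n [0]"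
proof (cases "0 # u \<in> walks (length u) \<and> 0 \<notin> set u")
  case False
  have "split_at_zero L u n = {}"
  proof (rule equals0I)
    fix \<omega> assume \<omega>: "\<omega> \<in> split_at_zero L u n"
    then have u: "map (path_after n \<omega>) [0..<length u] = u" by (simp add: split_at_zero_def)
    have "\<forall>k>n. \<omega> k \<noteq> 0" using \<omega> by (simp add: split_at_zero_def)
    then have "0 \<notin> set (map (path_after n \<omega>) [0..<length u])"
      by (auto simp: path_after_def)
    then have "0 \<notin> set u" unfolding u .
    moreover have "path_upto (length u) (\<lambda>k. \<omega> (n + k)) = 0 # map (path_after n \<omega>) [0..<length u]"
      using \<omega> path_upto_add[of 0 "length u" "\<lambda>k. \<omega> (n + k)"]
      by (simp add: split_at_zero_def path_after_def)
    then have "path_upto (length u) (\<lambda>k. \<omega> (n + k)) = 0 # u" unfolding u .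
    moreover have "path_upto (length u) (\<lambda>k. \<omega> (n + k)) \<in> walks (length u)"
      using \<omega> by (intro path_upto_in_walks) (auto simp: split_at_zero_def paths_def)
    ultimately show False using False by simp
  qed
  then show ?thesis using False by (auto simp: excursion_weight_def)
next
  case True
  let ?m = "length u"
  let ?L = "{v @ u | v. v \<in> L \<and> length v = Suc n \<and> last v = 0}"
  let ?e = "if u = [] then 1 else \<bar>real_of_int (last u)\<bar>"
  \<comment> \<open>As u contains no 0, zeros need only be excluded after the end of v @ u.\<close>
  have "split_at_zero L u n = {\<omega> \<in> paths. path_upto (n + ?m) \<omega> \<in> ?L \<and> (\<forall>k>n + ?m. \<omega> k \<noteq> 0)}"
  proof (intro set_eqI iffI)
    fix \<omega> assume "\<omega> \<in> split_at_zero L u n"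
    then have *: "\<omega> \<in> paths" "\<omega> n = 0" "\<forall>k>n. \<omega> k \<noteq> 0" "path_upto n \<omega> \<in> L"
      "map (path_after n \<omega>) [0..<?m] = u" by (simp_all add: split_at_zero_def)
    have "path_upto (n + ?m) \<omega> = path_upto n \<omega> @ u" unfolding path_upto_add *(5) ..
    then have "path_upto (n + ?m) \<omega> \<in> ?L" using * by auto
    then show "\<omega> \<in> {\<omega> \<in> paths. path_upto (n + ?m) \<omega> \<in> ?L \<and> (\<forall>k>n + ?m. \<omega> k \<noteq> 0)}"
      using * by simp
  next
    fix \<omega> assume "\<omega> \<in> {\<omega> \<in> paths. path_upto (n + ?m) \<omega> \<in> ?L \<and> (\<forall>k>n + ?m. \<omega> k \<noteq> 0)}"
    then obtain v where v: "path_upto n \<omega> @ map (path_after n \<omega>) [0..<?m] = v @ u" "v \<in> L"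
        "length v = Suc n" "last v = 0" and \<omega>: "\<omega> \<in> paths" "\<forall>k>n + ?m. \<omega> k \<noteq> 0"
      by (auto simp: path_upto_add)
    then have e: "path_upto n \<omega> = v" "map (path_after n \<omega>) [0..<?m] = u" by simp_all
    have "\<omega> k \<noteq> 0" if "k > n" for k
    proof (cases "k > n + ?m")
      case False
      then have "k - Suc n < ?m" using that by simp
      then have "\<omega> k = map (path_after n \<omega>) [0..<?m] ! (k - Suc n)"
        using that by (simp add: path_after_def)
      also have "\<dots> = u ! (k - Suc n)" unfolding e(2) ..
      also have "\<dots> \<in> set u" using False that by (intro nth_mem) simp
      finally show ?thesis using True by auto
    qed (use \<omega> in simp)
    moreover have "\<omega> n = 0" using e(1) v(4) by (metis last_path_upto)
    ultimately show "\<omega> \<in> split_at_zero L u n" using \<omega> e v by (simp add: split_at_zero_def)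
  qed
  then have "measure Q (split_at_zero L u n)
      = (\<Sum>w\<in>walks (n + ?m). of_bool (w \<in> ?L) * escape (n + ?m) w) / 2 ^ (n + ?m)"
    by (simp only: measure_escape walk_mean_sum_walks)
  also have "(\<Sum>w\<in>walks (n + ?m). of_bool (w \<in> ?L) * escape (n + ?m) w)
      = (\<Sum>w\<in>(\<lambda>v. v @ u) ` {v \<in> walks n. v \<in> L \<and> last v = 0}. escape (n + ?m) w)"
  proof (intro sum.mono_neutral_cong_right)
    show "(\<lambda>v. v @ u) ` {v \<in> walks n. v \<in> L \<and> last v = 0} \<subseteq> walks (n + ?m)"
      using True by (auto simp: walks_append_iff)
    show "\<forall>w\<in>walks (n + ?m) - (\<lambda>v. v @ u) ` {v \<in> walks n. v \<in> L \<and> last v = 0}.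
        of_bool (w \<in> ?L) * escape (n + ?m) w = 0"
      by (auto dest: walks_appendD)
    show "of_bool (w \<in> ?L) * escape (n + ?m) w = escape (n + ?m) w"
      if "w \<in> (\<lambda>v. v @ u) ` {v \<in> walks n. v \<in> L \<and> last v = 0}" for w
      using that by (auto dest: walks_length)
  qed simp
  also have "\<dots> = (\<Sum>v | v \<in> walks n \<and> v \<in> L \<and> last v = 0. escape (n + ?m) (v @ u))"
    by (subst sum.reindex) (auto simp: inj_on_def)
  also have "\<dots> = (\<Sum>v | v \<in> walks n \<and> v \<in> L \<and> last v = 0. ?e * \<phi> (wmax v))"
  proof (rule sum.cong)
    fix v assume "v \<in> {v. v \<in> walks n \<and> v \<in> L \<and> last v = 0}"
    then have v: "v \<in> walks n" "last v = 0" by auto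
    have ne: "v \<noteq> []" using walks_nonempty[OF v(1)] .
    have "v @ u \<in> walks (n + ?m)" using v True by (simp add: walks_append_iff)
    moreover have "gmax (v @ u) = wmax v" using True gmax_append[OF ne] gmax_eq_wmax[OF ne v(2)] by simp
    moreover have "last u \<noteq> 0" if "u \<noteq> []" using True last_in_set[OF that] by auto
    ultimately show "escape (n + ?m) (v @ u) = ?e * \<phi> (wmax v)"
      using v ne by (simp add: escape_def last_append)
  qed simp
  also have "\<dots> = (\<Sum>v\<in>walks n. ?e * (of_bool (v \<in> L) * zero_reward v))"
    by (rule sum.mono_neutral_cong_left) (auto simp: zero_reward_def)
  also have "\<dots> = ?e * (\<Sum>v\<in>walks n. of_bool (v \<in> L) * zero_reward v)"
    by (simp only: sum_distrib_left)
  finally show ?thesis using True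
    unfolding walk_mean_sum_walks by (simp add: excursion_weight_def power_add field_simps)
qed

lemma split_at_zero_last_zero: "\<omega> \<in> split_at_zero L u n \<Longrightarrow> last_zero \<omega> = enat n"
  by (rule last_zero_eqI) (auto simp: split_at_zero_def)

lemma split_at_zero_sets: "split_at_zero L u n \<in> sets Q"
proof -
  have "{\<omega> \<in> space cF_inf. \<forall>k\<in>{n<..}. \<omega> k \<noteq> 0} \<in> sets cF_inf" by measurable
  then have "{\<omega> \<in> paths. path_upto (n + length u) \<omega> \<in> {w. w ! n = 0 \<and> take (Suc n) w \<in> L \<and> drop (Suc n) w = u}}
      \<inter> {\<omega> \<in> space cF_inf. \<forall>k\<in>{n<..}. \<omega> k \<noteq> 0} \<in> sets cF_inf"
    by (intro sets.Int cF_inf_I)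
  also have "{\<omega> \<in> paths. path_upto (n + length u) \<omega> \<in> {w. w ! n = 0 \<and> take (Suc n) w \<in> L \<and> drop (Suc n) w = u}}
      \<inter> {\<omega> \<in> space cF_inf. \<forall>k\<in>{n<..}. \<omega> k \<noteq> 0} = split_at_zero L u n"
    by (auto simp: split_at_zero_def nth_path_upto path_upto_add nth_append)
  finally show ?thesis by (simp only: sets_law)
qed

lemma split_at_zero_sums:
  "(\<lambda>n. excursion_weight u * walk_mean (\<lambda>h. of_bool (h \<in> L) * zero_reward h) n [0])
    sums measure Q (\<Union>n. split_at_zero L u n)"
  unfolding measure_split_at_zero[symmetric]
proof (rule finite_measure_UNION)
  show "disjoint_family (split_at_zero L u)"
    unfolding disjoint_family_on_def
  proof (intro ballI impI)
    fix m n :: nat assume "m \<noteq> n"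
    show "split_at_zero L u m \<inter> split_at_zero L u n = {}"
    proof (rule equals0I)
      fix \<omega> assume "\<omega> \<in> split_at_zero L u m \<inter> split_at_zero L u n"
      then have "enat m = enat n" using split_at_zero_last_zero by (metis IntD1 IntD2)
      then show False using \<open>m \<noteq> n\<close> by simp
    qed
  qed
qed (use split_at_zero_sets in auto)

lemma excursion_weight_Nil: "excursion_weight [] = 1"
  by (simp add: excursion_weight_def)

text \<open>The masses of the possible last zeros are the expected rewards, with total
  \<open>residual [0] = 1\<close>; nothing is left for paths with infinitely many zeros.\<close>

lemma AE_split_at_zero: "AE \<omega> in Q. \<omega> \<in> (\<Union>n. split_at_zero UNIV [] n)"
proof -
  have "(\<lambda>n. walk_mean zero_reward n [0]) sums residual [0]" by (rule zero_reward_sums[of _ 0]) simp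
  moreover have "residual [0] = 1" using Mword_start by (simp add: Mword_def)
  moreover have "(\<lambda>n. walk_mean zero_reward n [0]) sums measure Q (\<Union>n. split_at_zero UNIV [] n)"
    using split_at_zero_sums[of "[]" UNIV] by (simp add: excursion_weight_Nil)
  ultimately have "measure Q (\<Union>n. split_at_zero UNIV [] n) = 1" using sums_unique2 by metis
  then show ?thesis by (intro AE_prob_1)
qed

lemma measurable_post_g:
  "(\<lambda>\<omega>. map (path_after (g_time \<omega>) \<omega>) [0..<m]) \<in> measurable cF_inf (count_space UNIV)"
proof (induction m)
  case (Suc m)
  have "(\<lambda>\<omega>. (\<lambda>h \<omega>. h @ [path_after (g_time \<omega>) \<omega> m]) (map (path_after (g_time \<omega>) \<omega>) [0..<m]) \<omega>)
      \<in> measurable cF_inf (count_space UNIV)"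
  proof (rule measurable_compose_countable[OF _ Suc, where f = "\<lambda>h \<omega>. h @ [path_after (g_time \<omega>) \<omega> m]"])
    show "(\<lambda>\<omega>. h @ [path_after (g_time \<omega>) \<omega> m]) \<in> measurable cF_inf (count_space UNIV)" for h
      by (rule measurable_compose[OF measurable_path_after_time[OF measurable_g_time] measurable_count_space])
  qed
  then show ?case by simp
qed simp

lemma pre_g_sets: "{\<omega> \<in> paths. path_upto (g_time \<omega>) \<omega> \<in> L} \<in> sets Q"
  using measurable_sets[OF measurable_path_upto_time[OF measurable_g_time], of L]
  by (simp add: sets_law vimage_def Int_def conj_commute)

lemma post_g_sets: "{\<omega> \<in> paths. map (path_after (g_time \<omega>) \<omega>) [0..<m] \<in> U} \<in> sets Q"
  using measurable_sets[OF measurable_post_g, of U m]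
  by (simp add: sets_law vimage_def Int_def conj_commute)

lemma split_sets:
  "{\<omega> \<in> paths. path_upto (g_time \<omega>) \<omega> \<in> L \<and> map (path_after (g_time \<omega>) \<omega>) [0..<length u] = u} \<in> sets Q"
proof -
  have "{\<omega> \<in> paths. path_upto (g_time \<omega>) \<omega> \<in> L \<and> map (path_after (g_time \<omega>) \<omega>) [0..<length u] = u}
    = {\<omega> \<in> paths. path_upto (g_time \<omega>) \<omega> \<in> L}
      \<inter> {\<omega> \<in> paths. map (path_after (g_time \<omega>) \<omega>) [0..<length u] \<in> {u}}" by auto
  then show ?thesis by (simp only: sets.Int pre_g_sets post_g_sets)
qed

lemma AE_mem_split_at_zero:
  "AE \<omega> in Q. \<omega> \<in> {\<omega> \<in> paths. path_upto (g_time \<omega>) \<omega> \<in> L \<and> map (path_after (g_time \<omega>) \<omega>) [0..<length u] = u}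
    \<longleftrightarrow> \<omega> \<in> (\<Union>n. split_at_zero L u n)"
  using AE_split_at_zero
proof eventually_elim
  case (elim \<omega>)
  then obtain n where n: "\<omega> \<in> split_at_zero UNIV [] n" by auto
  have g: "g_time \<omega> = n" using split_at_zero_last_zero[OF n] by simp
  show ?case
  proof
    assume "\<omega> \<in> {\<omega> \<in> paths. path_upto (g_time \<omega>) \<omega> \<in> L \<and> map (path_after (g_time \<omega>) \<omega>) [0..<length u] = u}"
    then have "\<omega> \<in> split_at_zero L u n" using n g by (simp add: split_at_zero_def)
    then show "\<omega> \<in> (\<Union>n. split_at_zero L u n)" by blast
  next
    assume "\<omega> \<in> (\<Union>n. split_at_zero L u n)"
    then obtain m where m: "\<omega> \<in> split_at_zero L u m" by auto
    then have "g_time \<omega> = m" using split_at_zero_last_zero[OF m] by simp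
    then show "\<omega> \<in> {\<omega> \<in> paths. path_upto (g_time \<omega>) \<omega> \<in> L \<and> map (path_after (g_time \<omega>) \<omega>) [0..<length u] = u}"
      using m by (simp add: split_at_zero_def)
  qed
qed

lemma measure_split:
  "measure Q {\<omega> \<in> paths. path_upto (g_time \<omega>) \<omega> \<in> L \<and> map (path_after (g_time \<omega>) \<omega>) [0..<length u] = u}
    = measure Q (\<Union>n. split_at_zero L u n)"
  using split_at_zero_sets by (intro finite_measure_eq_AE[OF AE_mem_split_at_zero] split_sets) auto

lemma pre_g_sums:
  "(\<lambda>n. walk_mean (\<lambda>h. of_bool (h \<in> L) * zero_reward h) n [0])
    sums measure Q {\<omega> \<in> paths. path_upto (g_time \<omega>) \<omega> \<in> L}"
  using split_at_zero_sums[of "[]" L] measure_split[of L "[]"] by (simp add: excursion_weight_Nil)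

lemma measure_pre_post:
  "measure Q {\<omega> \<in> paths. path_upto (g_time \<omega>) \<omega> \<in> L \<and> map (path_after (g_time \<omega>) \<omega>) [0..<length u] = u}
    = excursion_weight u * measure Q {\<omega> \<in> paths. path_upto (g_time \<omega>) \<omega> \<in> L}"
  unfolding measure_split
  using sums_unique2[OF split_at_zero_sums sums_mult[OF pre_g_sums]] .

end

text \<open>A word ending in 0 contains a zero. This rules out a = 0 as a conditioning
  value.\<close>

lemma tau_law_0: "tau_law 0 L = 0"
proof -
  have "walk_mean (\<lambda>h. of_bool (last h = 0 \<and> count_list h 0 = 0 \<and> h \<in> L)) n [0] = walk_mean (\<lambda>_. 0) n [0]" for n
  proof (rule walk_mean_cong[of "[0]" 0])
    fix w assume "w \<in> walks (0 + n)"
    then have "last w \<in> set w" using walks_nonempty by (intro last_in_set)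
    then show "of_bool (last w = 0 \<and> count_list w 0 = 0 \<and> w \<in> L) = 0"
      by (auto simp: count_list_0_iff)
  qed simp
  then show ?thesis by (simp add: tau_law_def)
qed

context penalized_law
begin

section \<open>Almost sure statements and the law of the path at its last zero\<close>

lemma AE_last_zero_finite: "AE \<omega> in Q. last_zero \<omega> < \<infinity>"
  using AE_split_at_zero by eventually_elim (auto dest: split_at_zero_last_zero)

lemma phi_le_1: "\<phi> k \<le> 1"
  using phi_le_tail[of k] antimonoD[OF antimono_tail, of 0 k] total by (simp add: tail_sum_def)

lemma Mword_le:
  assumes "w \<noteq> []" "wmax w \<le> K"
  shows "Mword w \<le> 2 * real K + 1"
proof -
  have "\<bar>real_of_int (last w)\<bar> \<le> real K" using abs_last_le_wmax[OF assms(1)] assms(2) by linarith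
  then have "\<phi> (gmax w) * \<bar>real_of_int (last w)\<bar> \<le> 1 * real K"
    by (intro mult_mono phi_le_1) auto
  moreover have "real (wmax w) * \<phi> (wmax w) \<le> real K * 1"
    using assms by (intro mult_mono phi_le_1 nonneg) auto
  moreover have "tail (wmax w) \<le> 1"
    using antimonoD[OF antimono_tail, of 0 "wmax w"] total by (simp add: tail_sum_def)
  ultimately show ?thesis using residual_bounds(2)[OF assms(1)] by (simp add: Mword_def)
qed

text \<open>While the path stays within distance K its density is at most 2 K + 1, so its mass under
  Q is dominated by that under the random walk, which tends to 0.\<close>

lemma AE_wmax_unbounded: "AE \<omega> in Q. \<forall>K. \<exists>n. K < wmax (path_upto n \<omega>)"
proof (subst AE_all_countable, intro allI)
  fix K
  let ?N = "\<Inter>n. {\<omega> \<in> paths. path_upto n \<omega> \<in> {w. wmax w \<le> K}}"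
  have N: "?N \<in> sets Q" unfolding sets_law by (intro sets.countable_INT image_subsetI cF_inf_I) simp
  have le: "measure Q ?N \<le> (2 * real K + 1) * walk_mean (\<lambda>w. of_bool (wmax w \<le> K)) n [0]" for n
  proof -
    have "measure Q ?N \<le> measure Q {\<omega> \<in> paths. path_upto n \<omega> \<in> {w. wmax w \<le> K}}"
      using cF_inf_I[of n "{w. wmax w \<le> K}"] by (intro finite_measure_mono) (auto simp: sets_law)
    also have "\<dots> \<le> walk_mean (\<lambda>w. (2 * real K + 1) * of_bool (wmax w \<le> K)) n [0]"
      unfolding law_walk_mean
      by (rule walk_mean_mono[of "[0]" 0]) (auto simp: Mword_le[OF walks_nonempty])
    finally show ?thesis by (simp only: walk_mean_mult)
  qed
  have lim: "(\<lambda>n. (2 * real K + 1) * walk_mean (\<lambda>w. of_bool (wmax w \<le> K)) n [0]) \<longlonglongrightarrow> (2 * real K + 1) * 0"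
    by (intro tendsto_mult tendsto_const walk_mean_wmax_le_tendsto_0[of _ 0]) simp
  have "measure Q ?N \<le> (2 * real K + 1) * 0"
    by (rule LIMSEQ_le_const[OF lim]) (use le in blast)
  then have "emeasure Q ?N = 0" by (simp add: emeasure_eq_measure measure_le_0_iff)
  then show "AE \<omega> in Q. \<exists>n. K < wmax (path_upto n \<omega>)"
    by (intro AE_I[OF _ _ N]) (auto simp: not_less)
qed

lemma AE_Smax_inf: "AE \<omega> in Q. Smax_inf \<omega> = \<infinity>"
  using AE_wmax_unbounded
proof eventually_elim
  case (elim \<omega>)
  show ?case
  proof (rule ccontr)
    assume "Smax_inf \<omega> \<noteq> \<infinity>"
    then obtain K where K: "Smax_inf \<omega> = enat K" by auto
    have "enat (nat \<bar>\<omega> k\<bar>) \<le> Smax_inf \<omega>" for k unfolding Smax_inf_def by (rule SUP_upper) simp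
    then have "nat \<bar>\<omega> k\<bar> \<le> K" for k by (simp add: K)
    then have "Smax n \<omega> \<le> K" for n unfolding Smax_def by (subst Max_le_iff) auto
    moreover obtain n where "K < wmax (path_upto n \<omega>)" using elim by blast
    ultimately show False by (metis Smax_eq_wmax not_le)
  qed
qed

text \<open>With the maximum fixed at k, the reward at a zero is the constant \<phi> k, and the law
  of the stopped walk is all that remains.\<close>

lemma measure_pre_g_tau_law:
  assumes "\<And>h. h \<in> L \<Longrightarrow> wmax h = k"
  shows "measure Q {\<omega> \<in> paths. path_upto (g_time \<omega>) \<omega> \<in> {h. count_list h 0 = a \<and> h \<in> L}} = \<phi> k * tau_law a L"
proof -
  have "(\<lambda>h. of_bool (h \<in> {h. count_list h 0 = a \<and> h \<in> L}) * zero_reward h)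
      = (\<lambda>h. \<phi> k * of_bool (last h = 0 \<and> count_list h 0 = a \<and> h \<in> L))"
    using assms by (auto simp: zero_reward_def)
  from sums_unique2[OF pre_g_sums[of "{h. count_list h 0 = a \<and> h \<in> L}", unfolded this walk_mean_mult]
      sums_mult[OF tau_law_sums(1)]]
  show ?thesis .
qed

lemma measure_gamma_S_tau_law:
  "measure Q {\<omega> \<in> paths. path_upto (g_time \<omega>) \<omega> \<in> A \<and> num_zeros (g_time \<omega>) \<omega> = a \<and> Smax (g_time \<omega>) \<omega> = k}
    = \<phi> k * tau_law a {h. wmax h = k \<and> h \<in> A}"
proof -
  have "{\<omega> \<in> paths. path_upto (g_time \<omega>) \<omega> \<in> A \<and> num_zeros (g_time \<omega>) \<omega> = a \<and> Smax (g_time \<omega>) \<omega> = k}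
    = {\<omega> \<in> paths. path_upto (g_time \<omega>) \<omega> \<in> {h. count_list h 0 = a \<and> h \<in> {h. wmax h = k \<and> h \<in> A}}}"
    by (auto simp: num_zeros_eq_count Smax_eq_wmax)
  then show ?thesis using measure_pre_g_tau_law[of "{h. wmax h = k \<and> h \<in> A}" k a] by simp
qed

lemma measure_gamma_S:
  assumes "1 \<le> a"
  shows "measure Q {\<omega> \<in> paths. num_zeros (g_time \<omega>) \<omega> = a \<and> Smax (g_time \<omega>) \<omega> = k} =
    (if k = 0 then (if a = 1 then \<phi> 0 else 0)
     else if a = 1 then 0
     else ((1 - 1 / (real k + 1)) ^ (a - 1) - (1 - 1 / real k) ^ (a - 1)) * \<phi> k)"
proof (cases "k = 0")
  \<comment> \<open>Here \<open>0 ^ (a - 1)\<close> separates a = 1 from a > 1. In the other case, a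
    = 1 makes both powers 1 and they cancel.\<close>
  case True
  then show ?thesis
    using measure_gamma_S_tau_law[of UNIV a k] tau_law_wmax_le[OF assms, of 0] assms by simp
next
  case False
  then show ?thesis
    using measure_gamma_S_tau_law[of UNIV a k] tau_law_wmax_eq[OF assms, of k] by simp
qed

text \<open>In place of a summation over a, the reward series is evaluated for the point mass at k:
  the expected number of zeros met while the maximum is k equals 1.\<close>

lemma measure_S: "measure Q {\<omega> \<in> paths. Smax (g_time \<omega>) \<omega> = k} = \<phi> k"
proof -
  interpret K: penalty "\<lambda>i. of_bool (i = k)"
    by unfold_locales (auto intro: summable_finite[of "{k}"])
  have "(\<lambda>i. of_bool (i = k) :: real) sums 1" using sums_single[of k "\<lambda>_. 1 :: real"] by (simp add: of_bool_def)
  then have "K.residual [0] = 1" by (simp add: K.residual_def tail_sum_def sums_unique[symmetric])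
  then have "(\<lambda>n. walk_mean K.zero_reward n [0]) sums 1" using K.zero_reward_sums[of "[0]" 0] by simp
  then have 1: "(\<lambda>n. \<phi> k * walk_mean K.zero_reward n [0]) sums (\<phi> k * 1)" by (rule sums_mult)
  have "(\<lambda>h. of_bool (h \<in> {h. wmax h = k}) * zero_reward h) = (\<lambda>h. \<phi> k * K.zero_reward h)"
    by (auto simp: zero_reward_def K.zero_reward_def)
  from sums_unique2[OF pre_g_sums[of "{h. wmax h = k}", unfolded this walk_mean_mult] 1]
  show ?thesis by (simp add: Smax_eq_wmax)
qed

lemma measure_post:
  "measure Q {\<omega> \<in> paths. map (path_after (g_time \<omega>) \<omega>) [0..<length u] = u} = excursion_weight u"
  using measure_pre_post[of UNIV u] prob_space by simp

text \<open>Two future cylinders are nested or disjoint, according as one word is a prefix of the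
  other or not. With the empty set added they form an intersection-stable generator, on which the
  factorization is already known.\<close>

lemma indep_pre_post:
  "indep_set
    (sets (vimage_algebra (space Q) (\<lambda>\<omega>. path_upto (g_time \<omega>) \<omega>) (count_space UNIV)))
    (sets (vimage_algebra (space Q) (\<lambda>\<omega>. path_after (g_time \<omega>) \<omega>) (PiM UNIV (\<lambda>_. count_space UNIV))))"
proof -
  define A where "A = sets (vimage_algebra (space Q) (\<lambda>\<omega>. path_upto (g_time \<omega>) \<omega>) (count_space UNIV))"
  define E where "E u = {\<omega> \<in> paths. map (path_after (g_time \<omega>) \<omega>) [0..<length u] = u}" for u
  define B where "B = insert {} (range E)"
  have A: "\<exists>L. a = {\<omega> \<in> paths. path_upto (g_time \<omega>) \<omega> \<in> L}" if "a \<in> A" for a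
    using that unfolding A_def by (subst (asm) sets_vimage_algebra2) (auto simp: vimage_def Int_def conj_commute)
  have E: "E u \<in> events" for u using post_g_sets[of "length u" "{u}"] by (simp add: E_def)
  have "indep_set A B"
  proof (rule indep_setI)
    show "A \<subseteq> events" using A pre_g_sets by fastforce
    show "B \<subseteq> events" using E by (auto simp: B_def)
    fix a b assume "a \<in> A" "b \<in> B"
    then obtain L where a: "a = {\<omega> \<in> paths. path_upto (g_time \<omega>) \<omega> \<in> L}" using A by blast
    show "prob (a \<inter> b) = prob a * prob b"
    proof (cases "b = {}")
      case False
      then obtain u where b: "b = E u" using \<open>b \<in> B\<close> by (auto simp: B_def)
      have "a \<inter> b = {\<omega> \<in> paths. path_upto (g_time \<omega>) \<omega> \<in> L \<and> map (path_after (g_time \<omega>) \<omega>) [0..<length u] = u}"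
        by (auto simp: a b E_def)
      then show ?thesis using measure_pre_post[of L u] measure_post[of u] by (simp add: a b E_def)
    qed simp
  qed
  moreover have "Int_stable A" unfolding A_def by (rule sets.Int_stable)
  moreover have "Int_stable B"
  proof (rule Int_stableI)
    have "E u \<inter> E v \<in> B" if "length u \<le> length v" for u v
    proof (cases "take (length u) v = u")
      case True
      have "E v \<subseteq> E u"
      proof
        fix \<omega> assume "\<omega> \<in> E v"
        then have "\<omega> \<in> paths" "take (length u) (map (path_after (g_time \<omega>) \<omega>) [0..<length v]) = take (length u) v"
          by (auto simp: E_def)
        then show "\<omega> \<in> E u" using that True by (simp add: E_def take_map)
      qed
      then show ?thesis by (auto simp: B_def Int_absorb1)
    next
      case False
      have "E u \<inter> E v = {}"
      proof (rule equals0I)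
        fix \<omega> assume "\<omega> \<in> E u \<inter> E v"
        then have u: "map (path_after (g_time \<omega>) \<omega>) [0..<length u] = u"
          and v: "map (path_after (g_time \<omega>) \<omega>) [0..<length v] = v" by (auto simp: E_def)
        have "take (length u) v = take (length u) (map (path_after (g_time \<omega>) \<omega>) [0..<length v])"
          unfolding v ..
        also have "\<dots> = u" using that u by (simp add: take_map)
        finally show False using False by simp
      qed
      then show ?thesis by (simp add: B_def)
    qed
    note * = this
    fix a b assume "a \<in> B" "b \<in> B"
    then consider "a = {} \<or> b = {}" | u v where "a = E u" "b = E v" by (auto simp: B_def)
    then show "a \<inter> b \<in> B"
    proof cases
      case (2 u v)
      then show ?thesis using *[of u v] *[of v u] by (cases "length u \<le> length v") (auto simp: Int_commute)
    qed (auto simp: B_def)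
  qed
  ultimately have ind: "indep_set (sigma_sets (space Q) A) (sigma_sets (space Q) B)"
    by (rule indep_set_sigma_sets)
  have Bp: "B \<subseteq> Pow (space Q)" by (auto simp: B_def E_def)
  let ?S = "sigma (space Q) B"
  have "(\<lambda>\<omega>. path_after (g_time \<omega>) \<omega> n) \<in> measurable ?S (count_space UNIV)" for n
  proof (rule measurableI)
    fix C :: "int set"
    have "(\<lambda>\<omega>. path_after (g_time \<omega>) \<omega> n) -` C \<inter> space ?S = (\<Union>u\<in>{u. length u = Suc n \<and> u ! n \<in> C}. E u)"
    proof (intro set_eqI iffI)
      fix \<omega> assume "\<omega> \<in> (\<lambda>\<omega>. path_after (g_time \<omega>) \<omega> n) -` C \<inter> space ?S"
      then have "\<omega> \<in> paths" "path_after (g_time \<omega>) \<omega> n \<in> C" using Bp by auto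
      then show "\<omega> \<in> (\<Union>u\<in>{u. length u = Suc n \<and> u ! n \<in> C}. E u)"
        by (intro UN_I[of "map (path_after (g_time \<omega>) \<omega>) [0..<Suc n]"]) (auto simp: E_def simp del: upt_Suc)
    next
      fix \<omega> assume "\<omega> \<in> (\<Union>u\<in>{u. length u = Suc n \<and> u ! n \<in> C}. E u)"
      then obtain u where u0: "length u = Suc n" "u ! n \<in> C" "\<omega> \<in> E u" by blast
      then have u: "length u = Suc n" "u ! n \<in> C" "\<omega> \<in> paths"
        "map (path_after (g_time \<omega>) \<omega>) [0..<length u] = u"
        unfolding E_def by blast+
      have "path_after (g_time \<omega>) \<omega> n = map (path_after (g_time \<omega>) \<omega>) [0..<length u] ! n"
        using u(1) by (simp del: upt_Suc)
      also have "\<dots> = u ! n" unfolding u(4) ..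
      finally show "\<omega> \<in> (\<lambda>\<omega>. path_after (g_time \<omega>) \<omega> n) -` C \<inter> space ?S" using u Bp by simp
    qed
    also have "\<dots> \<in> sets ?S"
      using Bp by (intro sets.countable_UN') (auto simp: B_def countableI_type)
    finally show "(\<lambda>\<omega>. path_after (g_time \<omega>) \<omega> n) -` C \<inter> space ?S \<in> sets ?S" .
  qed simp
  then have f: "(\<lambda>\<omega> n. path_after (g_time \<omega>) \<omega> n) \<in> measurable ?S (PiM UNIV (\<lambda>_. count_space UNIV))"
    by (rule measurable_abs_UNIV[of "\<lambda>n \<omega>. path_after (g_time \<omega>) \<omega> n" ?S "\<lambda>_. count_space UNIV"])
  define V where "V = sets (vimage_algebra (space Q) (\<lambda>\<omega>. path_after (g_time \<omega>) \<omega>) (PiM UNIV (\<lambda>_. count_space UNIV)))"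
  have V: "V = {(\<lambda>\<omega>. path_after (g_time \<omega>) \<omega>) -` C \<inter> space Q | C. C \<in> sets (PiM UNIV (\<lambda>_. count_space UNIV))}"
    unfolding V_def by (rule sets_vimage_algebra2) (simp add: space_PiM)
  have sub: "V \<subseteq> sigma_sets (space Q) B"
  proof
    fix b assume "b \<in> V"
    then obtain C where C: "C \<in> sets (PiM UNIV (\<lambda>_. count_space UNIV))"
      and b: "b = (\<lambda>\<omega>. path_after (g_time \<omega>) \<omega>) -` C \<inter> space Q" unfolding V by (elim CollectE exE conjE)
    show "b \<in> sigma_sets (space Q) B"
      using measurable_sets[OF f C] unfolding b space_measure_of[OF Bp] sets_measure_of[OF Bp] .
  qed
  have "indep_set A V"
  proof (rule indep_setI)
    show "A \<subseteq> events" using indep_setD_ev1[OF ind] by (rule order_trans[rotated]) (rule sigma_sets_superset_generator)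
    show "V \<subseteq> events" using sub indep_setD_ev2[OF ind] by (rule order_trans)
    show "prob (a \<inter> b) = prob a * prob b" if "a \<in> A" "b \<in> V" for a b
      by (rule indep_setD[OF ind sigma_sets.Basic[OF that(1)] subsetD[OF sub that(2)]])
  qed
  then show ?thesis unfolding A_def V_def .
qed

lemma first_step_after_g:
  assumes "s = 1 \<or> s = - 1"
  shows "measure Q {\<omega> \<in> paths. \<omega> (g_time \<omega> + 1) = s} = 1 / 2"
  using measure_post[of "[s]"] assms by (auto simp: path_after_def excursion_weight_def)

text \<open>The joint and the conditioning event carry the same factor \<phi> b, which
  cancels.\<close>

lemma cond_prob_pre_g:
  assumes "0 < \<P>(\<omega> in Q. num_zeros (g_time \<omega>) \<omega> = a \<and> Smax (g_time \<omega>) \<omega> = b)"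
  shows "cond_prob Q (\<lambda>\<omega>. path_upto (g_time \<omega>) \<omega> \<in> A)
      (\<lambda>\<omega>. num_zeros (g_time \<omega>) \<omega> = a \<and> Smax (g_time \<omega>) \<omega> = b) =
    cond_prob SRW (\<lambda>\<omega>. path_upto (tau_time a \<omega>) \<omega> \<in> A) (\<lambda>\<omega>. Smax (tau_time a \<omega>) \<omega> = b)"
proof -
  have all: "measure Q {\<omega> \<in> paths. num_zeros (g_time \<omega>) \<omega> = a \<and> Smax (g_time \<omega>) \<omega> = b}
      = \<phi> b * tau_law a {h. wmax h = b}"
    using measure_gamma_S_tau_law[of UNIV a b] by simp
  with assms have pos: "\<phi> b \<noteq> 0" "1 \<le> a" using tau_law_0 by (auto simp: Suc_le_eq intro!: gr0I)
  have tau: "measure SRW {\<omega> \<in> paths. path_upto (tau_time a \<omega>) \<omega> \<in> A \<and> Smax (tau_time a \<omega>) \<omega> = b}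
      = tau_law a {h. wmax h = b \<and> h \<in> A}" for A
    using measure_path_upto_tau[OF pos(2), of "{h. wmax h = b \<and> h \<in> A}"]
    by (simp add: Smax_eq_wmax conj_commute)
  show ?thesis
    using pos(1) all measure_gamma_S_tau_law[of A a b] tau[of A] tau[of UNIV]
    by (simp add: cond_prob_def)
qed

end

section \<open>The path after its last zero\<close>

text \<open>Unit steps cannot cross 0 without hitting it. The sign s treats both sides of 0 at
  once.\<close>

lemma excursion_positive:
  fixes h :: "nat \<Rightarrow> int"
  assumes s: "s = 1 \<or> s = - 1" and "h 0 = 1"
    and "0 # map (\<lambda>i. s * h i) [0..<Suc n] \<in> walks (Suc n)" "0 \<notin> set (map (\<lambda>i. s * h i) [0..<Suc n])"
  shows "1 \<le> h n"
  using assms(3,4)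
proof (induction n)
  case 0
  then show ?case using assms(2) by simp
next
  case (Suc n)
  have "(0 # map (\<lambda>i. s * h i) [0..<Suc n]) @ [s * h (Suc n)] \<in> walks (Suc (Suc n))"
    using Suc.prems(1) by simp
  then have w: "0 # map (\<lambda>i. s * h i) [0..<Suc n] \<in> walks (Suc n)"
    and step: "s * h (Suc n) = s * h n + 1 \<or> s * h (Suc n) = s * h n - 1"
    unfolding walks_snoc_iff by simp_all
  have "1 \<le> h n" using w Suc.prems(2) by (intro Suc.IH) auto
  moreover have "h (Suc n) \<noteq> 0" using Suc.prems(2) s by auto
  ultimately show ?case using s step by auto
qed

context penalized_law
begin

lemma excursion_weight_posD:
  "0 < excursion_weight u \<Longrightarrow> 0 # u \<in> walks (length u) \<and> 0 \<notin> set u"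
  by (rule ccontr) (auto simp: excursion_weight_def)

text \<open>A neighbouring letter multiplies the weight by y / (2 h n): the kernel is the transform
  of the walk killed at 0 by its harmonic function.\<close>

lemma excursion_weight_snoc:
  assumes s: "s = 1 \<or> s = - 1" and "h 0 = 1" "1 \<le> y"
    and pos: "0 < excursion_weight (map (\<lambda>i. s * h i) [0..<Suc n])"
  shows "excursion_weight (map (\<lambda>i. s * h i) [0..<Suc n] @ [s * y])
    = excursion_weight (map (\<lambda>i. s * h i) [0..<Suc n]) * bessel3_star (h n) y"
proof -
  let ?u = "map (\<lambda>i. s * h i) [0..<Suc n]"
  have w: "0 # ?u \<in> walks (Suc n)" "0 \<notin> set ?u"
    using excursion_weight_posD[OF pos] by (simp_all del: upt_Suc walks.simps)
  then have hn: "1 \<le> h n" by (intro excursion_positive[where h = h, OF s assms(2)])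
  have abs_s: "\<bar>real_of_int (s * z)\<bar> = real_of_int z" if "1 \<le> z" for z
    using s that by auto
  have lu: "last ?u = s * h n" "length ?u = Suc n" "?u \<noteq> []" by simp_all
  have eu: "excursion_weight ?u = real_of_int (h n) / 2 ^ Suc n"
    unfolding excursion_weight_def lu abs_s[OF hn] using w lu(3) by (simp del: upt_Suc walks.simps)
  have "(0 # ?u) @ [s * y] \<in> walks (Suc (Suc n)) \<longleftrightarrow> s * y = s * h n + 1 \<or> s * y = s * h n - 1"
    unfolding walks_snoc_iff using w(1) by simp
  also have "\<dots> \<longleftrightarrow> y = h n + 1 \<or> y = h n - 1" using s by auto
  finally have ey: "excursion_weight (?u @ [s * y]) = of_bool (y = h n + 1 \<or> y = h n - 1) * real_of_int y / 2 ^ Suc (Suc n)"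
    unfolding excursion_weight_def using w(2) lu(2) s assms(3) abs_s[OF assms(3)]
    by (auto simp del: upt_Suc walks.simps)
  show ?thesis
  proof (cases "y = h n - 1")
    case True
    then have hy: "h n = y + 1" by simp
    have b: "bessel3_star (y + 1) y = real_of_int y / (2 * (real_of_int y + 1))"
      by (simp add: bessel3_star_def)
    have cancel: "r / c * (z / (2 * r)) = z / (2 * c)" if "r \<noteq> 0" for r c z :: real
      using that by simp
    have "real_of_int y + 1 \<noteq> 0" using assms(3) by linarith
    from cancel[OF this, of "2 ^ Suc n" "real_of_int y"] show ?thesis
      unfolding ey eu hy b by simp
  next
    case False
    then show ?thesis unfolding ey eu using hn by (auto simp: bessel3_star_def field_simps)
  qed
qed

lemma path_after_positive:
  assumes \<omega>: "\<omega> \<in> paths" "\<forall>k>m. \<omega> k \<noteq> 0" and s: "s = 1 \<or> s = - 1" and start: "\<omega> (Suc m) = s"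
  shows "1 \<le> s * path_after m \<omega> n"
proof (induction n)
  case 0
  then show ?case using s start by (auto simp: path_after_def)
next
  case (Suc n)
  have "\<omega> (m + Suc (Suc n)) = \<omega> (m + Suc n) + 1 \<or> \<omega> (m + Suc (Suc n)) = \<omega> (m + Suc n) - 1"
    using path_step[OF \<omega>(1), of "m + Suc n"] by simp
  moreover have "\<omega> (m + Suc (Suc n)) \<noteq> 0" using \<omega>(2) by simp
  ultimately show ?case using Suc s by (auto simp: path_after_def)
qed

lemma bessel_after_g:
  assumes s: "s = 1 \<or> s = - 1"
  shows "bessel3_star_walk (uniform_measure Q {\<omega> \<in> space Q. \<omega> (g_time \<omega> + 1) = s}) 1
    (\<lambda>n \<omega>. s * path_after (g_time \<omega>) \<omega> n)"
proof -
  let ?B = "{\<omega> \<in> space Q. \<omega> (g_time \<omega> + 1) = s}"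
  let ?U = "uniform_measure Q ?B"
  let ?Y = "\<lambda>n \<omega>. s * path_after (g_time \<omega>) \<omega> n"
  have mB: "measure Q ?B = 1 / 2" using first_step_after_g[OF s] by simp
  \<comment> \<open>A set outside \<open>sets Q\<close> would have measure 0.\<close>
  have B: "?B \<in> sets Q" using mB measure_notin_sets by fastforce
  have eB: "emeasure Q ?B \<noteq> 0" "emeasure Q ?B \<noteq> \<infinity>" using mB by (simp_all add: emeasure_eq_measure)
  interpret U: prob_space ?U by (rule prob_space_uniform_measure[OF eB])
  have Y: "?Y n \<in> measurable Q (count_space UNIV)" for n
    using measurable_compose[OF measurable_path_after_time[OF measurable_g_time, of n], of "\<lambda>x. s * x" "count_space UNIV"]
    by (simp add: measurable_cong_sets[OF sets_law refl])
  \<comment> \<open>The factor 2 normalizes by the probability 1 / 2 of the first step s, and this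
    step forces h 0 = 1.\<close>
  have hist: "measure ?U {\<omega> \<in> space ?U. \<forall>i\<le>n. ?Y i \<omega> = h i}
      = 2 * of_bool (h 0 = 1) * excursion_weight (map (\<lambda>i. s * h i) [0..<Suc n])" for n h
  proof -
    let ?H = "{\<omega> \<in> paths. \<forall>i\<le>n. ?Y i \<omega> = h i}"
    let ?u = "map (\<lambda>i. s * h i) [0..<Suc n]"
    have *: "s * x = y \<longleftrightarrow> x = s * y" for x y using s by auto
    have H: "?H = {\<omega> \<in> paths. map (path_after (g_time \<omega>) \<omega>) [0..<length ?u] = ?u}"
      by (auto simp: list_eq_iff_nth_eq * less_Suc_eq_le simp del: upt_Suc)
    have "?H \<in> sets Q" unfolding H using post_g_sets[of "length ?u" "{?u}"] by simp
    then have "measure ?U ?H = measure Q (?B \<inter> ?H) / (1 / 2)"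
      by (subst measure_uniform_measure[OF eB]) (simp_all only: mB)
    also have "?B \<inter> ?H = (if h 0 = 1 then ?H else {})"
      using s by (auto simp: path_after_def)
    finally have U: "measure ?U ?H = measure Q (if h 0 = 1 then ?H else {}) / (1 / 2)" .
    have "measure Q ?H = excursion_weight ?u" unfolding H by (rule measure_post)
    moreover have "{\<omega> \<in> space ?U. \<forall>i\<le>n. ?Y i \<omega> = h i} = ?H" by simp
    ultimately show ?thesis using U by (cases "h 0 = 1") (simp_all only: if_True if_False, simp_all del: upt_Suc)
  qed
  have positive: "AE \<omega> in Q. \<omega> \<in> ?B \<longrightarrow> (\<forall>n. 1 \<le> ?Y n \<omega>) \<and> ?Y 0 \<omega> = 1"
    using AE_split_at_zero
  proof eventually_elim
    case (elim \<omega>)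
    then obtain m where m: "\<omega> \<in> split_at_zero UNIV [] m" by auto
    then have g: "g_time \<omega> = m" using split_at_zero_last_zero[OF m] by simp
    show ?case
    proof
      assume "\<omega> \<in> ?B"
      then have "\<omega> (Suc m) = s" "\<omega> \<in> paths" "\<forall>k>m. \<omega> k \<noteq> 0" using g m by (auto simp: split_at_zero_def)
      then show "(\<forall>n. 1 \<le> ?Y n \<omega>) \<and> ?Y 0 \<omega> = 1"
        unfolding g using s path_after_positive[of \<omega> m s] by (auto simp: path_after_def)
    qed
  qed
  show ?thesis unfolding bessel3_star_walk_def markov_chain_def
  proof (intro conjI allI ballI impI)
    show "prob_space ?U" by (rule U.prob_space_axioms)
    show "?Y n \<in> measurable ?U (count_space UNIV)" for n
      using Y by (simp add: measurable_cong_sets[OF sets_uniform_measure refl])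
    show "AE \<omega> in ?U. \<forall>n. ?Y n \<omega> \<in> {1..}"
      by (rule AE_uniform_measureI[OF B]) (use positive in \<open>eventually_elim, auto\<close>)
    show "AE \<omega> in ?U. ?Y 0 \<omega> = 1"
      by (rule AE_uniform_measureI[OF B]) (use positive in \<open>eventually_elim, auto\<close>)
    fix n and h :: "nat \<Rightarrow> int" and y :: int
    assume y: "y \<in> {1..}" and pos: "0 < measure ?U {\<omega> \<in> space ?U. \<forall>i\<le>n. ?Y i \<omega> = h i}"
    let ?u = "map (\<lambda>i. s * h i) [0..<Suc n]"
    have h0: "h 0 = 1" and eu: "0 < excursion_weight ?u"
      using pos unfolding hist by (cases "h 0 = 1"; simp del: upt_Suc)+
    \<comment> \<open>The history with the next letter is again a history, one step longer, so
      \<open>hist\<close> applies to it.\<close>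
    let ?h = "h(Suc n := y)"
    have "{\<omega> \<in> space ?U. ?Y (Suc n) \<omega> = y \<and> (\<forall>i\<le>n. ?Y i \<omega> = h i)}
        = {\<omega> \<in> space ?U. \<forall>i\<le>Suc n. ?Y i \<omega> = ?h i}"
      by (auto simp: le_Suc_eq)
    moreover have "map (\<lambda>i. s * ?h i) [0..<Suc (Suc n)] = ?u @ [s * y]" by simp
    ultimately have "measure ?U {\<omega> \<in> space ?U. ?Y (Suc n) \<omega> = y \<and> (\<forall>i\<le>n. ?Y i \<omega> = h i)}
        = 2 * excursion_weight (?u @ [s * y])"
      using hist[of "Suc n" ?h] h0 by (simp del: upt_Suc)
    also have "\<dots> = 2 * excursion_weight ?u * bessel3_star (h n) y"
      using excursion_weight_snoc[OF s h0 _ eu] y by simp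
    finally show "cond_prob ?U (\<lambda>\<omega>. ?Y (Suc n) \<omega> = y) (\<lambda>\<omega>. \<forall>i\<le>n. ?Y i \<omega> = h i) = bessel3_star (h n) y"
      unfolding cond_prob_def hist using eu h0 by (simp del: upt_Suc)
  qed
qed

end

section \<open>The penalization limit and the martingale\<close>

context prob_penalty
begin

lemma Mstar_nonneg: "0 \<le> Mstar \<phi> n \<omega>"
  unfolding Mstar_eq_Mword by (rule Mword_nonneg) simp

text \<open>After n steps the remaining horizon is m = p - n, so the numerator is measured by
  \<open>no_return m\<close>, the denominator by \<open>no_return (m + n)\<close>. Their ratio tends
  to 1.\<close>

lemma penalization_limit:
  assumes "\<Lambda> \<in> sets (cF n)"
  shows "(\<lambda>p. (\<integral>\<omega>. indicator \<Lambda> \<omega> * \<phi> (Smax (last_zero_upto p \<omega>) \<omega>) \<partial>SRW) /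
      (\<integral>\<omega>. \<phi> (Smax (last_zero_upto p \<omega>) \<omega>) \<partial>SRW))
    \<longlonglongrightarrow> (\<integral>\<omega>. indicator \<Lambda> \<omega> * Mstar \<phi> n \<omega> \<partial>SRW)"
proof -
  obtain L where L: "\<Lambda> = {\<omega> \<in> paths. path_upto n \<omega> \<in> L}" using assms by (auto simp: sets_cF)
  let ?G = "\<lambda>w. \<phi> (gmax w)"
  let ?num = "\<lambda>p. (\<integral>\<omega>. indicator \<Lambda> \<omega> * \<phi> (Smax (last_zero_upto p \<omega>) \<omega>) \<partial>SRW)"
  let ?den = "\<lambda>p. (\<integral>\<omega>. \<phi> (Smax (last_zero_upto p \<omega>) \<omega>) \<partial>SRW)"
  have num: "?num (m + n) = walk_mean (\<lambda>h. of_bool (h \<in> L) * walk_mean ?G m h) n [0]" for m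
    unfolding L Smax_last_zero_upto using SRW_expectation_indicator[of n "m + n" L ?G] by simp
  have den: "?den p = walk_mean ?G p [0]" for p
    unfolding Smax_last_zero_upto by (rule SRW_expectation)
  have "(\<lambda>m. walk_mean (\<lambda>h. of_bool (h \<in> L) * (walk_mean ?G m h / no_return m)) n [0])
      \<longlonglongrightarrow> walk_mean (\<lambda>h. of_bool (h \<in> L) * Mword h) n [0]"
    by (rule walk_mean_LIMSEQ[of "[0]" 0]) (auto intro!: tendsto_mult tendsto_const walk_mean_gmax_asymp)
  moreover have "walk_mean (\<lambda>h. of_bool (h \<in> L) * (walk_mean ?G m h / no_return m)) n [0]
      = ?num (m + n) / no_return m" for m
    using walk_mean_mult[of "inverse (no_return m)" "\<lambda>h. of_bool (h \<in> L) * walk_mean ?G m h" n "[0]"]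
    by (simp add: num field_simps del: no_return_simps)
  ultimately have N: "(\<lambda>m. ?num (m + n) / no_return m) \<longlonglongrightarrow> walk_mean (\<lambda>h. of_bool (h \<in> L) * Mword h) n [0]"
    by (simp only:)
  have "(\<lambda>p. ?den p / no_return p) \<longlonglongrightarrow> 1"
    unfolding den using walk_mean_gmax_asymp[of "[0]" 0] by (simp add: Mword_start)
  from LIMSEQ_ignore_initial_segment[OF this, of n]
  have "(\<lambda>m. (?num (m + n) / no_return m) * (no_return m / no_return (m + n)) / (?den (m + n) / no_return (m + n)))
      \<longlonglongrightarrow> walk_mean (\<lambda>h. of_bool (h \<in> L) * Mword h) n [0] * 1 / 1"
    by (intro tendsto_divide tendsto_mult N no_return_ratio) simp_all
  moreover have "(?num (m + n) / no_return m) * (no_return m / no_return (m + n)) / (?den (m + n) / no_return (m + n))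
      = ?num (m + n) / ?den (m + n)" for m
    using no_return_pos[of m] no_return_pos[of "m + n"] by (simp del: no_return_simps)
  ultimately have "(\<lambda>m. ?num (m + n) / ?den (m + n)) \<longlonglongrightarrow> walk_mean (\<lambda>h. of_bool (h \<in> L) * Mword h) n [0]"
    by (simp only: mult_1_right div_by_1)
  then have "(\<lambda>p. ?num p / ?den p) \<longlonglongrightarrow> walk_mean (\<lambda>h. of_bool (h \<in> L) * Mword h) n [0]"
    by (rule LIMSEQ_offset)
  moreover have "(\<integral>\<omega>. indicator \<Lambda> \<omega> * Mstar \<phi> n \<omega> \<partial>SRW) = walk_mean (\<lambda>h. of_bool (h \<in> L) * Mword h) n [0]"
    unfolding L Mstar_eq_Mword using SRW_expectation_indicator[of n n L Mword] by simp
  ultimately show ?thesis by simp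
qed

lemma measurable_Mstar: "Mstar \<phi> n \<in> borel_measurable (cF n)"
proof -
  have "(\<lambda>\<omega>. Mword (path_upto n \<omega>)) \<in> borel_measurable (cF n)"
    by (rule measurable_compose[OF measurable_path_upto_cF]) simp
  then show ?thesis by (simp add: Mstar_eq_Mword[abs_def])
qed

lemma integrable_Mstar: "integrable SRW (Mstar \<phi> n)"
  unfolding Mstar_eq_Mword[abs_def] by (rule SRW.law_sum(1))

lemma martingale_Mstar: "martingale SRW cF (Mstar \<phi>)"
  unfolding martingale_def
proof (intro conjI allI impI)
  show "prob_space SRW" by (rule SRW.prob_space_axioms)
  show "filtration (space SRW) cF" by (simp add: filtration_def sets_cF_mono)
  show sub: "subalgebra SRW (cF n)" for n
    using cF_subset_cF_inf by (simp add: subalgebra_def SRW.sets_law)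
  fix m n :: nat assume mn: "m \<le> n"
  have fin: "finite_measure_subalgebra SRW (cF m)"
    by unfold_locales (rule sub)
  show "AE \<omega> in SRW. real_cond_exp SRW (cF m) (Mstar \<phi> n) \<omega> = Mstar \<phi> m \<omega>"
  proof (rule sigma_finite_subalgebra.real_cond_exp_charact)
    show "sigma_finite_subalgebra SRW (cF m)"
      using fin by (simp add: finite_measure_subalgebra.axioms finite_measure_subalgebra_is_sigma_finite)
    fix A assume "A \<in> sets (cF m)"
    then obtain L where L: "A = {\<omega> \<in> paths. path_upto m \<omega> \<in> L}" by (auto simp: sets_cF)
    have "(\<integral>\<omega>\<in>A. Mstar \<phi> k \<omega> \<partial>SRW) = walk_mean (\<lambda>h. of_bool (h \<in> L) * Mword h) m [0]" if "m \<le> k" for k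
    proof -
      have "(\<integral>\<omega>\<in>A. Mstar \<phi> k \<omega> \<partial>SRW) = walk_mean (\<lambda>h. of_bool (h \<in> L) * walk_mean Mword (k - m) h) m [0]"
        unfolding set_lebesgue_integral_def L Mstar_eq_Mword using SRW_expectation_indicator[OF that, of L Mword] by simp
      also have "\<dots> = walk_mean (\<lambda>h. of_bool (h \<in> L) * Mword h) m [0]"
        by (rule walk_mean_cong[of "[0]" 0]) (simp_all add: walk_mean_Mword)
      finally show ?thesis .
    qed
    then show "(\<integral>\<omega>\<in>A. Mstar \<phi> n \<omega> \<partial>SRW) = (\<integral>\<omega>\<in>A. Mstar \<phi> m \<omega> \<partial>SRW)" using mn by simp
  qed (use integrable_Mstar measurable_Mstar in auto)
qed (use integrable_Mstar measurable_Mstar in auto)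

text \<open>The events that a zero at time \<open>n\<close> is not followed by another one before time \<open>n + m\<close>
  become negligible as \<open>m\<close> grows, while the martingale retains a fixed mass on them.\<close>

lemma not_uniformly_integrable_Mstar: "\<not> uniformly_integrable SRW (Mstar \<phi>)"
proof
  assume UI: "uniformly_integrable SRW (Mstar \<phi>)"
  have "(\<lambda>n. walk_mean zero_reward n [0]) sums residual [0]" by (rule zero_reward_sums[of _ 0]) simp
  moreover have "residual [0] = 1" using Mword_start by (simp add: Mword_def)
  ultimately have sums_1: "(\<lambda>n. walk_mean zero_reward n [0]) sums 1" by simp
  \<comment> \<open>The rewards add up to 1, so one is nonzero. The choice n = 0 may fail, since its
    reward is \<phi> 0.\<close>
  obtain n where "walk_mean zero_reward n [0] \<noteq> 0"
  proof (rule ccontr)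
    assume "\<not> thesis"
    then have "walk_mean zero_reward n [0] = 0" for n using that by blast
    with sums_1 have "(\<lambda>_. 0 :: real) sums 1" by simp
    then show False using sums_unique2[OF _ sums_zero] by fastforce
  qed
  moreover have "0 \<le> walk_mean zero_reward n [0]"
    by (rule walk_mean_nonneg[of "[0]" 0]) (simp_all add: zero_reward_nonneg)
  ultimately obtain e where e: "walk_mean zero_reward n [0] = e" "0 < e" by simp
  define B where "B m = {\<omega> \<in> paths. path_upto (n + m) \<omega> \<in> {w. last (take (Suc n) w) = 0 \<and> no_zero_after n w}}" for m
  have B_sets: "B m \<in> sets SRW" for m unfolding B_def SRW.sets_law by (rule cF_inf_I)
  have split: "(\<integral>\<omega>. indicator (B m) \<omega> * G (path_upto (n + m) \<omega>) \<partial>SRW)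
      = walk_mean (\<lambda>h. of_bool (last h = 0) * walk_mean (\<lambda>w. of_bool (no_zero_after n w) * G w) m h) n [0]"
    for m and G :: "int list \<Rightarrow> real"
  proof -
    have "(\<integral>\<omega>. indicator (B m) \<omega> * G (path_upto (n + m) \<omega>) \<partial>SRW)
      = walk_mean (walk_mean (\<lambda>w. of_bool (last (take (Suc n) w) = 0) * (of_bool (no_zero_after n w) * G w)) m) n [0]"
      unfolding B_def walk_mean_add[symmetric]
      by (subst SRW_expectation_indicator) (simp_all add: of_bool_conj mult.assoc)
    also have "\<dots> = walk_mean (\<lambda>h. of_bool (last h = 0) * walk_mean (\<lambda>w. of_bool (no_zero_after n w) * G w) m h) n [0]"
      by (rule walk_mean_cong[of "[0]" 0]) (simp_all add: walk_mean_take[of _ n "\<lambda>h. of_bool (last h = 0)"])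
    finally show ?thesis .
  qed
  have "(\<lambda>m. (\<integral>\<omega>. indicator (B m) \<omega> * Mstar \<phi> (n + m) \<omega> \<partial>SRW))
      \<longlonglongrightarrow> walk_mean (\<lambda>h. of_bool (last h = 0) * escape n h) n [0]"
    unfolding Mstar_eq_Mword split
    by (rule walk_mean_LIMSEQ[of "[0]" 0]) (auto intro!: tendsto_mult tendsto_const walk_mean_no_zero_after_Mword)
  moreover have "walk_mean (\<lambda>h. of_bool (last h = 0) * escape n h) n [0] = walk_mean zero_reward n [0]"
    by (rule walk_mean_cong[of "[0]" 0])
      (auto simp: escape_def zero_reward_def gmax_eq_wmax walks_nonempty)
  ultimately have lim_M: "(\<lambda>m. (\<integral>\<omega>. indicator (B m) \<omega> * Mstar \<phi> (n + m) \<omega> \<partial>SRW)) \<longlonglongrightarrow> e" by (simp add: e)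
  have "(\<lambda>m. walk_mean (\<lambda>h. of_bool (last h = 0) * walk_mean (\<lambda>w. of_bool (no_zero_after n w)) m h) n [0])
      \<longlonglongrightarrow> walk_mean (\<lambda>_. 0) n [0]"
  proof (rule walk_mean_LIMSEQ[of "[0]" 0])
    fix w assume "w \<in> walks (0 + n)"
    then show "(\<lambda>m. of_bool (last w = 0) * walk_mean (\<lambda>w. of_bool (no_zero_after n w)) m w) \<longlonglongrightarrow> 0"
      using walk_mean_no_zero_after_tendsto_0[of w n] by (cases "last w = 0") auto
  qed simp
  moreover have "measure SRW (B m)
      = walk_mean (\<lambda>h. of_bool (last h = 0) * walk_mean (\<lambda>w. of_bool (no_zero_after n w)) m h) n [0]" for m
    using split[of m "\<lambda>_. 1"] B_sets[of m] sets.sets_into_space[OF B_sets[of m]] by (simp add: Int_absorb2)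
  ultimately have lim_B: "(\<lambda>m. measure SRW (B m)) \<longlonglongrightarrow> 0" by simp
  let ?T = "\<lambda>c::real. SUP k. \<integral>\<^sup>+\<omega>. ennreal \<bar>Mstar \<phi> k \<omega>\<bar> * indicator {\<omega>. \<bar>Mstar \<phi> k \<omega>\<bar> > c} \<omega> \<partial>SRW"
  have "(?T \<longlongrightarrow> 0) at_top" using UI by (simp add: uniformly_integrable_def)
  moreover have "(0::ennreal) < ennreal (e / 2)" using e by simp
  ultimately have "\<forall>\<^sub>F c in at_top. ?T c < ennreal (e / 2)" by (rule order_tendstoD(2))
  then have "\<forall>\<^sub>F c in at_top. ?T c < ennreal (e / 2) \<and> 0 \<le> c"
    by (intro eventually_conj eventually_ge_at_top)
  then obtain c where c: "?T c < ennreal (e / 2)" "0 \<le> c"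
    by (auto dest: eventually_happens)
  \<comment> \<open>The martingale is cut at c: below, B m contributes at most c times its
    probability; above, uniform integrability leaves e / 2. In the limit this contradicts the
    retained mass e.\<close>
  have "(\<integral>\<omega>. indicator (B m) \<omega> * Mstar \<phi> (n + m) \<omega> \<partial>SRW) \<le> c * measure SRW (B m) + e / 2" for m
  proof -
    let ?M = "Mstar \<phi> (n + m)"
    let ?I = "\<lambda>\<omega>. ?M \<omega> * indicator {\<omega>. ?M \<omega> > c} \<omega>"
    have M_meas[measurable]: "?M \<in> borel_measurable SRW" using integrable_Mstar by simp
    have I: "integrable SRW ?I"
      by (rule Bochner_Integration.integrable_bound[OF integrable_Mstar[of "n + m"]])
        (auto simp: indicator_def)
    have "ennreal (\<integral>\<omega>. ?I \<omega> \<partial>SRW) = (\<integral>\<^sup>+\<omega>. ennreal (?I \<omega>) \<partial>SRW)"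
      using I Mstar_nonneg by (intro nn_integral_eq_integral[symmetric]) auto
    also have "\<dots> = (\<integral>\<^sup>+\<omega>. ennreal \<bar>?M \<omega>\<bar> * indicator {\<omega>. \<bar>?M \<omega>\<bar> > c} \<omega> \<partial>SRW)"
      using Mstar_nonneg by (intro nn_integral_cong) (auto simp: indicator_def)
    also have "\<dots> \<le> ?T c" by (rule SUP_upper) simp
    also have "\<dots> < ennreal (e / 2)" by (rule c(1))
    finally have I_le: "(\<integral>\<omega>. ?I \<omega> \<partial>SRW) \<le> e / 2"
      using e(2) by (simp add: ennreal_less_iff Mstar_nonneg)
    have "(\<integral>\<omega>. indicator (B m) \<omega> * ?M \<omega> \<partial>SRW) \<le> (\<integral>\<omega>. c * indicator (B m) \<omega> + ?I \<omega> \<partial>SRW)"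
    proof (rule integral_mono)
      show "integrable SRW (\<lambda>\<omega>. indicator (B m) \<omega> * ?M \<omega>)"
        using integrable_mult_indicator[OF B_sets[of m] integrable_Mstar[of "n + m"]] by simp
      show "integrable SRW (\<lambda>\<omega>. c * indicator (B m) \<omega> + ?I \<omega>)"
        using I B_sets by (intro Bochner_Integration.integrable_add integrable_mult_right integrable_real_indicator)
          (auto simp: SRW.emeasure_eq_measure)
      show "indicator (B m) \<omega> * ?M \<omega> \<le> c * indicator (B m) \<omega> + ?I \<omega>" for \<omega>
        using Mstar_nonneg c(2) by (auto simp: indicator_def)
    qed
    also have "\<dots> = (\<integral>\<omega>. c * indicator (B m) \<omega> \<partial>SRW) + (\<integral>\<omega>. ?I \<omega> \<partial>SRW)"
      using I B_sets by (intro Bochner_Integration.integral_add integrable_mult_right integrable_real_indicator)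
        (auto simp: SRW.emeasure_eq_measure)
    also have "(\<integral>\<omega>. c * indicator (B m) \<omega> \<partial>SRW) = c * measure SRW (B m)"
      using B_sets[of m] sets.sets_into_space[OF B_sets[of m]] by (simp add: Int_absorb2)
    finally show ?thesis using I_le by simp
  qed
  moreover have "(\<lambda>m. c * measure SRW (B m) + e / 2) \<longlonglongrightarrow> c * 0 + e / 2"
    by (intro tendsto_add tendsto_mult tendsto_const lim_B)
  ultimately have "e \<le> c * 0 + e / 2" using lim_M by (intro LIMSEQ_le[OF lim_M]) auto
  then show False using e(2) by simp
qed

end

theorem theorem1p4:
  fixes \<phi> :: "nat \<Rightarrow> real"
  assumes nonneg: "\<And>k. 0 \<le> \<phi> k"
    and total: "\<phi> sums 1"
    and second_moment: "summable (\<lambda>k. (real k)\<^sup>2 * \<phi> k)"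
  shows
    "(\<forall>n. \<forall>\<Lambda>\<in>sets (cF n).
        (\<lambda>p. (\<integral>\<omega>. indicator \<Lambda> \<omega> * \<phi> (Smax (last_zero_upto p \<omega>) \<omega>) \<partial>SRW) /
             (\<integral>\<omega>. \<phi> (Smax (last_zero_upto p \<omega>) \<omega>) \<partial>SRW))
        \<longlonglongrightarrow> (\<integral>\<omega>. indicator \<Lambda> \<omega> * Mstar \<phi> n \<omega> \<partial>SRW)) \<and>
     (\<forall>n. \<forall>\<omega>\<in>paths. 0 \<le> Mstar \<phi> n \<omega>) \<and>
     martingale SRW cF (Mstar \<phi>) \<and>
     \<not> uniformly_integrable SRW (Mstar \<phi>) \<and>
     (\<exists>!Q. is_Qstar \<phi> Q) \<and>
     (\<forall>Q. is_Qstar \<phi> Q \<longrightarrow>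
        (AE \<omega> in Q. last_zero \<omega> < \<infinity> \<and> Smax_inf \<omega> = \<infinity>) \<and>
        (\<forall>a k. a \<ge> 1 \<longrightarrow>
           \<P>(\<omega> in Q. num_zeros (g_time \<omega>) \<omega> = a \<and> Smax (g_time \<omega>) \<omega> = k) =
             (if k = 0 then (if a = 1 then \<phi> 0 else 0)
              else if a = 1 then 0
              else ((1 - 1 / (real k + 1)) ^ (a - 1) - (1 - 1 / real k) ^ (a - 1)) * \<phi> k)) \<and>
        (\<forall>k. \<P>(\<omega> in Q. Smax (g_time \<omega>) \<omega> = k) = \<phi> k) \<and>
        prob_space.indep_set Q
          (sets (vimage_algebra (space Q) (\<lambda>\<omega>. path_upto (g_time \<omega>) \<omega>) (count_space UNIV)))
          (sets (vimage_algebra (space Q) (\<lambda>\<omega>. path_after (g_time \<omega>) \<omega>)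
             (PiM UNIV (\<lambda>_. count_space UNIV)))) \<and>
        \<P>(\<omega> in Q. \<omega> (g_time \<omega> + 1) = 1) = 1 / 2 \<and>
        \<P>(\<omega> in Q. \<omega> (g_time \<omega> + 1) = - 1) = 1 / 2 \<and>
        bessel3_star_walk (uniform_measure Q {\<omega> \<in> space Q. \<omega> (g_time \<omega> + 1) = 1}) 1
          (\<lambda>n \<omega>. path_after (g_time \<omega>) \<omega> n) \<and>
        bessel3_star_walk (uniform_measure Q {\<omega> \<in> space Q. \<omega> (g_time \<omega> + 1) = - 1}) 1
          (\<lambda>n \<omega>. - path_after (g_time \<omega>) \<omega> n) \<and>
        (\<forall>a b. \<P>(\<omega> in Q. num_zeros (g_time \<omega>) \<omega> = a \<and> Smax (g_time \<omega>) \<omega> = b) > 0 \<longrightarrow>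
           (\<forall>A :: int list set.
              cond_prob Q (\<lambda>\<omega>. path_upto (g_time \<omega>) \<omega> \<in> A)
                (\<lambda>\<omega>. num_zeros (g_time \<omega>) \<omega> = a \<and> Smax (g_time \<omega>) \<omega> = b) =
              cond_prob SRW (\<lambda>\<omega>. path_upto (tau_time a \<omega>) \<omega> \<in> A)
                (\<lambda>\<omega>. Smax (tau_time a \<omega>) \<omega> = b))))"
proof -
  interpret penalty \<phi> by unfold_locales (use assms in \<open>auto simp: sums_iff\<close>)
  interpret prob_penalty \<phi> by unfold_locales (use total in \<open>simp add: sums_iff\<close>)
  have law: "penalized_law \<phi> Q" if "is_Qstar \<phi> Q" for Q
  proof -
    interpret walk_law Q q_weight using that by (simp only: is_Qstar_iff)
    show ?thesis ..
  qed
  show ?thesis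
  proof (intro conjI allI ballI impI)
    show "\<exists>!Q. is_Qstar \<phi> Q" by (rule ex1_is_Qstar)
  next
    fix Q assume "is_Qstar \<phi> Q"
    then interpret penalized_law \<phi> Q by (rule law)
    show "AE \<omega> in Q. last_zero \<omega> < \<infinity> \<and> Smax_inf \<omega> = \<infinity>"
      using AE_last_zero_finite AE_Smax_inf by eventually_elim simp
    show "\<P>(\<omega> in Q. num_zeros (g_time \<omega>) \<omega> = a \<and> Smax (g_time \<omega>) \<omega> = k) =
        (if k = 0 then (if a = 1 then \<phi> 0 else 0)
         else if a = 1 then 0
         else ((1 - 1 / (real k + 1)) ^ (a - 1) - (1 - 1 / real k) ^ (a - 1)) * \<phi> k)"
      if "a \<ge> 1" for a k
      unfolding space_law by (rule measure_gamma_S[OF that])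
    show "\<P>(\<omega> in Q. Smax (g_time \<omega>) \<omega> = k) = \<phi> k" for k
      unfolding space_law by (rule measure_S)
    show "\<P>(\<omega> in Q. \<omega> (g_time \<omega> + 1) = 1) = 1 / 2" "\<P>(\<omega> in Q. \<omega> (g_time \<omega> + 1) = - 1) = 1 / 2"
      unfolding space_law by (intro first_step_after_g; simp)+
    show "bessel3_star_walk (uniform_measure Q {\<omega> \<in> space Q. \<omega> (g_time \<omega> + 1) = 1}) 1
        (\<lambda>n \<omega>. path_after (g_time \<omega>) \<omega> n)"
      using bessel_after_g[of 1] by simp
    show "bessel3_star_walk (uniform_measure Q {\<omega> \<in> space Q. \<omega> (g_time \<omega> + 1) = - 1}) 1
        (\<lambda>n \<omega>. - path_after (g_time \<omega>) \<omega> n)"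
      using bessel_after_g[of "- 1"] by simp
    show "prob_space.indep_set Q
        (sets (vimage_algebra (space Q) (\<lambda>\<omega>. path_upto (g_time \<omega>) \<omega>) (count_space UNIV)))
        (sets (vimage_algebra (space Q) (\<lambda>\<omega>. path_after (g_time \<omega>) \<omega>)
           (PiM UNIV (\<lambda>_. count_space UNIV))))"
      by (rule indep_pre_post)
    show "cond_prob Q (\<lambda>\<omega>. path_upto (g_time \<omega>) \<omega> \<in> A)
          (\<lambda>\<omega>. num_zeros (g_time \<omega>) \<omega> = a \<and> Smax (g_time \<omega>) \<omega> = b) =
        cond_prob SRW (\<lambda>\<omega>. path_upto (tau_time a \<omega>) \<omega> \<in> A) (\<lambda>\<omega>. Smax (tau_time a \<omega>) \<omega> = b)"
      if "\<P>(\<omega> in Q. num_zeros (g_time \<omega>) \<omega> = a \<and> Smax (g_time \<omega>) \<omega> = b) > 0" for a b A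
      by (rule cond_prob_pre_g[OF that])
  qed (rule penalization_limit Mstar_nonneg martingale_Mstar not_uniformly_integrable_Mstar, assumption?)+
qed

end
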